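(* The category of computads $\mathbf{Comp}$ is not locally cartesian closed, and for every integer $n>2$ the category $\mathbf{Comp}_n$ of $n$-computads is not locally cartesian closed.
   Context: All $n$-categories and $\omega$-categories are small and strict; $n\mathbf{Cat}$ is the category of $n$-categories and (strict) $n$-functors, and $\omega\mathbf{Cat}$ is the category of $\omega$-categories and (strict) $\omega$-functors. The truncation functor $tr_n$ from $(n+1)\mathbf{Cat}$ (or from $\omega\mathbf{Cat}$) to $n\mathbf{Cat}$ forgets all cells of dimension greater than $n$. For an $n$-category $A$, $A_n$ is its set of $n$-cells, and $d$, $c$ denote domain and codomain. A computad is a levelwise free higher category. The categories $\mathbf{Comp}_n$ of $n$-computads are defined inductively as (in general non-full) subcategories of $n\mathbf{Cat}$. - $\mathbf{Comp}_0=\mathbf{Set}$, the category of sets. - Suppose $\mathbf{Comp}_n$ is defined. For an $n$-computad $A$, let $\Pi_n(A)=\{\langle a,b\rangle \mid a,b\in A_n,\ d(a)=d(b),\ c(a)=c(b)\}$ be the set of parallel pairs of $n$-cells (for $n=0$ there is no condition and $\Pi_0(A)=A\times A$). This gives a functor $\Pi_n:\mathbf{Comp}_n\to\mathbf{Set}$. - Let $\mathbf{Com}_{n+1}=\mathbf{Set}\downarrow\Pi_n$ be the comma category. An object is an $n$-computad $A$ together with a set $X$ (of "$(n+1)$-indets", i.e. indeterminates or generators) and a function $\langle d,c\rangle:X\to\Pi_n(A)$. A morphism is a morphism of $n$-computads together with a function between the sets of $(n+1)$-indets, compatible with the structure functions. - Let $\mathbf{CCat}_{n+1}$ be the category whose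 objects are the $(n+1)$-categories $B$ with $tr_n(B)$ an $n$-computad, and whose morphisms are the $(n+1)$-functors $f$ with $tr_n(f)$ a morphism of $\mathbf{Comp}_n$. - The forgetful functor $U_{n+1}:\mathbf{CCat}_{n+1}\to\mathbf{Com}_{n+1}$ sends $B$ to $tr_n(B)$ together with the set $B_{n+1}$ and its domain and codomain functions (it forgets compositions and identities at level $n+1$). It has a left adjoint $F_{n+1}$, the free $(n+1)$-category functor. - $\mathbf{Comp}_{n+1}$ is the essential (non-full) image of $F_{n+1}$ in $\mathbf{CCat}_{n+1}$. That is, the $(n+1)$-computads are the $(n+1)$-categories isomorphic in $\mathbf{CCat}_{n+1}$ to one of the form $F_{n+1}(A,X\to\Pi_n(A))$, and the morphisms of $(n+1)$-computads are the $(n+1)$-functors sending indets to indets (in every dimension). After restricting its codomain, $F_{n+1}$ becomes an equivalence of categories $\mathbf{Com}_{n+1}\simeq\mathbf{Comp}_{n+1}$. The category of computads $\mathbf{Comp}$ is the (non-full) subcategory of $\omega\mathbf{Cat}$ consisting of those $\omega$-categories and $\omega$-functors whose truncation to $n\mathbf{Cat}$ lies in $\mathbf{Comp}_n$ for every $n$. A category is locally cartesian closed if each of its slice categories is cartesian closed. *)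

theory Defs
  imports "HOL-Library.Extended_Nat" "HOL-Library.FuncSet"
begin

unbundle cardinal_syntax

section \<open>Categories and local cartesian closedness\<close>

text \<open>\<open>Cmp C a b c g f\<close> is the composite of \<open>f : a \<rightarrow> b\<close> and \<open>g : b \<rightarrow> c\<close>. The objects are
  arguments because morphisms below are functions that do not record their domain.\<close>

record ('o, 'm) cat =
  Obj :: "'o set"
  Hom :: "'o \<Rightarrow> 'o \<Rightarrow> 'm set"
  Ident :: "'o \<Rightarrow> 'm"
  Cmp :: "'o \<Rightarrow> 'o \<Rightarrow> 'o \<Rightarrow> 'm \<Rightarrow> 'm \<Rightarrow> 'm"

definition slice :: "('o, 'm) cat \<Rightarrow> 'o \<Rightarrow> ('o \<times> 'm, 'm) cat" where
  "slice C z = \<lparr>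
    Obj = {(a, p). a \<in> Obj C \<and> p \<in> Hom C a z},
    Hom = (\<lambda>(a, p) (b, q). {h \<in> Hom C a b. Cmp C a b z q h = p}),
    Ident = (\<lambda>(a, p). Ident C a),
    Cmp = (\<lambda>(a, p) (b, q) (c, r). Cmp C a b c) \<rparr>"

definition is_terminal :: "('o, 'm) cat \<Rightarrow> 'o \<Rightarrow> bool" where
  "is_terminal C t \<longleftrightarrow> t \<in> Obj C \<and> (\<forall>a\<in>Obj C. \<exists>!f. f \<in> Hom C a t)"

definition is_product :: "('o, 'm) cat \<Rightarrow> 'o \<Rightarrow> 'o \<Rightarrow> 'o \<Rightarrow> 'm \<Rightarrow> 'm \<Rightarrow> bool" where
  "is_product C a b p \<pi>1 \<pi>2 \<longleftrightarrow>
    p \<in> Obj C \<and> \<pi>1 \<in> Hom C p a \<and> \<pi>2 \<in> Hom C p b \<and>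
    (\<forall>x\<in>Obj C. \<forall>f\<in>Hom C x a. \<forall>g\<in>Hom C x b.
       \<exists>!h. h \<in> Hom C x p \<and> Cmp C x p a \<pi>1 h = f \<and> Cmp C x p b \<pi>2 h = g)"

text \<open>\<open>(e, ev : p \<rightarrow> c)\<close> is an exponential of \<open>c\<close> by \<open>b\<close>, where \<open>p\<close> is a product of \<open>e\<close> and \<open>b\<close>:
  every \<open>f : x \<times> b \<rightarrow> c\<close> is \<open>ev \<circ> (g \<times> b)\<close> for exactly one \<open>g : x \<rightarrow> e\<close>. The \<open>h\<close> below
  is \<open>g \<times> b\<close>.\<close>

definition is_exponential ::
    "('o, 'm) cat \<Rightarrow> 'o \<Rightarrow> 'o \<Rightarrow> 'o \<Rightarrow> 'o \<Rightarrow> 'm \<Rightarrow> 'm \<Rightarrow> 'm \<Rightarrow> bool" where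
  "is_exponential C b c e p \<pi>1 \<pi>2 ev \<longleftrightarrow>
    e \<in> Obj C \<and> is_product C e b p \<pi>1 \<pi>2 \<and> ev \<in> Hom C p c \<and>
    (\<forall>x\<in>Obj C. \<forall>q \<rho>1 \<rho>2. is_product C x b q \<rho>1 \<rho>2 \<longrightarrow>
      (\<forall>f\<in>Hom C q c. \<exists>!g. g \<in> Hom C x e \<and>
        (\<exists>h\<in>Hom C q p. Cmp C q p e \<pi>1 h = Cmp C q x e g \<rho>1 \<and> Cmp C q p b \<pi>2 h = \<rho>2 \<and>
           Cmp C q p c ev h = f)))"

definition cartesian_closed :: "('o, 'm) cat \<Rightarrow> bool" where
  "cartesian_closed C \<longleftrightarrow>
    (\<exists>t. is_terminal C t) \<and>
    (\<forall>a\<in>Obj C. \<forall>b\<in>Obj C. \<exists>p \<pi>1 \<pi>2. is_product C a b p \<pi>1 \<pi>2) \<and>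
    (\<forall>b\<in>Obj C. \<forall>c\<in>Obj C. \<exists>e p \<pi>1 \<pi>2 ev. is_exponential C b c e p \<pi>1 \<pi>2 ev)"

definition locally_cartesian_closed :: "('o, 'm) cat \<Rightarrow> bool" where
  "locally_cartesian_closed C \<longleftrightarrow> (\<forall>z\<in>Obj C. cartesian_closed (slice C z))"


section \<open>Strict higher categories\<close>

text \<open>\<open>dm A k\<close>, \<open>cd A k\<close> map \<open>(k+1)\<close>-cells to \<open>k\<close>-cells, \<open>idt A k\<close> maps \<open>k\<close>-cells to
  \<open>(k+1)\<close>-cells, and \<open>hcmp A k j x y\<close> (for \<open>j < k\<close>) is the composite of the \<open>k\<close>-cells \<open>x\<close> and \<open>y\<close>
  along \<open>j\<close>-cells, in applicative order (\<open>y\<close> first). Values outside the cells are irrelevant.\<close>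

record 'u ncat =
  cells :: "nat \<Rightarrow> 'u set"
  dm :: "nat \<Rightarrow> 'u \<Rightarrow> 'u"
  cd :: "nat \<Rightarrow> 'u \<Rightarrow> 'u"
  idt :: "nat \<Rightarrow> 'u \<Rightarrow> 'u"
  hcmp :: "nat \<Rightarrow> nat \<Rightarrow> 'u \<Rightarrow> 'u \<Rightarrow> 'u"

text \<open>Iterated operations between the dimensions \<open>j\<close> and \<open>j + m\<close>.\<close>

primrec idm :: "'u ncat \<Rightarrow> nat \<Rightarrow> nat \<Rightarrow> 'u \<Rightarrow> 'u" where
  "idm A j 0 x = x"
| "idm A j (Suc m) x = idm A j m (dm A (j + m) x)"

primrec icd :: "'u ncat \<Rightarrow> nat \<Rightarrow> nat \<Rightarrow> 'u \<Rightarrow> 'u" where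
  "icd A j 0 x = x"
| "icd A j (Suc m) x = icd A j m (cd A (j + m) x)"

primrec iidt :: "'u ncat \<Rightarrow> nat \<Rightarrow> nat \<Rightarrow> 'u \<Rightarrow> 'u" where
  "iidt A j 0 x = x"
| "iidt A j (Suc m) x = idt A (j + m) (iidt A j m x)"

definition composable :: "'u ncat \<Rightarrow> nat \<Rightarrow> nat \<Rightarrow> 'u \<Rightarrow> 'u \<Rightarrow> bool" where
  "composable A k j x y \<longleftrightarrow>
    j < k \<and> x \<in> cells A k \<and> y \<in> cells A k \<and> idm A j (k - j) x = icd A j (k - j) y"

text \<open>Strict \<open>n\<close>-categories; \<open>n = \<infinity>\<close> gives strict \<open>\<omega>\<close>-categories.\<close>

definition is_ncat :: "enat \<Rightarrow> 'u ncat \<Rightarrow> bool" where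
  "is_ncat n A \<longleftrightarrow>
    (\<forall>k. n < enat k \<longrightarrow> cells A k = {}) \<and>
    \<comment> \<open>globular structure\<close>
    (\<forall>k. \<forall>x\<in>cells A (Suc k). dm A k x \<in> cells A k \<and> cd A k x \<in> cells A k) \<and>
    (\<forall>k. \<forall>x\<in>cells A (Suc (Suc k)).
       dm A k (dm A (Suc k) x) = dm A k (cd A (Suc k) x) \<and>
       cd A k (dm A (Suc k) x) = cd A k (cd A (Suc k) x)) \<and>
    \<comment> \<open>identities: domains and codomains\<close>
    (\<forall>k. enat (Suc k) \<le> n \<longrightarrow> (\<forall>x\<in>cells A k.
       idt A k x \<in> cells A (Suc k) \<and> dm A k (idt A k x) = x \<and> cd A k (idt A k x) = x)) \<and>
    \<comment> \<open>composites: domains and codomains\<close>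
    (\<forall>k j x y. composable A k j x y \<longrightarrow> hcmp A k j x y \<in> cells A k) \<and>
    (\<forall>k x y. composable A (Suc k) k x y \<longrightarrow>
       dm A k (hcmp A (Suc k) k x y) = dm A k y \<and>
       cd A k (hcmp A (Suc k) k x y) = cd A k x) \<and>
    (\<forall>k j x y. composable A (Suc k) j x y \<and> j < k \<longrightarrow>
       dm A k (hcmp A (Suc k) j x y) = hcmp A k j (dm A k x) (dm A k y) \<and>
       cd A k (hcmp A (Suc k) j x y) = hcmp A k j (cd A k x) (cd A k y)) \<and>
    \<comment> \<open>unit and associativity laws\<close>
    (\<forall>k j. j < k \<longrightarrow> (\<forall>x\<in>cells A k.
       hcmp A k j x (iidt A j (k - j) (idm A j (k - j) x)) = x \<and>
       hcmp A k j (iidt A j (k - j) (icd A j (k - j) x)) x = x)) \<and>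
    (\<forall>k j x y z. composable A k j x y \<and> composable A k j y z \<longrightarrow>
       hcmp A k j (hcmp A k j x y) z = hcmp A k j x (hcmp A k j y z)) \<and>
    \<comment> \<open>binary and nullary interchange\<close>
    (\<forall>k j i x y z w. i < j \<and>
       composable A k j x y \<and> composable A k j z w \<and>
       composable A k i x z \<and> composable A k i y w \<longrightarrow>
       hcmp A k i (hcmp A k j x y) (hcmp A k j z w) =
       hcmp A k j (hcmp A k i x z) (hcmp A k i y w)) \<and>
    (\<forall>k j x y. enat (Suc k) \<le> n \<and> composable A k j x y \<longrightarrow>
       idt A k (hcmp A k j x y) = hcmp A (Suc k) j (idt A k x) (idt A k y))"

type_synonym 'u nmap = "nat \<Rightarrow> 'u \<Rightarrow> 'u"

text \<open>Strict functors. They are extensional (\<open>undefined\<close> outside the cells of the domain), so that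
  equality of functors is equality in HOL.\<close>

definition nfunctors :: "enat \<Rightarrow> 'u ncat \<Rightarrow> 'u ncat \<Rightarrow> 'u nmap set" where
  "nfunctors n A B = {f.
    (\<forall>k. f k \<in> cells A k \<rightarrow>\<^sub>E cells B k) \<and>
    (\<forall>k. \<forall>x\<in>cells A (Suc k).
       f k (dm A k x) = dm B k (f (Suc k) x) \<and> f k (cd A k x) = cd B k (f (Suc k) x)) \<and>
    (\<forall>k. enat (Suc k) \<le> n \<longrightarrow> (\<forall>x\<in>cells A k. f (Suc k) (idt A k x) = idt B k (f k x))) \<and>
    (\<forall>k j x y. composable A k j x y \<longrightarrow> f k (hcmp A k j x y) = hcmp B k j (f k x) (f k y))}"

definition nid :: "'u ncat \<Rightarrow> 'u nmap" where
  "nid A = (\<lambda>k. restrict (\<lambda>x. x) (cells A k))"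

definition ncompose :: "'u ncat \<Rightarrow> 'u nmap \<Rightarrow> 'u nmap \<Rightarrow> 'u nmap" where
  "ncompose A g f = (\<lambda>k. compose (cells A k) (g k) (f k))"

text \<open>Smallness is relative to a cardinal \<open>\<kappa>\<close> on the type \<open>'u\<close> of all cells: a set is small if it has
  fewer than \<open>\<kappa>\<close> elements. Every set with fewer than \<open>\<kappa>\<close> elements has a copy in \<open>'u\<close>. For \<open>\<kappa>\<close>
  strongly inaccessible, these are, up to bijection, the sets of a Grothendieck universe. The
  left adjoint \<open>F\<close> below exists as soon as \<open>\<kappa>\<close> is uncountable (a free category on finite data
  can be countably infinite, so countable sets must be small).\<close>

definition nCat :: "'u rel \<Rightarrow> enat \<Rightarrow> ('u ncat, 'u nmap) cat" where
  "nCat \<kappa> n = \<lparr>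
    Obj = {A. is_ncat n A \<and> (\<forall>k. |cells A k| <o \<kappa>)},
    Hom = nfunctors n,
    Ident = nid,
    Cmp = (\<lambda>A B C. ncompose A) \<rparr>"

definition trunc :: "nat \<Rightarrow> 'u ncat \<Rightarrow> 'u ncat" where
  "trunc n A = A\<lparr>cells := (\<lambda>k. if k \<le> n then cells A k else {})\<rparr>"

definition trunc_map :: "nat \<Rightarrow> 'u nmap \<Rightarrow> 'u nmap" where
  "trunc_map n f = (\<lambda>k. if k \<le> n then f k else (\<lambda>_. undefined))"


section \<open>Computads\<close>

definition parallel :: "nat \<Rightarrow> 'u ncat \<Rightarrow> ('u \<times> 'u) set" where
  "parallel n A = {(a, b). a \<in> cells A n \<and> b \<in> cells A n \<and>
    (\<forall>m. n = Suc m \<longrightarrow> dm A m a = dm A m b \<and> cd A m a = cd A m b)}"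

text \<open>In this section \<open>K\<close> stands for the category of \<open>n\<close>-computads. An object of the comma category
  \<open>Set \<down> \<Pi>\<^sub>n\<close> is a triple of an object \<open>A\<close> of \<open>K\<close>, a small set \<open>X\<close> and a function from \<open>X\<close> to
  parallel pairs.\<close>

type_synonym 'u com = "'u ncat \<times> 'u set \<times> ('u \<Rightarrow> 'u \<times> 'u)"

definition Com :: "'u rel \<Rightarrow> nat \<Rightarrow> ('u ncat, 'u nmap) cat \<Rightarrow> ('u com, 'u nmap \<times> ('u \<Rightarrow> 'u)) cat" where
  "Com \<kappa> n K = \<lparr>
    Obj = {(A, X, \<delta>). A \<in> Obj K \<and> |X| <o \<kappa> \<and> \<delta> \<in> X \<rightarrow>\<^sub>E parallel n A},
    Hom = (\<lambda>(A, X, \<delta>) (B, Y, \<epsilon>). {(f, h). f \<in> Hom K A B \<and> h \<in> X \<rightarrow>\<^sub>E Y \<and>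
      (\<forall>x\<in>X. \<epsilon> (h x) = map_prod (f n) (f n) (\<delta> x))}),
    Ident = (\<lambda>(A, X, \<delta>). (Ident K A, restrict (\<lambda>x. x) X)),
    Cmp = (\<lambda>(A, X, \<delta>) (B, Y, \<epsilon>) (C, Z, \<zeta>) (g, i) (f, h). (Cmp K A B C g f, compose X i h)) \<rparr>"

definition CCat :: "'u rel \<Rightarrow> nat \<Rightarrow> ('u ncat, 'u nmap) cat \<Rightarrow> ('u ncat, 'u nmap) cat" where
  "CCat \<kappa> n K = (nCat \<kappa> (enat (Suc n)))\<lparr>
    Obj := {B \<in> Obj (nCat \<kappa> (enat (Suc n))). trunc n B \<in> Obj K},
    Hom := (\<lambda>B C. {f \<in> Hom (nCat \<kappa> (enat (Suc n))) B C.
      trunc_map n f \<in> Hom K (trunc n B) (trunc n C)})\<rparr>"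

text \<open>The forgetful functor from \<open>CCat\<close> to \<open>Com\<close>, on objects and on morphisms.\<close>

definition U_obj :: "nat \<Rightarrow> 'u ncat \<Rightarrow> 'u com" where
  "U_obj n B = (trunc n B, cells B (Suc n), restrict (\<lambda>x. (dm B n x, cd B n x)) (cells B (Suc n)))"

definition U_map :: "nat \<Rightarrow> 'u nmap \<Rightarrow> 'u nmap \<times> ('u \<Rightarrow> 'u)" where
  "U_map n f = (trunc_map n f, f (Suc n))"

text \<open>\<open>\<eta> : P \<rightarrow> U B\<close> is a universal arrow, that is, it exhibits \<open>B\<close> as a value \<open>F P\<close> of the left
  adjoint \<open>F\<close> of \<open>U\<close>. Since \<open>F P\<close> is only determined up to isomorphism in \<open>CCat\<close>, an object \<open>B\<close> is
  isomorphic to \<open>F P\<close> iff there is such an \<open>\<eta>\<close>.\<close>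

definition is_free_on :: "'u rel \<Rightarrow> nat \<Rightarrow> ('u ncat, 'u nmap) cat \<Rightarrow>
    'u ncat \<Rightarrow> 'u com \<Rightarrow> 'u nmap \<times> ('u \<Rightarrow> 'u) \<Rightarrow> bool" where
  "is_free_on \<kappa> n K B P \<eta> \<longleftrightarrow>
    B \<in> Obj (CCat \<kappa> n K) \<and> P \<in> Obj (Com \<kappa> n K) \<and> \<eta> \<in> Hom (Com \<kappa> n K) P (U_obj n B) \<and>
    (\<forall>C\<in>Obj (CCat \<kappa> n K). \<forall>g\<in>Hom (Com \<kappa> n K) P (U_obj n C).
      \<exists>!f. f \<in> Hom (CCat \<kappa> n K) B C \<and>
        Cmp (Com \<kappa> n K) P (U_obj n B) (U_obj n C) (U_map n f) \<eta> = g)"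

text \<open>The \<open>(n+1)\<close>-indets of \<open>B\<close>, as cells of \<open>B\<close>. (All presentations of \<open>B\<close> as a free
  \<open>(n+1)\<close>-category give the same set; the union avoids choosing one.)\<close>

definition indets :: "'u rel \<Rightarrow> nat \<Rightarrow> ('u ncat, 'u nmap) cat \<Rightarrow> 'u ncat \<Rightarrow> 'u set" where
  "indets \<kappa> n K B = \<Union> {h ` X | A X \<delta> f h. is_free_on \<kappa> n K B (A, X, \<delta>) (f, h)}"

primrec nComp :: "'u rel \<Rightarrow> nat \<Rightarrow> ('u ncat, 'u nmap) cat" where
  "nComp \<kappa> 0 = nCat \<kappa> 0"
| "nComp \<kappa> (Suc n) = (CCat \<kappa> n (nComp \<kappa> n))\<lparr>
    Obj := {B. \<exists>P \<eta>. is_free_on \<kappa> n (nComp \<kappa> n) B P \<eta>},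
    Hom := (\<lambda>B C. {f \<in> Hom (CCat \<kappa> n (nComp \<kappa> n)) B C.
      f (Suc n) ` indets \<kappa> n (nComp \<kappa> n) B \<subseteq> indets \<kappa> n (nComp \<kappa> n) C})\<rparr>"

definition Comp :: "'u rel \<Rightarrow> ('u ncat, 'u nmap) cat" where
  "Comp \<kappa> = (nCat \<kappa> \<infinity>)\<lparr>
    Obj := {A \<in> Obj (nCat \<kappa> \<infinity>). \<forall>n. trunc n A \<in> Obj (nComp \<kappa> n)},
    Hom := (\<lambda>A B. {f \<in> Hom (nCat \<kappa> \<infinity>) A B.
      \<forall>n. trunc_map n f \<in> Hom (nComp \<kappa> n) (trunc n A) (trunc n B)})\<rparr>"

end

theory Submission
  imports Defs "HOL-Library.Multiset" "HOL-Library.Countable"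
begin

text \<open>The obstruction lives in dimension 3. In a computad with one 0-cell and no 1-indets the
  2-cells all have the identity 1-cell as boundary, so by the Eckmann--Hilton argument they form the
  free commutative monoid on the 2-indets, and a 3-indet is a pair of finite multisets of 2-indets.
  Such 3-computads are thus Petri nets: the 2-indets are the places and the 3-indets the transitions.
  Multisets are where pullbacks go wrong: if a transition of \<open>P\<close> and a transition of \<open>Q\<close> lie over the
  same transition of \<open>Z\<close>, then the transitions of \<open>P \<times>\<^sub>Z Q\<close> over the two correspond to the ways of
  matching their inputs, and there may be several.

  Let \<open>P\<close> have two places \<open>0, 1\<close> and one transition, which consumes \<open>0 + 1\<close> and produces nothing. Let
  \<open>Z\<close> be obtained from \<open>P\<close> by identifying the two places, so that its transition consumes \<open>0 + 0\<close>. With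
  \<open>D\<close> the net of one place and no transition, \<open>P \<rightarrow> Z\<close> is the coequalizer of the two maps \<open>D \<rightarrow> P\<close>
  (\<open>collapse_coequalizes\<close>). If \<open>P\<close> were exponentiable over \<open>Z\<close>, then every map \<open>f\<close> out of \<open>P \<times>\<^sub>Z P\<close>
  that takes the same values along the two maps \<open>D \<times>\<^sub>Z P \<rightarrow> P \<times>\<^sub>Z P\<close> would factor through the second
  projection (\<open>exponential_factors_through_projection\<close>). But \<open>P \<times>\<^sub>Z P\<close> has two transitions, consuming
  \<open>(0,0) + (1,1)\<close> and \<open>(0,1) + (1,0)\<close>. Let \<open>W\<close> be \<open>P\<close> with its transition doubled, and let \<open>f\<close> be the
  second projection on places and separate the two transitions (\<open>separating_map\<close>). As \<open>D \<times>\<^sub>Z P\<close> has no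
  transitions, \<open>f\<close> takes the same values along the two maps. It does not factor: the diagonal of
  \<open>P\<close> and the graph of the automorphism exchanging the places hit different transitions of
  \<open>P \<times>\<^sub>Z P\<close>, which have the same second projection.

  The product is never constructed. All that is used about it is that each of its dimensions is free
  over the preceding one, in the form of two consequences. Its cells are generated by indets and
  identities (\<open>free_generated\<close>). And any assignment of natural numbers to indets extends to an
  additive function on cells (\<open>free_weight\<close>); this is the universal property applied to the category
  obtained by labelling the top cells with numbers. A weight on 2-cells counts the places over \<open>(0,0)\<close>, which
  tells the two matchings apart, and weights on 3-cells count the two kinds of transitions; \<open>f\<close> is
  defined from these. That Petri nets are computads is \<open>net_free\<close>, where maps into an arbitrary
  category are constructed in commutative monoids supplied by the Eckmann--Hilton argument.

  Maps of computads send indets to indets, so computads over \<open>Z\<close> have no indets above dimension 3,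
  their higher cells are identities, and functors out of them are determined by, and extend from,
  dimension 3 (\<open>idle_functors_eq\<close>, \<open>idle_extend_functor\<close>). This makes the argument uniform in the
  dimension, including the case of \<open>\<omega>\<close>-categories.\<close>


section \<open>Exponentials in a category\<close>

locale category =
  fixes C :: "('o, 'm) cat"
  assumes comp_in: "\<lbrakk>a \<in> Obj C; b \<in> Obj C; c \<in> Obj C; f \<in> Hom C a b; g \<in> Hom C b c\<rbrakk>
      \<Longrightarrow> Cmp C a b c g f \<in> Hom C a c"
    and comp_assoc: "\<lbrakk>a \<in> Obj C; b \<in> Obj C; c \<in> Obj C; d \<in> Obj C;
        f \<in> Hom C a b; g \<in> Hom C b c; h \<in> Hom C c d\<rbrakk>
      \<Longrightarrow> Cmp C a b d (Cmp C b c d h g) f = Cmp C a c d h (Cmp C a b c g f)"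
    and id_in: "a \<in> Obj C \<Longrightarrow> Ident C a \<in> Hom C a a"
    and id_left: "\<lbrakk>a \<in> Obj C; b \<in> Obj C; f \<in> Hom C a b\<rbrakk> \<Longrightarrow> Cmp C a b b (Ident C b) f = f"
    and id_right: "\<lbrakk>a \<in> Obj C; b \<in> Obj C; f \<in> Hom C a b\<rbrakk> \<Longrightarrow> Cmp C a a b f (Ident C a) = f"

lemma slice_category:
  assumes "category C" and z: "z \<in> Obj C"
  shows "category (slice C z)"
proof -
  interpret category C by fact
  show ?thesis
  proof
    fix a b c f g
    assume "a \<in> Obj (slice C z)" "b \<in> Obj (slice C z)" "c \<in> Obj (slice C z)"
      "f \<in> Hom (slice C z) a b" "g \<in> Hom (slice C z) b c"
    then show "Cmp (slice C z) a b c g f \<in> Hom (slice C z) a c"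
      using z by (auto simp: slice_def comp_in simp flip: comp_assoc)
  next
    fix a b c d f g h
    assume "a \<in> Obj (slice C z)" "b \<in> Obj (slice C z)" "c \<in> Obj (slice C z)" "d \<in> Obj (slice C z)"
      "f \<in> Hom (slice C z) a b" "g \<in> Hom (slice C z) b c" "h \<in> Hom (slice C z) c d"
    then show "Cmp (slice C z) a b d (Cmp (slice C z) b c d h g) f =
        Cmp (slice C z) a c d h (Cmp (slice C z) a b c g f)"
      by (auto simp: slice_def intro: comp_assoc)
  qed (use z in \<open>auto simp: slice_def id_in id_left id_right\<close>)
qed

lemma (in category) product_pairing:
  assumes "is_product C a b p \<pi>1 \<pi>2" "x \<in> Obj C" "f \<in> Hom C x a" "g \<in> Hom C x b"
  obtains h where "h \<in> Hom C x p" "Cmp C x p a \<pi>1 h = f" "Cmp C x p b \<pi>2 h = g"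
  using assms unfolding is_product_def by metis

lemma (in category) product_ext:
  assumes "is_product C a b p \<pi>1 \<pi>2" "a \<in> Obj C" "b \<in> Obj C" "x \<in> Obj C"
    "h \<in> Hom C x p" "h' \<in> Hom C x p"
    "Cmp C x p a \<pi>1 h = Cmp C x p a \<pi>1 h'" "Cmp C x p b \<pi>2 h = Cmp C x p b \<pi>2 h'"
  shows "h = h'"
proof -
  have p: "p \<in> Obj C" "\<pi>1 \<in> Hom C p a" "\<pi>2 \<in> Hom C p b"
    using assms(1) unfolding is_product_def by auto
  then have "\<exists>!k. k \<in> Hom C x p \<and> Cmp C x p a \<pi>1 k = Cmp C x p a \<pi>1 h \<and>
      Cmp C x p b \<pi>2 k = Cmp C x p b \<pi>2 h"
    using assms(1-5) comp_in unfolding is_product_def by blast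
  then show ?thesis using assms(5-8) by metis
qed

text \<open>An exponentiable \<open>b\<close> makes \<open>- \<times> b\<close> preserve colimits; this is the instance for a coequalizer
  \<open>r\<close> of \<open>i\<close> and \<open>j\<close> with terminal target. The transpose \<open>g\<close> of \<open>f\<close> coequalizes \<open>i\<close> and \<open>j\<close>, because the
  transposes of \<open>f \<circ> (i \<times> b)\<close> and \<open>f \<circ> (j \<times> b)\<close> are unique. So \<open>g\<close> factors through \<open>r\<close>, and transposing
  back \<open>f\<close> factors through \<open>z \<times> b = b\<close>. The equation \<open>r \<circ> \<rho>1 = s \<circ> \<rho>2\<close> holds when
  \<open>z\<close> is terminal.\<close>

lemma (in category) exponential_factors_through_projection:
  assumes obj: "x \<in> Obj C" "d \<in> Obj C" "b \<in> Obj C" "c \<in> Obj C" "z \<in> Obj C"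
    and i: "i \<in> Hom C d x" and j: "j \<in> Hom C d x" and r: "r \<in> Hom C x z" and s: "s \<in> Hom C b z"
    and coeq: "\<And>e g. \<lbrakk>e \<in> Obj C; g \<in> Hom C x e; Cmp C d x e g i = Cmp C d x e g j\<rbrakk>
      \<Longrightarrow> \<exists>g'\<in>Hom C z e. Cmp C x z e g' r = g"
    and ex: "is_exponential C b c e p \<pi>1 \<pi>2 ev"
    and q: "is_product C x b q \<rho>1 \<rho>2"
    and sq: "Cmp C q x z r \<rho>1 = Cmp C q b z s \<rho>2"
    and dq: "is_product C d b dq \<sigma>1 \<sigma>2"
    and f: "f \<in> Hom C q c"
    and fuv: "\<And>u v. \<lbrakk>u \<in> Hom C dq q; v \<in> Hom C dq q;
        Cmp C dq q x \<rho>1 u = Cmp C dq d x i \<sigma>1; Cmp C dq q b \<rho>2 u = \<sigma>2;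
        Cmp C dq q x \<rho>1 v = Cmp C dq d x j \<sigma>1; Cmp C dq q b \<rho>2 v = \<sigma>2\<rbrakk>
      \<Longrightarrow> Cmp C dq q c f u = Cmp C dq q c f v"
  shows "\<exists>k\<in>Hom C b c. f = Cmp C q b c k \<rho>2"
proof -
  have e: "e \<in> Obj C" and p: "is_product C e b p \<pi>1 \<pi>2" and ev: "ev \<in> Hom C p c"
    using ex unfolding is_exponential_def by auto
  have pO: "p \<in> Obj C" "\<pi>1 \<in> Hom C p e" "\<pi>2 \<in> Hom C p b"
    using p unfolding is_product_def by auto
  have qO: "q \<in> Obj C" "\<rho>1 \<in> Hom C q x" "\<rho>2 \<in> Hom C q b"
    using q unfolding is_product_def by auto
  have dO: "dq \<in> Obj C" "\<sigma>1 \<in> Hom C dq d" "\<sigma>2 \<in> Hom C dq b"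
    using dq unfolding is_product_def by auto
  \<comment> \<open>The transpose \<open>g\<close> of \<open>f\<close>, with \<open>h = g \<times> b\<close>.\<close>
  obtain g h where g: "g \<in> Hom C x e" and h: "h \<in> Hom C q p"
    and h1: "Cmp C q p e \<pi>1 h = Cmp C q x e g \<rho>1" and h2: "Cmp C q p b \<pi>2 h = \<rho>2"
    and h3: "Cmp C q p c ev h = f"
    using ex obj(1) q f unfolding is_exponential_def by metis
  have is1: "Cmp C dq d x i \<sigma>1 \<in> Hom C dq x" and js1: "Cmp C dq d x j \<sigma>1 \<in> Hom C dq x"
    using comp_in i j dO obj by blast+
  \<comment> \<open>\<open>u = i \<times> b\<close> and \<open>v = j \<times> b\<close>.\<close>
  obtain u where u: "u \<in> Hom C dq q" "Cmp C dq q x \<rho>1 u = Cmp C dq d x i \<sigma>1"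
      "Cmp C dq q b \<rho>2 u = \<sigma>2"
    using product_pairing[OF q dO(1) is1 dO(3)] by blast
  obtain v where v: "v \<in> Hom C dq q" "Cmp C dq q x \<rho>1 v = Cmp C dq d x j \<sigma>1"
      "Cmp C dq q b \<rho>2 v = \<sigma>2"
    using product_pairing[OF q dO(1) js1 dO(3)] by blast
  have tr: "Cmp C dq p e \<pi>1 (Cmp C dq q p h w) = Cmp C dq d e (Cmp C d x e g l) \<sigma>1 \<and>
      Cmp C dq p b \<pi>2 (Cmp C dq q p h w) = \<sigma>2 \<and>
      Cmp C dq p c ev (Cmp C dq q p h w) = Cmp C dq q c f w \<and> Cmp C dq q p h w \<in> Hom C dq p"
    if w: "w \<in> Hom C dq q" "Cmp C dq q x \<rho>1 w = Cmp C dq d x l \<sigma>1" "Cmp C dq q b \<rho>2 w = \<sigma>2"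
      and l: "l \<in> Hom C d x" for w l
  proof -
    have "Cmp C dq p e \<pi>1 (Cmp C dq q p h w) = Cmp C dq q e (Cmp C q p e \<pi>1 h) w"
      by (rule comp_assoc[symmetric]) (use w h pO qO dO e in auto)
    also have "\<dots> = Cmp C dq x e g (Cmp C dq q x \<rho>1 w)"
      unfolding h1 by (rule comp_assoc) (use w g qO dO e obj in auto)
    also have "\<dots> = Cmp C dq d e (Cmp C d x e g l) \<sigma>1"
      unfolding w(2) by (rule comp_assoc[symmetric]) (use l g dO e obj in auto)
    finally have 1: "Cmp C dq p e \<pi>1 (Cmp C dq q p h w) = Cmp C dq d e (Cmp C d x e g l) \<sigma>1" .
    have 2: "Cmp C dq p b \<pi>2 (Cmp C dq q p h w) = Cmp C dq q b (Cmp C q p b \<pi>2 h) w"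
      by (rule comp_assoc[symmetric]) (use w h pO qO dO obj in auto)
    have 3: "Cmp C dq p c ev (Cmp C dq q p h w) = Cmp C dq q c (Cmp C q p c ev h) w"
      by (rule comp_assoc[symmetric]) (use w h pO qO dO obj ev in auto)
    show ?thesis using 1 2 3 h2 h3 w(3) comp_in[OF dO(1) qO(1) pO(1) w(1) h] by simp
  qed
  have eqf: "Cmp C dq q c f u = Cmp C dq q c f v" using fuv u v by blast
  have fu: "Cmp C dq q c f u \<in> Hom C dq c" using comp_in dO qO obj u f by blast
  have "\<exists>!g. g \<in> Hom C d e \<and> (\<exists>h\<in>Hom C dq p. Cmp C dq p e \<pi>1 h = Cmp C dq d e g \<sigma>1 \<and>
      Cmp C dq p b \<pi>2 h = \<sigma>2 \<and> Cmp C dq p c ev h = Cmp C dq q c f u)"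
    using ex obj(2) dq fu unfolding is_exponential_def by blast
  moreover have "Cmp C d x e g i \<in> Hom C d e" "Cmp C d x e g j \<in> Hom C d e"
    using comp_in obj e i j g by blast+
  ultimately have "Cmp C d x e g i = Cmp C d x e g j"
    using tr[OF u i] tr[OF v j] eqf by metis
  then obtain g' where g': "g' \<in> Hom C z e" "Cmp C x z e g' r = g"
    using coeq e g by blast
  have gs: "Cmp C b z e g' s \<in> Hom C b e" using comp_in obj e g' s by blast
  \<comment> \<open>\<open>k\<close> is \<open>g' \<times> b\<close> restricted along \<open>(s, id) : b \<rightarrow> z \<times> b\<close>.\<close>
  obtain k where k: "k \<in> Hom C b p" "Cmp C b p e \<pi>1 k = Cmp C b z e g' s"
      "Cmp C b p b \<pi>2 k = Ident C b"
    using product_pairing[OF p obj(3) gs id_in[OF obj(3)]] by blast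
  have "h = Cmp C q b p k \<rho>2"
  proof (rule product_ext[OF p e obj(3) qO(1) h])
    show "Cmp C q b p k \<rho>2 \<in> Hom C q p" using comp_in k qO pO obj by blast
    have "Cmp C q p e \<pi>1 h = Cmp C q z e g' (Cmp C q x z r \<rho>1)"
      unfolding h1 g'(2)[symmetric] by (rule comp_assoc) (use g' r qO obj e in auto)
    also have "\<dots> = Cmp C q b e (Cmp C b z e g' s) \<rho>2"
      unfolding sq by (rule comp_assoc[symmetric]) (use g' s qO obj e in auto)
    also have "\<dots> = Cmp C q p e \<pi>1 (Cmp C q b p k \<rho>2)"
      unfolding k(2)[symmetric] by (rule comp_assoc) (use k qO pO obj e in auto)
    finally show "Cmp C q p e \<pi>1 h = Cmp C q p e \<pi>1 (Cmp C q b p k \<rho>2)" .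
    have "Cmp C q p b \<pi>2 (Cmp C q b p k \<rho>2) = Cmp C q b b (Cmp C b p b \<pi>2 k) \<rho>2"
      by (rule comp_assoc[symmetric]) (use k qO pO obj in auto)
    then show "Cmp C q p b \<pi>2 h = Cmp C q p b \<pi>2 (Cmp C q b p k \<rho>2)"
      using k h2 id_left[OF qO(1) obj(3) qO(3)] by simp
  qed
  then have "f = Cmp C q b c (Cmp C b p c ev k) \<rho>2"
    unfolding h3[symmetric] using comp_assoc[OF qO(1) obj(3) pO(1) obj(4) qO(3) k(1) ev] by simp
  then show ?thesis using comp_in k ev pO obj by blast
qed


section \<open>Strict higher categories and functors\<close>

lemma is_ncatI:
  assumes "\<And>k. n < enat k \<Longrightarrow> cells A k = {}"
    and "\<And>k x. x \<in> cells A (Suc k) \<Longrightarrow> dm A k x \<in> cells A k"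
    and "\<And>k x. x \<in> cells A (Suc k) \<Longrightarrow> cd A k x \<in> cells A k"
    and "\<And>k x. x \<in> cells A (Suc (Suc k)) \<Longrightarrow> dm A k (dm A (Suc k) x) = dm A k (cd A (Suc k) x)"
    and "\<And>k x. x \<in> cells A (Suc (Suc k)) \<Longrightarrow> cd A k (dm A (Suc k) x) = cd A k (cd A (Suc k) x)"
    and "\<And>k x. \<lbrakk>enat (Suc k) \<le> n; x \<in> cells A k\<rbrakk> \<Longrightarrow> idt A k x \<in> cells A (Suc k)"
    and "\<And>k x. \<lbrakk>enat (Suc k) \<le> n; x \<in> cells A k\<rbrakk> \<Longrightarrow> dm A k (idt A k x) = x"
    and "\<And>k x. \<lbrakk>enat (Suc k) \<le> n; x \<in> cells A k\<rbrakk> \<Longrightarrow> cd A k (idt A k x) = x"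
    and "\<And>k j x y. composable A k j x y \<Longrightarrow> hcmp A k j x y \<in> cells A k"
    and "\<And>k x y. composable A (Suc k) k x y \<Longrightarrow> dm A k (hcmp A (Suc k) k x y) = dm A k y"
    and "\<And>k x y. composable A (Suc k) k x y \<Longrightarrow> cd A k (hcmp A (Suc k) k x y) = cd A k x"
    and "\<And>k j x y. \<lbrakk>composable A (Suc k) j x y; j < k\<rbrakk> \<Longrightarrow>
      dm A k (hcmp A (Suc k) j x y) = hcmp A k j (dm A k x) (dm A k y)"
    and "\<And>k j x y. \<lbrakk>composable A (Suc k) j x y; j < k\<rbrakk> \<Longrightarrow>
      cd A k (hcmp A (Suc k) j x y) = hcmp A k j (cd A k x) (cd A k y)"
    and "\<And>k j x. \<lbrakk>j < k; x \<in> cells A k\<rbrakk> \<Longrightarrow> hcmp A k j x (iidt A j (k - j) (idm A j (k - j) x)) = x"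
    and "\<And>k j x. \<lbrakk>j < k; x \<in> cells A k\<rbrakk> \<Longrightarrow> hcmp A k j (iidt A j (k - j) (icd A j (k - j) x)) x = x"
    and "\<And>k j x y z. \<lbrakk>composable A k j x y; composable A k j y z\<rbrakk> \<Longrightarrow>
      hcmp A k j (hcmp A k j x y) z = hcmp A k j x (hcmp A k j y z)"
    and "\<And>k j i x y z w. \<lbrakk>i < j; composable A k j x y; composable A k j z w;
      composable A k i x z; composable A k i y w\<rbrakk> \<Longrightarrow>
      hcmp A k i (hcmp A k j x y) (hcmp A k j z w) = hcmp A k j (hcmp A k i x z) (hcmp A k i y w)"
    and "\<And>k j x y. \<lbrakk>enat (Suc k) \<le> n; composable A k j x y\<rbrakk> \<Longrightarrow>
      idt A k (hcmp A k j x y) = hcmp A (Suc k) j (idt A k x) (idt A k y)"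
  shows "is_ncat n A"
  unfolding is_ncat_def
  by (intro conjI allI ballI impI; (elim conjE)?; rule assms; assumption)

locale hcat =
  fixes n :: enat and A :: "'u ncat"
  assumes ncat: "is_ncat n A"
begin

lemmas laws = ncat[unfolded is_ncat_def]
lemmas laws1 = laws[THEN conjunct2] lemmas laws2 = laws1[THEN conjunct2]
lemmas laws3 = laws2[THEN conjunct2] lemmas laws4 = laws3[THEN conjunct2]
lemmas laws5 = laws4[THEN conjunct2] lemmas laws6 = laws5[THEN conjunct2]
lemmas laws7 = laws6[THEN conjunct2] lemmas laws8 = laws7[THEN conjunct2]
lemmas laws9 = laws8[THEN conjunct2] lemmas laws10 = laws9[THEN conjunct2]

lemma cells_empty: "n < enat k \<Longrightarrow> cells A k = {}"
  using laws[THEN conjunct1] by blast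

lemma cell_le: "x \<in> cells A k \<Longrightarrow> enat k \<le> n"
  using cells_empty by (metis empty_iff not_le)

lemma dm_cell [intro]: "x \<in> cells A (Suc k) \<Longrightarrow> dm A k x \<in> cells A k"
  and cd_cell [intro]: "x \<in> cells A (Suc k) \<Longrightarrow> cd A k x \<in> cells A k"
  using laws1[THEN conjunct1] by blast+

lemma dm_glob: "x \<in> cells A (Suc (Suc k)) \<Longrightarrow> dm A k (dm A (Suc k) x) = dm A k (cd A (Suc k) x)"
  and cd_glob: "x \<in> cells A (Suc (Suc k)) \<Longrightarrow> cd A k (dm A (Suc k) x) = cd A k (cd A (Suc k) x)"
  using laws2[THEN conjunct1] by blast+

lemma idt_cell: "\<lbrakk>enat (Suc k) \<le> n; x \<in> cells A k\<rbrakk> \<Longrightarrow> idt A k x \<in> cells A (Suc k)"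
  and dm_idt: "\<lbrakk>enat (Suc k) \<le> n; x \<in> cells A k\<rbrakk> \<Longrightarrow> dm A k (idt A k x) = x"
  and cd_idt: "\<lbrakk>enat (Suc k) \<le> n; x \<in> cells A k\<rbrakk> \<Longrightarrow> cd A k (idt A k x) = x"
  using laws3[THEN conjunct1] by blast+

lemma hcmp_cell: "composable A k j x y \<Longrightarrow> hcmp A k j x y \<in> cells A k"
  and dm_hcmp_top: "composable A (Suc k) k x y \<Longrightarrow> dm A k (hcmp A (Suc k) k x y) = dm A k y"
  and cd_hcmp_top: "composable A (Suc k) k x y \<Longrightarrow> cd A k (hcmp A (Suc k) k x y) = cd A k x"
  and dm_hcmp: "\<lbrakk>composable A (Suc k) j x y; j < k\<rbrakk> \<Longrightarrow>
      dm A k (hcmp A (Suc k) j x y) = hcmp A k j (dm A k x) (dm A k y)"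
  and cd_hcmp: "\<lbrakk>composable A (Suc k) j x y; j < k\<rbrakk> \<Longrightarrow>
      cd A k (hcmp A (Suc k) j x y) = hcmp A k j (cd A k x) (cd A k y)"
  using laws4[THEN conjunct1] laws5[THEN conjunct1] laws6[THEN conjunct1] by blast+

lemma unit_right: "\<lbrakk>j < k; x \<in> cells A k\<rbrakk> \<Longrightarrow> hcmp A k j x (iidt A j (k - j) (idm A j (k - j) x)) = x"
  and unit_left: "\<lbrakk>j < k; x \<in> cells A k\<rbrakk> \<Longrightarrow> hcmp A k j (iidt A j (k - j) (icd A j (k - j) x)) x = x"
  and hcmp_assoc: "\<lbrakk>composable A k j x y; composable A k j y z\<rbrakk> \<Longrightarrow>
      hcmp A k j (hcmp A k j x y) z = hcmp A k j x (hcmp A k j y z)"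
  using laws7[THEN conjunct1] laws8[THEN conjunct1] by blast+

lemma interchange: "\<lbrakk>i < j; composable A k j x y; composable A k j z w;
      composable A k i x z; composable A k i y w\<rbrakk> \<Longrightarrow>
      hcmp A k i (hcmp A k j x y) (hcmp A k j z w) = hcmp A k j (hcmp A k i x z) (hcmp A k i y w)"
  using laws9[THEN conjunct1] by blast

lemma idt_hcmp: "\<lbrakk>enat (Suc k) \<le> n; composable A k j x y\<rbrakk> \<Longrightarrow>
      idt A k (hcmp A k j x y) = hcmp A (Suc k) j (idt A k x) (idt A k y)"
  using laws10 by blast

lemma iidt_cell: "\<lbrakk>x \<in> cells A j; enat (j + m) \<le> n\<rbrakk> \<Longrightarrow> iidt A j m x \<in> cells A (j + m)"
proof (induction m)
  case (Suc m)
  then have "enat (j + m) \<le> n" by (simp add: order_trans[OF _ Suc.prems(2)])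
  then show ?case using Suc by (simp add: idt_cell)
qed simp

lemma composableD:
  assumes "composable A k j x y"
  shows "j < k" "x \<in> cells A k" "y \<in> cells A k" "idm A j (k - j) x = icd A j (k - j) y"
  using assms unfolding composable_def by auto

lemma composable_top: "composable A (Suc k) k x y \<longleftrightarrow>
    x \<in> cells A (Suc k) \<and> y \<in> cells A (Suc k) \<and> dm A k x = cd A k y"
  unfolding composable_def by auto

lemma composable_dm:
  assumes "composable A (Suc k) j x y" "j < k"
  shows "composable A k j (dm A k x) (dm A k y)"
proof -
  obtain m where k: "k = Suc (j + m)" using assms(2) less_iff_Suc_add by auto
  show ?thesis using assms unfolding composable_def k
    by (auto simp: cd_glob Suc_diff_le)
qed

lemma composable_cd:
  assumes "composable A (Suc k) j x y" "j < k"
  shows "composable A k j (cd A k x) (cd A k y)"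
proof -
  obtain m where k: "k = Suc (j + m)" using assms(2) less_iff_Suc_add by auto
  show ?thesis using assms unfolding composable_def k
    by (auto simp: dm_glob Suc_diff_le)
qed

end

lemma idm_cells_update [simp]: "idm (A\<lparr>cells := c\<rparr>) j m x = idm A j m x"
  and icd_cells_update [simp]: "icd (A\<lparr>cells := c\<rparr>) j m x = icd A j m x"
  and iidt_cells_update [simp]: "iidt (A\<lparr>cells := c\<rparr>) j m x = iidt A j m x"
  by (induction m arbitrary: x) auto

lemma composable_cells_update:
  "(\<And>k. c k \<subseteq> cells A k) \<Longrightarrow>
    composable (A\<lparr>cells := c\<rparr>) k j x y \<longleftrightarrow> x \<in> c k \<and> y \<in> c k \<and> composable A k j x y"
  unfolding composable_def by auto

text \<open>Restricting the cells may also lower the dimension, so truncations are an instance.\<close>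

lemma subcategory_ncat:
  assumes A: "is_ncat N A" and nN: "n \<le> N"
    and sub: "\<And>k. c k \<subseteq> cells A k" and e: "\<And>k. n < enat k \<Longrightarrow> c k = {}"
    and d: "\<And>k x. x \<in> c (Suc k) \<Longrightarrow> dm A k x \<in> c k \<and> cd A k x \<in> c k"
    and i: "\<And>k x. \<lbrakk>enat (Suc k) \<le> n; x \<in> c k\<rbrakk> \<Longrightarrow> idt A k x \<in> c (Suc k)"
    and h: "\<And>k j x y. \<lbrakk>composable A k j x y; x \<in> c k; y \<in> c k\<rbrakk> \<Longrightarrow> hcmp A k j x y \<in> c k"
  shows "is_ncat n (A\<lparr>cells := c\<rparr>)"
proof -
  interpret hcat N A by unfold_locales fact
  have s: "\<And>k x. x \<in> c k \<Longrightarrow> x \<in> cells A k" using sub by blast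
  have l: "enat (Suc k) \<le> N" if "enat (Suc k) \<le> n" for k using that nN by (rule order_trans)
  show ?thesis
    by (rule is_ncatI)
      (auto simp: composable_cells_update[OF sub] e d i h s l
        dm_glob cd_glob dm_idt cd_idt dm_hcmp_top cd_hcmp_top dm_hcmp cd_hcmp unit_right unit_left
        intro: hcmp_assoc interchange idt_hcmp)
qed

lemma trunc_simps [simp]:
  "cells (trunc m A) = (\<lambda>k. if k \<le> m then cells A k else {})"
  "dm (trunc m A) = dm A" "cd (trunc m A) = cd A" "idt (trunc m A) = idt A"
  "hcmp (trunc m A) = hcmp A" "idm (trunc m A) j l x = idm A j l x"
  "icd (trunc m A) j l x = icd A j l x" "iidt (trunc m A) j l x = iidt A j l x"
  by (simp_all add: trunc_def)

lemma composable_trunc [simp]: "composable (trunc m A) k j x y \<longleftrightarrow> k \<le> m \<and> composable A k j x y"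
  by (auto simp: composable_def)

lemma trunc_trunc [simp]: "trunc m (trunc l A) = trunc (min m l) A"
  by (auto simp: trunc_def fun_eq_iff)

lemma trunc_ncat:
  assumes "is_ncat N A" "enat m \<le> N"
  shows "is_ncat (enat m) (trunc m A)"
proof -
  interpret hcat N A by unfold_locales fact
  have "enat (Suc k) \<le> N" if "Suc k \<le> m" for k
    using that assms(2) by (meson enat_ord_simps(1) order_trans)
  then show ?thesis unfolding trunc_def
    by (intro subcategory_ncat[OF assms])
      (auto intro: hcmp_cell idt_cell split: if_splits)
qed

lemma trunc_id: "is_ncat (enat m) A \<Longrightarrow> trunc m A = A"
  using hcat.cells_empty[of "enat m" A] by (auto simp: trunc_def hcat_def fun_eq_iff intro!: ncat.equality)

lemma nfunctorsD:
  assumes "f \<in> nfunctors n A B"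
  shows "f k \<in> cells A k \<rightarrow>\<^sub>E cells B k"
    and "x \<in> cells A k \<Longrightarrow> f k x \<in> cells B k"
    and "x \<in> cells A (Suc k) \<Longrightarrow> f k (dm A k x) = dm B k (f (Suc k) x)"
    and "x \<in> cells A (Suc k) \<Longrightarrow> f k (cd A k x) = cd B k (f (Suc k) x)"
    and "\<lbrakk>enat (Suc k) \<le> n; x \<in> cells A k\<rbrakk> \<Longrightarrow> f (Suc k) (idt A k x) = idt B k (f k x)"
    and "composable A k j x y \<Longrightarrow> f k (hcmp A k j x y) = hcmp B k j (f k x) (f k y)"
  using assms unfolding nfunctors_def by (auto simp: PiE_iff)

lemma nfunctorsI:
  assumes "\<And>k. f k \<in> cells A k \<rightarrow>\<^sub>E cells B k"
    and "\<And>k x. x \<in> cells A (Suc k) \<Longrightarrow> f k (dm A k x) = dm B k (f (Suc k) x)"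
    and "\<And>k x. x \<in> cells A (Suc k) \<Longrightarrow> f k (cd A k x) = cd B k (f (Suc k) x)"
    and "\<And>k x. \<lbrakk>enat (Suc k) \<le> n; x \<in> cells A k\<rbrakk> \<Longrightarrow> f (Suc k) (idt A k x) = idt B k (f k x)"
    and "\<And>k j x y. composable A k j x y \<Longrightarrow> f k (hcmp A k j x y) = hcmp B k j (f k x) (f k y)"
  shows "f \<in> nfunctors n A B"
  unfolding nfunctors_def using assms by simp

lemma nfunctors_ext:
  assumes "f \<in> nfunctors n A B" "g \<in> nfunctors n A B'"
    and "\<And>k x. x \<in> cells A k \<Longrightarrow> f k x = g k x"
  shows "f = g"
proof
  fix k
  show "f k = g k"
    using nfunctorsD(1)[OF assms(1), of k] nfunctorsD(1)[OF assms(2), of k] assms(3)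
    by (intro extensionalityI[of _ "cells A k"]) (auto simp: PiE_iff)
qed

lemma nfunctors_idm:
  assumes "f \<in> nfunctors n A B" "is_ncat n' A" "x \<in> cells A (j + m)"
  shows "f j (idm A j m x) = idm B j m (f (j + m) x)" "f j (icd A j m x) = icd B j m (f (j + m) x)"
proof -
  interpret hcat n' A by unfold_locales fact
  show "f j (idm A j m x) = idm B j m (f (j + m) x)"
    using assms(3) by (induction m arbitrary: x) (auto simp: dm_cell nfunctorsD(3)[OF assms(1)])
  show "f j (icd A j m x) = icd B j m (f (j + m) x)"
    using assms(3) by (induction m arbitrary: x) (auto simp: cd_cell nfunctorsD(4)[OF assms(1)])
qed

lemma nfunctors_composable:
  assumes f: "f \<in> nfunctors n A B" and A: "is_ncat n' A" and c: "composable A k j x y"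
  shows "composable B k j (f k x) (f k y)"
proof -
  obtain m where k: "k = j + m" using c unfolding composable_def by (metis less_imp_add_positive)
  have x: "x \<in> cells A (j + m)" and y: "y \<in> cells A (j + m)" and "j < k"
    and e: "idm A j m x = icd A j m y"
    using c unfolding composable_def k by auto
  then show ?thesis
    using nfunctors_idm(1)[OF f A x] nfunctors_idm(2)[OF f A y] nfunctorsD(2)[OF f]
    unfolding composable_def k by simp
qed

lemma nid_functor: "is_ncat n A \<Longrightarrow> nid A \<in> nfunctors n A A"
proof -
  assume A: "is_ncat n A"
  interpret hcat n A by unfold_locales fact
  show ?thesis unfolding nid_def
    by (rule nfunctorsI) (auto simp: dm_cell cd_cell idt_cell hcmp_cell dest: composableD)
qed

lemma ncompose_functor:
  assumes f: "f \<in> nfunctors n A B" and g: "g \<in> nfunctors n B C" and A: "is_ncat n A"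
  shows "ncompose A g f \<in> nfunctors n A C"
proof -
  interpret hcat n A by unfold_locales fact
  note F = nfunctorsD[OF f] and G = nfunctorsD[OF g]
  show ?thesis unfolding ncompose_def
  proof (rule nfunctorsI)
    fix k show "compose (cells A k) (g k) (f k) \<in> cells A k \<rightarrow>\<^sub>E cells C k"
      using F(2) G(2) by (auto simp: compose_def)
  qed (auto simp: compose_def dm_cell cd_cell idt_cell hcmp_cell F G nfunctors_composable[OF f A]
      dest: composableD)
qed

lemma ncompose_apply [simp]: "x \<in> cells A k \<Longrightarrow> ncompose A g f k x = g k (f k x)"
  by (simp add: ncompose_def compose_def)

lemma nid_apply [simp]: "x \<in> cells A k \<Longrightarrow> nid A k x = x"
  by (simp add: nid_def)

lemma trunc_map_functor:
  assumes "f \<in> nfunctors N A B" "enat m \<le> N"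
  shows "trunc_map m f \<in> nfunctors (enat m) (trunc m A) (trunc m B)"
proof (rule nfunctorsI)
  fix k
  show "trunc_map m f k \<in> cells (trunc m A) k \<rightarrow>\<^sub>E cells (trunc m B) k"
    using nfunctorsD(1)[OF assms(1), of k] by (auto simp: trunc_map_def)
qed (use assms(2) in \<open>auto simp: trunc_map_def nfunctorsD[OF assms(1)] order_trans[OF _ assms(2)]
      split: if_splits\<close>)

lemma trunc_map_trunc_map [simp]: "trunc_map m (trunc_map l f) = trunc_map (min m l) f"
  by (auto simp: trunc_map_def fun_eq_iff)

text \<open>\<open>F\<close> is an admissible action on \<open>(n+1)\<close>-cells for a functor that is \<open>g\<close> in the lower dimensions.\<close>

definition lifts :: "nat \<Rightarrow> 'u ncat \<Rightarrow> 'u ncat \<Rightarrow> 'u nmap \<Rightarrow> ('u \<Rightarrow> 'u) \<Rightarrow> bool" where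
  "lifts n B C g F \<longleftrightarrow>
    (\<forall>y\<in>cells B (Suc n). F y \<in> cells C (Suc n) \<and>
      dm C n (F y) = g n (dm B n y) \<and> cd C n (F y) = g n (cd B n y)) \<and>
    (\<forall>x\<in>cells B n. F (idt B n x) = idt C n (g n x)) \<and>
    (\<forall>j u v. composable B (Suc n) j u v \<longrightarrow>
      F (hcmp B (Suc n) j u v) = hcmp C (Suc n) j (F u) (F v))"

lemma lift_functor:
  assumes nB: "is_ncat (enat (Suc n)) B"
    and g: "g \<in> nfunctors (enat n) (trunc n B) (trunc n C)" and F: "lifts n B C g F"
  defines "f \<equiv> g(Suc n := restrict F (cells B (Suc n)))"
  shows "f \<in> nfunctors (enat (Suc n)) B C" "trunc_map n f = g"
proof -
  interpret hcat "enat (Suc n)" B by unfold_locales fact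
  note G = nfunctorsD[OF g] and F' = F[unfolded lifts_def]
  have u: "g k = (\<lambda>_. undefined)" if "k > n" for k
    using G(1)[of k] that by (auto simp: PiE_iff extensional_def fun_eq_iff)
  show "trunc_map n f = g"
    by (auto simp: f_def trunc_map_def fun_eq_iff u)
  have low: "f k = g k" if "k \<le> n" for k using that by (simp add: f_def)
  have top: "f (Suc n) y = F y" if "y \<in> cells B (Suc n)" for y using that by (simp add: f_def)
  have le: "k \<le> Suc n" if "x \<in> cells B k" for k x using cell_le[OF that] by simp
  show "f \<in> nfunctors (enat (Suc n)) B C"
  proof (rule nfunctorsI)
    fix k
    consider "k \<le> n" | "k = Suc n" | "k > Suc n" by linarith
    then show "f k \<in> cells B k \<rightarrow>\<^sub>E cells C k"
      using G(1)[of k] F' cells_empty[of k] by cases (auto simp: f_def u)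
  next
    fix k x assume x: "x \<in> cells B (Suc k)"
    then consider "k < n" | "k = n" using le by fastforce
    then show "f k (dm B k x) = dm C k (f (Suc k) x)" "f k (cd B k x) = cd C k (f (Suc k) x)"
      by (cases; use G(3,4)[of x k] x F' low top in auto)+
  next
    fix k x assume l: "enat (Suc k) \<le> enat (Suc n)" and x: "x \<in> cells B k"
    then consider "k < n" | "k = n" by (auto simp: le_less)
    then show "f (Suc k) (idt B k x) = idt C k (f k x)"
      by cases (use G(5)[of k x] x F' low top idt_cell[OF l x] in auto)
  next
    fix k j x y assume xy: "composable B k j x y"
    then have "k \<le> Suc n" using le composableD(2) by blast
    then consider "k \<le> n" | "k = Suc n" by linarith
    then show "f k (hcmp B k j x y) = hcmp C k j (f k x) (f k y)"
      by cases (use G(6)[of k j x y] xy F' low top hcmp_cell[OF xy] composableD[OF xy] in auto)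
  qed
qed


section \<open>Operations beyond the dimension\<close>

text \<open>An \<open>n\<close>-category as a record still carries values of operations that concern dimensions above \<open>n\<close>.
  They change when a different top dimension is put on a truncation, so computads have to be shown
  insensitive to them.\<close>

definition agree_upto :: "nat \<Rightarrow> 'u ncat \<Rightarrow> 'u ncat \<Rightarrow> bool" where
  "agree_upto n A B \<longleftrightarrow> cells A = cells B \<and>
    (\<forall>k<n. dm A k = dm B k \<and> cd A k = cd B k \<and> idt A k = idt B k) \<and>
    (\<forall>k\<le>n. hcmp A k = hcmp B k)"

lemma agree_upto_sym: "agree_upto n A B \<Longrightarrow> agree_upto n B A"
  by (simp add: agree_upto_def)

lemma agree_upto_idm:
  assumes "agree_upto n A B" "j + m \<le> n"
  shows "idm B j m x = idm A j m x" "icd B j m x = icd A j m x" "iidt B j m x = iidt A j m x"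
  using assms(2) by (induction m arbitrary: x) (use assms(1) in \<open>auto simp: agree_upto_def\<close>)

lemma agree_upto_composable:
  assumes "agree_upto n A B" "is_ncat (enat n) A"
  shows "composable B k j x y \<longleftrightarrow> composable A k j x y"
proof (cases "k \<le> n \<and> j < k")
  case True
  then show ?thesis
    using assms(1) agree_upto_idm[OF assms(1), of j "k - j"]
    by (auto simp: composable_def agree_upto_def)
next
  case False
  then have "cells A k = {} \<or> \<not> j < k"
    using hcat.cells_empty[of "enat n" A k] assms(2) by (auto simp: hcat_def not_le)
  then show ?thesis using assms(1) by (auto simp: composable_def agree_upto_def)
qed

lemma agree_upto_ncat:
  assumes "agree_upto n A B" "is_ncat (enat n) A"
  shows "is_ncat (enat n) B"
proof -
  interpret hcat "enat n" A by unfold_locales fact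
  have [simp]: "cells B = cells A" using assms(1) by (simp add: agree_upto_def)
  have d: "dm B k = dm A k" "cd B k = cd A k" "idt B k = idt A k" if "k < n" for k
    using assms(1) that by (simp_all add: agree_upto_def)
  have h: "hcmp B k = hcmp A k" if "k \<le> n" for k
    using assms(1) that by (simp add: agree_upto_def)
  have le: "k \<le> n" if "x \<in> cells A k" for k x using cell_le that by fastforce
  have lc: "k \<le> n" if "composable A k j x y" for k j x y
    using le that by (auto simp: composable_def)
  note c = agree_upto_composable[OF assms] and i = agree_upto_idm[OF assms(1)]
  show ?thesis
  proof (rule is_ncatI, unfold c)
    fix k j x assume jk: "j < k" "x \<in> cells B k"
    then have "j + (k - j) \<le> n" "k \<le> n" using le by auto
    then show "hcmp B k j x (iidt B j (k - j) (idm B j (k - j) x)) = x"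
      "hcmp B k j (iidt B j (k - j) (icd B j (k - j) x)) x = x"
      using jk by (simp_all add: i h unit_left unit_right)
  next
    fix k j x y assume "composable A (Suc k) j x y" "j < k"
    moreover from this have "Suc k \<le> n" using lc by blast
    ultimately show "dm B k (hcmp B (Suc k) j x y) = hcmp B k j (dm B k x) (dm B k y)"
      "cd B k (hcmp B (Suc k) j x y) = hcmp B k j (cd B k x) (cd B k y)"
      by (simp_all add: d h dm_hcmp cd_hcmp)
  next
    fix k x y assume "composable A (Suc k) k x y"
    moreover from this have "Suc k \<le> n" using lc by blast
    ultimately show "dm B k (hcmp B (Suc k) k x y) = dm B k y"
      "cd B k (hcmp B (Suc k) k x y) = cd B k x"
      by (simp_all add: d h dm_hcmp_top cd_hcmp_top)
  next
    fix k x assume "x \<in> cells B (Suc k)"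
    moreover from this have "Suc k \<le> n" using le by simp
    ultimately show "dm B k x \<in> cells B k" "cd B k x \<in> cells B k" by (auto simp: d)
  next
    fix k x assume "x \<in> cells B (Suc (Suc k))"
    moreover from this have "Suc (Suc k) \<le> n" using le by simp
    ultimately show "dm B k (dm B (Suc k) x) = dm B k (cd B (Suc k) x)"
      "cd B k (dm B (Suc k) x) = cd B k (cd B (Suc k) x)" by (auto simp: d dm_glob cd_glob)
  next
    fix k j x y z assume "composable A k j x y" "composable A k j y z"
    then show "hcmp B k j (hcmp B k j x y) z = hcmp B k j x (hcmp B k j y z)"
      using lc by (simp add: h hcmp_assoc)
  next
    fix k j i x y z w
    assume "i < j" "composable A k j x y" "composable A k j z w"
      "composable A k i x z" "composable A k i y w"
    then show "hcmp B k i (hcmp B k j x y) (hcmp B k j z w) =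
        hcmp B k j (hcmp B k i x z) (hcmp B k i y w)"
      using lc[of k j x y] by (simp add: h interchange[of i j k x y z w])
  qed (auto simp: d h lc cells_empty idt_cell dm_idt cd_idt hcmp_cell idt_hcmp)
qed

lemma agree_upto_functors_from:
  assumes "agree_upto n A B" "is_ncat (enat n) A"
  shows "nfunctors (enat n) A X = nfunctors (enat n) B X"
proof -
  have "nfunctors (enat n) A X \<subseteq> nfunctors (enat n) B X"
    if "agree_upto n A B" "is_ncat (enat n) A" for A B
  proof
    fix f assume f: "f \<in> nfunctors (enat n) A X"
    interpret hcat "enat n" A by unfold_locales fact
    have le: "k \<le> n" if "x \<in> cells A k" for k x using cell_le that by fastforce
    have lc: "k \<le> n" if "composable A k j x y" for k j x y
      using le that by (auto simp: composable_def)
    note F = nfunctorsD[OF f] and a = that(1)[unfolded agree_upto_def]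
    show "f \<in> nfunctors (enat n) B X"
    proof (rule nfunctorsI, unfold agree_upto_composable[OF that])
      fix k x assume "x \<in> cells B (Suc k)"
      then have "x \<in> cells A (Suc k)" "k < n" using a le[of x "Suc k"] by auto
      then show "f k (dm B k x) = dm X k (f (Suc k) x)" "f k (cd B k x) = cd X k (f (Suc k) x)"
        using F(3,4)[of x k] a by auto
    next
      fix k j x y assume "composable A k j x y"
      then show "f k (hcmp B k j x y) = hcmp X k j (f k x) (f k y)"
        using F(6)[of k j x y] a lc by auto
    qed (use F(1) a F(5) in auto)
  qed
  from this[OF assms] this[OF agree_upto_sym agree_upto_ncat, OF assms(1) assms]
  show ?thesis by blast
qed

lemma agree_upto_functors_to:
  assumes "agree_upto n A B" "is_ncat (enat n) X"
  shows "nfunctors (enat n) X A = nfunctors (enat n) X B"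
proof -
  interpret hcat "enat n" X by unfold_locales fact
  have le: "k \<le> n" if "x \<in> cells X k" for k x using cell_le that by fastforce
  have "nfunctors (enat n) X A \<subseteq> nfunctors (enat n) X B" if a: "agree_upto n A B" for A B
  proof
    fix f assume f: "f \<in> nfunctors (enat n) X A"
    note F = nfunctorsD[OF f] and a' = a[unfolded agree_upto_def]
    show "f \<in> nfunctors (enat n) X B"
    proof (rule nfunctorsI)
      fix k x assume x: "x \<in> cells X (Suc k)"
      then have "k < n" using le by fastforce
      then show "f k (dm X k x) = dm B k (f (Suc k) x)" "f k (cd X k x) = cd B k (f (Suc k) x)"
        using F(3,4)[of x k] a' x by auto
    next
      fix k j x y assume xy: "composable X k j x y"
      then have "k \<le> n" using le by (auto simp: composable_def)
      then show "f k (hcmp X k j x y) = hcmp B k j (f k x) (f k y)"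
        using F(6)[of k j x y] a' xy by auto
    qed (use F(1) a' F(5) in auto)
  qed
  from this[OF assms(1)] this[OF agree_upto_sym, OF assms(1)] show ?thesis by blast
qed

lemma agree_upto_trunc: "agree_upto (Suc n) A B \<Longrightarrow> agree_upto n (trunc n A) (trunc n B)"
  by (auto simp: agree_upto_def fun_eq_iff)


section \<open>Free extensions\<close>

lemma nCat_simps [simp]:
  "Obj (nCat \<kappa> N) = {A. is_ncat N A \<and> (\<forall>k. |cells A k| <o \<kappa>)}"
  "Hom (nCat \<kappa> N) = nfunctors N" "Ident (nCat \<kappa> N) = nid"
  "Cmp (nCat \<kappa> N) = (\<lambda>A B C. ncompose A)"
  by (simp_all add: nCat_def)

lemma CCat_simps [simp]:
  "Obj (CCat \<kappa> n K) = {B. is_ncat (enat (Suc n)) B \<and> (\<forall>k. |cells B k| <o \<kappa>) \<and> trunc n B \<in> Obj K}"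
  "Hom (CCat \<kappa> n K) = (\<lambda>B C. {f \<in> nfunctors (enat (Suc n)) B C.
    trunc_map n f \<in> Hom K (trunc n B) (trunc n C)})"
  "Ident (CCat \<kappa> n K) = nid" "Cmp (CCat \<kappa> n K) = (\<lambda>A B C. ncompose A)"
  by (auto simp add: CCat_def)

lemma nComp_simps [simp]: "Ident (nComp \<kappa> n) = nid" "Cmp (nComp \<kappa> n) = (\<lambda>A B C. ncompose A)"
  by (induction n) auto

lemma nComp_small_ncat:
  "A \<in> Obj (nComp \<kappa> n) \<Longrightarrow> is_ncat (enat n) A"
  "A \<in> Obj (nComp \<kappa> n) \<Longrightarrow> |cells A k| <o \<kappa>"
  by (cases n; auto simp: is_free_on_def zero_enat_def)+

lemma nComp_functor: "f \<in> Hom (nComp \<kappa> n) A B \<Longrightarrow> f \<in> nfunctors (enat n) A B"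
  by (cases n) (auto simp: zero_enat_def)

text \<open>The part of a morphism of \<open>Set \<down> \<Pi>\<^sub>n\<close> into an underlying object that concerns the indets.\<close>

definition attaches :: "nat \<Rightarrow> 'u ncat \<Rightarrow> 'u set \<Rightarrow> ('u \<Rightarrow> 'u \<times> 'u) \<Rightarrow> 'u nmap \<Rightarrow> ('u \<Rightarrow> 'u) \<Rightarrow> bool" where
  "attaches n C X \<delta> g h \<longleftrightarrow> h \<in> X \<rightarrow>\<^sub>E cells C (Suc n) \<and>
    (\<forall>x\<in>X. (dm C n (h x), cd C n (h x)) = map_prod (g n) (g n) (\<delta> x))"

lemma Com_Hom_iff:
  "(g, h) \<in> Hom (Com \<kappa> n K) (A, X, \<delta>) (U_obj n C) \<longleftrightarrow>
    g \<in> Hom K A (trunc n C) \<and> attaches n C X \<delta> g h"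
  by (auto simp: Com_def U_obj_def attaches_def PiE_iff Pi_iff)

text \<open>The universal property with the comma category unfolded into its two components.\<close>

lemma is_free_on_iff:
  "is_free_on \<kappa> n (nComp \<kappa> n) B (A, X, \<delta>) (f, h) \<longleftrightarrow>
    B \<in> Obj (CCat \<kappa> n (nComp \<kappa> n)) \<and> A \<in> Obj (nComp \<kappa> n) \<and> |X| <o \<kappa> \<and>
    \<delta> \<in> X \<rightarrow>\<^sub>E parallel n A \<and> f \<in> Hom (nComp \<kappa> n) A (trunc n B) \<and> attaches n B X \<delta> f h \<and>
    (\<forall>C g g1. C \<in> Obj (CCat \<kappa> n (nComp \<kappa> n)) \<and> g \<in> Hom (nComp \<kappa> n) A (trunc n C) \<and>
       attaches n C X \<delta> g g1 \<longrightarrow>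
      (\<exists>!F. F \<in> nfunctors (enat (Suc n)) B C \<and>
        trunc_map n F \<in> Hom (nComp \<kappa> n) (trunc n B) (trunc n C) \<and>
        ncompose A (trunc_map n F) f = g \<and> compose X (F (Suc n)) h = g1))"
proof -
  have o: "(A, X, \<delta>) \<in> Obj (Com \<kappa> n (nComp \<kappa> n)) \<longleftrightarrow>
      A \<in> Obj (nComp \<kappa> n) \<and> |X| <o \<kappa> \<and> \<delta> \<in> X \<rightarrow>\<^sub>E parallel n A"
    by (simp add: Com_def)
  have c: "Cmp (Com \<kappa> n (nComp \<kappa> n)) (A, X, \<delta>) (U_obj n B) (U_obj n C) (U_map n F) (f, h) =
      (ncompose A (trunc_map n F) f, compose X (F (Suc n)) h)" for C F
    by (simp add: Com_def U_obj_def U_map_def)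
  have b: "(\<forall>p\<in>Hom (Com \<kappa> n (nComp \<kappa> n)) (A, X, \<delta>) (U_obj n C). R p) \<longleftrightarrow>
      (\<forall>g g1. g \<in> Hom (nComp \<kappa> n) A (trunc n C) \<and> attaches n C X \<delta> g g1 \<longrightarrow> R (g, g1))" for R C
    by (simp add: Ball_def split_paired_All Com_Hom_iff)
  show ?thesis unfolding is_free_on_def o Com_Hom_iff b c prod.inject CCat_simps(2) mem_Collect_eq
    by blast
qed

lemma indets_iff: "y \<in> indets \<kappa> n K B \<longleftrightarrow>
    (\<exists>A X \<delta> f h. is_free_on \<kappa> n K B (A, X, \<delta>) (f, h) \<and> y \<in> h ` X)"
  unfolding indets_def by blast

lemma indets_cell: "y \<in> indets \<kappa> n (nComp \<kappa> n) B \<Longrightarrow> y \<in> cells B (Suc n)"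
proof -
  assume "y \<in> indets \<kappa> n (nComp \<kappa> n) B"
  then obtain A X \<delta> f h where fr: "is_free_on \<kappa> n (nComp \<kappa> n) B (A, X, \<delta>) (f, h)" and y: "y \<in> h ` X"
    unfolding indets_iff by blast
  from fr have "attaches n B X \<delta> f h" unfolding is_free_on_iff by (elim conjE)
  then show ?thesis using y by (auto simp: attaches_def)
qed

lemma nComp_nid: "is_ncat (enat n) A \<Longrightarrow> nid A \<in> Hom (nComp \<kappa> n) A A"
proof (induction n arbitrary: A)
  case 0
  then show ?case using nid_functor by (simp add: zero_enat_def)
next
  case (Suc n)
  have t: "is_ncat (enat n) (trunc n A)" using trunc_ncat[OF Suc.prems] by simp
  have "trunc_map n (nid A) = nid (trunc n A)"
    by (auto simp: trunc_map_def nid_def fun_eq_iff)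
  moreover have "nid A (Suc n) ` indets \<kappa> n (nComp \<kappa> n) A \<subseteq> indets \<kappa> n (nComp \<kappa> n) A"
    using indets_cell[of _ \<kappa> n A] by auto
  ultimately show ?case using Suc.IH[OF t] nid_functor[OF Suc.prems] by simp
qed

text \<open>By induction on the dimension: freeness refers to the operations only through functors out of and
  into the category and through the truncation.\<close>

lemma agree_upto_computads:
  assumes "agree_upto n A B" "is_ncat (enat n) A"
  shows "A \<in> Obj (nComp \<kappa> n) \<Longrightarrow> B \<in> Obj (nComp \<kappa> n)"
    and "is_ncat (enat n) X \<Longrightarrow> Hom (nComp \<kappa> n) A X = Hom (nComp \<kappa> n) B X"
    and "is_ncat (enat n) X \<Longrightarrow> Hom (nComp \<kappa> n) X A = Hom (nComp \<kappa> n) X B"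
proof -
  have "(A \<in> Obj (nComp \<kappa> n) \<longrightarrow> B \<in> Obj (nComp \<kappa> n)) \<and> (\<forall>X. is_ncat (enat n) X \<longrightarrow>
      Hom (nComp \<kappa> n) A X = Hom (nComp \<kappa> n) B X \<and> Hom (nComp \<kappa> n) X A = Hom (nComp \<kappa> n) X B)"
    using assms
  proof (induction n arbitrary: A B)
    case 0
    then show ?case
      using agree_upto_ncat[of 0 A B] agree_upto_functors_from[of 0 A B] agree_upto_functors_to[of 0 A B]
      by (auto simp: zero_enat_def agree_upto_def)
  next
    case (Suc n)
    have free: "is_free_on \<kappa> n (nComp \<kappa> n) B P \<eta>"
      if ag: "agree_upto (Suc n) A B" and nA: "is_ncat (enat (Suc n)) A"
        and fr: "is_free_on \<kappa> n (nComp \<kappa> n) A P \<eta>" for A B P \<eta>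
    proof -
      obtain A0 X \<delta> f h where P: "P = (A0, X, \<delta>)" "\<eta> = (f, h)" by (metis prod.exhaust)
      note fr' = fr[unfolded P is_free_on_iff]
      have nB: "is_ncat (enat (Suc n)) B" using agree_upto_ncat[OF ag nA] .
      have tA: "is_ncat (enat n) (trunc n A)" using trunc_ncat[OF nA] by simp
      note IH = Suc.IH[OF agree_upto_trunc[OF ag] tA]
      have A0: "is_ncat (enat n) A0" using fr' nComp_small_ncat by blast
      have 1: "B \<in> Obj (CCat \<kappa> n (nComp \<kappa> n))"
        using fr' IH nB ag by (auto simp: agree_upto_def)
      have 2: "f \<in> Hom (nComp \<kappa> n) A0 (trunc n B)" using fr' IH A0 by blast
      have 3: "attaches n B X \<delta> f h" using fr' ag by (auto simp: attaches_def agree_upto_def)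
      have 4: "nfunctors (enat (Suc n)) A C = nfunctors (enat (Suc n)) B C" for C
        by (rule agree_upto_functors_from[OF ag nA])
      have 5: "Hom (nComp \<kappa> n) (trunc n A) (trunc n C) = Hom (nComp \<kappa> n) (trunc n B) (trunc n C)"
        if "C \<in> Obj (CCat \<kappa> n (nComp \<kappa> n))" for C
        using IH trunc_ncat[of "enat (Suc n)" C n] that by simp
      show ?thesis unfolding P is_free_on_iff using fr' 1 2 3 4 5 by (metis (no_types, lifting))
    qed
    note sym = agree_upto_sym[OF Suc.prems(1)] agree_upto_ncat[OF Suc.prems]
    have ind: "indets \<kappa> n (nComp \<kappa> n) A = indets \<kappa> n (nComp \<kappa> n) B"
      using free[OF Suc.prems] free[OF sym] unfolding set_eq_iff indets_iff by blast
    have tA: "is_ncat (enat n) (trunc n A)" using trunc_ncat[OF Suc.prems(2)] by simp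
    note IH = Suc.IH[OF agree_upto_trunc[OF Suc.prems(1)] tA]
    have homs: "Hom (nComp \<kappa> (Suc n)) A X = Hom (nComp \<kappa> (Suc n)) B X \<and>
        Hom (nComp \<kappa> (Suc n)) X A = Hom (nComp \<kappa> (Suc n)) X B"
      if "is_ncat (enat (Suc n)) X" for X
    proof -
      have "is_ncat (enat n) (trunc n X)" using trunc_ncat[OF that] by simp
      then show ?thesis
        using IH ind agree_upto_functors_from[OF Suc.prems] agree_upto_functors_to[OF Suc.prems(1) that]
        by auto
    qed
    have "A \<in> Obj (nComp \<kappa> (Suc n)) \<longrightarrow> B \<in> Obj (nComp \<kappa> (Suc n))"
      using free[OF Suc.prems] by (simp del: split_paired_Ex) blast
    with homs show ?case by blast
  qed
  then show "A \<in> Obj (nComp \<kappa> n) \<Longrightarrow> B \<in> Obj (nComp \<kappa> n)"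
    and "is_ncat (enat n) X \<Longrightarrow> Hom (nComp \<kappa> n) A X = Hom (nComp \<kappa> n) B X"
    and "is_ncat (enat n) X \<Longrightarrow> Hom (nComp \<kappa> n) X A = Hom (nComp \<kappa> n) X B"
    by blast+
qed

lemma free_endomorphism:
  assumes fr: "is_free_on \<kappa> n (nComp \<kappa> n) B (A, X, \<delta>) (f, h)"
    and G: "G \<in> nfunctors (enat (Suc n)) B B"
    and tG: "trunc_map n G \<in> Hom (nComp \<kappa> n) (trunc n B) (trunc n B)"
    and Gf: "ncompose A (trunc_map n G) f = f" and Gh: "compose X (G (Suc n)) h = h"
  shows "G = nid B"
proof -
  note fr' = fr[unfolded is_free_on_iff]
  have nB: "is_ncat (enat (Suc n)) B" using fr' by simp
  have tB: "is_ncat (enat n) (trunc n B)" using trunc_ncat[OF nB, of n] by simp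
  have "nid B \<in> nfunctors (enat (Suc n)) B B" using nid_functor nB .
  moreover have "trunc_map n (nid B) = nid (trunc n B)"
    by (auto simp: trunc_map_def nid_def fun_eq_iff)
  moreover have "nid (trunc n B) \<in> Hom (nComp \<kappa> n) (trunc n B) (trunc n B)" by (rule nComp_nid[OF tB])
  moreover have "ncompose A (nid (trunc n B)) f = f"
  proof -
    have f: "f \<in> nfunctors (enat n) A (trunc n B)" using fr' nComp_functor by blast
    show ?thesis
      by (rule nfunctors_ext[OF ncompose_functor[OF f nid_functor[OF tB]] f])
        (use nfunctorsD(2)[OF f] fr' nComp_small_ncat(1)[of A] in auto)
  qed
  moreover have "compose X (nid B (Suc n)) h = h"
    using fr' by (auto simp: attaches_def compose_def PiE_iff Pi_iff extensional_def fun_eq_iff)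
  moreover have "B \<in> Obj (CCat \<kappa> n (nComp \<kappa> n))" "f \<in> Hom (nComp \<kappa> n) A (trunc n B)"
    "attaches n B X \<delta> f h" using fr' by blast+
  ultimately show ?thesis using fr' G tG Gf Gh by metis
qed

definition generated_by :: "nat \<Rightarrow> 'u ncat \<Rightarrow> 'u set \<Rightarrow> bool" where
  "generated_by k A G \<longleftrightarrow> (\<forall>Q. (\<forall>g\<in>G. Q g) \<and> (\<forall>x\<in>cells A k. Q (idt A k x)) \<and>
    (\<forall>j u v. composable A (Suc k) j u v \<longrightarrow> Q u \<longrightarrow> Q v \<longrightarrow> Q (hcmp A (Suc k) j u v)) \<longrightarrow>
    (\<forall>y\<in>cells A (Suc k). Q y))"

lemma generated_by_induct:
  assumes "generated_by k A G" "y \<in> cells A (Suc k)"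
    and "\<And>g. g \<in> G \<Longrightarrow> Q g" "\<And>x. x \<in> cells A k \<Longrightarrow> Q (idt A k x)"
    and "\<And>j u v. \<lbrakk>composable A (Suc k) j u v; Q u; Q v\<rbrakk> \<Longrightarrow> Q (hcmp A (Suc k) j u v)"
  shows "Q y"
  using assms(1)[unfolded generated_by_def, rule_format, of Q y] assms(2-5) by blast

text \<open>Closure under identities and composition makes \<open>Q\<close> a subcategory with the same truncation. The
  universal arrow factors through it, and the resulting endofunctor of \<open>B\<close> is the identity.\<close>

lemma free_generated:
  assumes fr: "is_free_on \<kappa> n (nComp \<kappa> n) B (A, X, \<delta>) (f, h)"
    and gen: "\<And>x. x \<in> X \<Longrightarrow> Q (h x)"
    and idt: "\<And>x. x \<in> cells B n \<Longrightarrow> Q (idt B n x)"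
    and cmp: "\<And>j u v. \<lbrakk>composable B (Suc n) j u v; Q u; Q v\<rbrakk> \<Longrightarrow> Q (hcmp B (Suc n) j u v)"
    and y: "y \<in> cells B (Suc n)"
  shows "Q y"
proof -
  note fr' = fr[unfolded is_free_on_iff]
  have nB: "is_ncat (enat (Suc n)) B" using fr' by simp
  interpret hcat "enat (Suc n)" B by unfold_locales fact
  define c where "c = (\<lambda>k. if k = Suc n then {y \<in> cells B (Suc n). Q y} else cells B k)"
  have sub: "c k \<subseteq> cells B k" for k by (auto simp: c_def)
  let ?B = "B\<lparr>cells := c\<rparr>"
  have nc: "is_ncat (enat (Suc n)) ?B"
  proof (rule subcategory_ncat[OF nB order_refl sub])
    show "enat (Suc n) < enat k \<Longrightarrow> c k = {}" for k
      using sub[of k] cells_empty by blast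
    show "x \<in> c (Suc k) \<Longrightarrow> dm B k x \<in> c k \<and> cd B k x \<in> c k" for k x
      using sub[of "Suc k"] cell_le[of x "Suc k"] by (auto simp: c_def split: if_splits)
    show "enat (Suc k) \<le> enat (Suc n) \<Longrightarrow> x \<in> c k \<Longrightarrow> idt B k x \<in> c (Suc k)" for k x
      using idt idt_cell by (auto simp: c_def split: if_splits)
    show "composable B k j x y \<Longrightarrow> x \<in> c k \<Longrightarrow> y \<in> c k \<Longrightarrow> hcmp B k j x y \<in> c k" for k j x y
      using cmp hcmp_cell by (auto simp: c_def split: if_splits)
  qed
  have t: "trunc n ?B = trunc n B" by (auto simp: trunc_def c_def fun_eq_iff)
  have "|c k| <o \<kappa>" for k
    using fr' card_of_mono1[OF sub[of k]] ordLeq_ordLess_trans by fastforce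
  then have "?B \<in> Obj (CCat \<kappa> n (nComp \<kappa> n))" using nc fr' t by simp
  moreover have "attaches n ?B X \<delta> f h"
    using fr' gen by (auto simp: attaches_def c_def PiE_iff Pi_iff)
  ultimately obtain F where F: "F \<in> nfunctors (enat (Suc n)) B ?B"
      "trunc_map n F \<in> Hom (nComp \<kappa> n) (trunc n B) (trunc n B)"
      "ncompose A (trunc_map n F) f = f" "compose X (F (Suc n)) h = h"
    using fr' t by metis
  note F' = nfunctorsD[OF F(1)]
  have F1: "F \<in> nfunctors (enat (Suc n)) B B"
  proof (rule nfunctorsI)
    show "F k \<in> cells B k \<rightarrow>\<^sub>E cells B k" for k using F'(1)[of k] sub[of k] by (auto simp: PiE_iff)
  qed (use F'(3-6) in auto)
  have "F = nid B" by (rule free_endomorphism[OF fr F1 F(2-4)])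
  then have "F (Suc n) y = y" using y by simp
  moreover have "F (Suc n) y \<in> c (Suc n)" using F'(2)[OF y] by simp
  ultimately show ?thesis by (simp add: c_def)
qed


section \<open>Small sets\<close>

locale small_universe =
  fixes \<kappa> :: "'u rel"
  assumes card_order: "Card_order \<kappa>" and uncountable: "natLeq <o \<kappa>"
begin

lemma infinite_Field: "infinite (Field \<kappa>)"
  using card_order uncountable
  by (meson Card_order_iff_ordLeq_card_of card_of_Field_ordIso cinfinite_def cinfinite_mono
      natLeq_cinfinite ordLess_imp_ordLeq)

lemma infinite_universe: "infinite (UNIV :: 'u set)"
  using infinite_Field by (meson finite_subset subset_UNIV)

lemma countable_small: "|A| \<le>o natLeq \<Longrightarrow> |A| <o \<kappa>"
  using uncountable ordLeq_ordLess_trans by blast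

lemma small_times_nat:
  assumes "|A| <o \<kappa>"
  shows "|A \<times> (UNIV :: nat set)| <o \<kappa>"
proof (cases "finite A")
  case True
  then have "|A| \<le>o |UNIV :: nat set|"
    using infinite_UNIV_nat by (meson card_of_ordLeq_infinite card_of_ordLeq_finite ordLeq_total card_of_Well_order)
  then have "|A \<times> (UNIV :: nat set)| \<le>o |(UNIV :: nat set) \<times> (UNIV :: nat set)|"
    by (rule card_of_Times_mono1)
  also have "|(UNIV :: nat set) \<times> (UNIV :: nat set)| =o |UNIV :: nat set|"
    by (rule card_of_Times_same_infinite[OF infinite_UNIV_nat])
  finally show ?thesis
    using card_of_nat by (intro countable_small) (rule ordLeq_ordIso_trans)
next
  case False
  then have "|A \<times> (UNIV :: nat set)| =o |A|"
    using card_of_Times_infinite[OF False, of "UNIV :: nat set"] infinite_iff_card_of_nat by blast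
  then show ?thesis using assms ordIso_ordLess_trans by blast
qed

lemma small_image: "|A| <o \<kappa> \<Longrightarrow> |f ` A| <o \<kappa>"
  using card_of_image ordLeq_ordLess_trans by blast

lemma small_subset: "|A| <o \<kappa> \<Longrightarrow> B \<subseteq> A \<Longrightarrow> |B| <o \<kappa>"
  using card_of_mono1 ordLeq_ordLess_trans by blast

lemma ex_pairing: "\<exists>e :: 'u \<times> nat \<Rightarrow> 'u. inj e"
proof -
  have "|UNIV :: nat set| \<le>o |UNIV :: 'u set|"
    using infinite_universe infinite_iff_card_of_nat by blast
  from card_of_Times_infinite[OF infinite_universe UNIV_not_empty this]
  have "|(UNIV :: 'u set) \<times> (UNIV :: nat set)| \<le>o |UNIV :: 'u set|"
    by (rule ordIso_imp_ordLeq[OF conjunct1])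
  then show ?thesis
    using card_of_ordLeq[of "UNIV :: ('u \<times> nat) set" "UNIV :: 'u set"] by auto
qed

end


section \<open>Weights\<close>

definition weight :: "nat \<Rightarrow> 'u ncat \<Rightarrow> ('u \<Rightarrow> nat) \<Rightarrow> bool" where
  "weight k A \<phi> \<longleftrightarrow> (\<forall>x\<in>cells A k. \<phi> (idt A k x) = 0) \<and>
    (\<forall>j u v. composable A (Suc k) j u v \<longrightarrow> \<phi> (hcmp A (Suc k) j u v) = \<phi> u + \<phi> v)"

text \<open>\<open>B\<close> with every \<open>(n+1)\<close>-cell labelled by a number; labels add under all compositions and identities
  are labelled 0. Interchange for labels is commutativity of addition. The injection \<open>e\<close> encodes
  labelled cells as cells, since the cells of lower dimension must stay what they are.\<close>

definition weighted :: "('u \<times> nat \<Rightarrow> 'u) \<Rightarrow> nat \<Rightarrow> 'u ncat \<Rightarrow> 'u ncat" where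
  "weighted e n B = \<lparr>
    cells = (cells B)(Suc n := e ` (cells B (Suc n) \<times> UNIV)),
    dm = (dm B)(n := \<lambda>u. dm B n (fst (inv e u))),
    cd = (cd B)(n := \<lambda>u. cd B n (fst (inv e u))),
    idt = (idt B)(n := \<lambda>x. e (idt B n x, 0)),
    hcmp = (hcmp B)(Suc n := \<lambda>j u v.
      e (hcmp B (Suc n) j (fst (inv e u)) (fst (inv e v)), snd (inv e u) + snd (inv e v)))\<rparr>"

locale weighted_ncat = hcat "enat (Suc n)" B for n and B :: "'u ncat" +
  fixes e :: "'u \<times> nat \<Rightarrow> 'u"
  assumes inj: "inj e"
begin

abbreviation "C \<equiv> weighted e n B"

lemma w_simps [simp]:
  "cells C (Suc n) = e ` (cells B (Suc n) \<times> UNIV)"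
  "k \<noteq> Suc n \<Longrightarrow> cells C k = cells B k"
  "k \<noteq> n \<Longrightarrow> dm C k = dm B k" "k \<noteq> n \<Longrightarrow> cd C k = cd B k" "k \<noteq> n \<Longrightarrow> idt C k = idt B k"
  "k \<noteq> Suc n \<Longrightarrow> hcmp C k = hcmp B k"
  "dm C n (e (y, a)) = dm B n y" "cd C n (e (y, a)) = cd B n y" "idt C n x = e (idt B n x, 0)"
  "hcmp C (Suc n) j (e (y, a)) (e (z, b)) = e (hcmp B (Suc n) j y z, a + b)"
  using inj by (auto simp: weighted_def)

lemma w_iter [simp]:
  assumes "j + m \<le> n"
  shows "idm C j m x = idm B j m x" "icd C j m x = icd B j m x" "iidt C j m x = iidt B j m x"
  using assms by (induction m arbitrary: x) auto

lemma w_iter_top: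
  assumes "j \<le> n"
  shows "idm C j (Suc n - j) (e (y, a)) = idm B j (Suc n - j) y"
    "icd C j (Suc n - j) (e (y, a)) = icd B j (Suc n - j) y"
    "iidt C j (Suc n - j) x = e (iidt B j (Suc n - j) x, 0)"
  using assms by (simp_all add: Suc_diff_le)

lemma w_composable: "k \<le> n \<Longrightarrow> composable C k j x y \<longleftrightarrow> composable B k j x y"
  by (auto simp: composable_def)

lemma w_composable_top: "composable C (Suc n) j u v \<longleftrightarrow>
    (\<exists>y a z b. u = e (y, a) \<and> v = e (z, b) \<and> composable B (Suc n) j y z)"
  using inj by (auto simp: composable_def w_iter_top less_Suc_eq_le inj_eq)

lemma w_le: "x \<in> cells C k \<Longrightarrow> k \<le> Suc n"
  using cells_empty[of k] by (cases "k > Suc n") auto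

lemma w_composable_cases:
  assumes "composable C k j u v"
  obtains "k \<le> n" "composable B k j u v"
  | y a z b where "k = Suc n" "u = e (y, a)" "v = e (z, b)" "composable B (Suc n) j y z"
proof -
  have "k \<le> Suc n" using assms w_le by (auto simp: composable_def)
  then show ?thesis using assms that w_composable w_composable_top by (metis le_Suc_eq)
qed

lemma weighted_ncat: "is_ncat (enat (Suc n)) C"
proof (rule is_ncatI)
  show "cells C k = {}" if "enat (Suc n) < enat k" for k using cells_empty[OF that] that by auto
next
  fix k x assume x: "x \<in> cells C (Suc k)"
  then consider "k < n" | "k = n" using w_le by fastforce
  then show "dm C k x \<in> cells C k" "cd C k x \<in> cells C k" by (cases; use x in auto)+
next
  fix k x assume x: "x \<in> cells C (Suc (Suc k))"
  then consider "Suc k < n" | "Suc k = n" using w_le by fastforce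
  then show "dm C k (dm C (Suc k) x) = dm C k (cd C (Suc k) x)"
    "cd C k (dm C (Suc k) x) = cd C k (cd C (Suc k) x)"
    by (cases; use x in \<open>auto simp: dm_glob cd_glob\<close>)+
next
  fix k x assume "enat (Suc k) \<le> enat (Suc n)" and x: "x \<in> cells C k"
  then consider "k < n" | "k = n" by fastforce
  then show "idt C k x \<in> cells C (Suc k)" "dm C k (idt C k x) = x" "cd C k (idt C k x) = x"
    by (cases; use x in \<open>auto simp: idt_cell dm_idt cd_idt\<close>)+
next
  fix k j x y assume "composable C k j x y"
  then show "hcmp C k j x y \<in> cells C k"
    by (cases rule: w_composable_cases) (auto simp: hcmp_cell)
next
  fix k x y assume "composable C (Suc k) k x y"
  then show "dm C k (hcmp C (Suc k) k x y) = dm C k y" "cd C k (hcmp C (Suc k) k x y) = cd C k x"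
    by (cases rule: w_composable_cases; auto simp: dm_hcmp_top cd_hcmp_top)+
next
  fix k j x y assume "composable C (Suc k) j x y" "j < k"
  then show "dm C k (hcmp C (Suc k) j x y) = hcmp C k j (dm C k x) (dm C k y)"
    "cd C k (hcmp C (Suc k) j x y) = hcmp C k j (cd C k x) (cd C k y)"
    by (cases rule: w_composable_cases; auto simp: dm_hcmp cd_hcmp)+
next
  fix k j x assume j: "j < k" and x: "x \<in> cells C k"
  have "hcmp C k j x (iidt C j (k - j) (idm C j (k - j) x)) = x \<and>
    hcmp C k j (iidt C j (k - j) (icd C j (k - j) x)) x = x"
  proof (cases "k \<le> n")
    case True then show ?thesis using j x by (simp add: unit_left unit_right)
  next
    case False
    then have k: "k = Suc n" using w_le[OF x] by simp
    then obtain y a where "x = e (y, a)" "y \<in> cells B (Suc n)" using x by auto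
    then show ?thesis using j k unit_left[of j "Suc n" y] unit_right[of j "Suc n" y]
      by (simp add: w_iter_top)
  qed
  then show "hcmp C k j x (iidt C j (k - j) (idm C j (k - j) x)) = x"
    "hcmp C k j (iidt C j (k - j) (icd C j (k - j) x)) x = x" by blast+
next
  fix k j x y z assume c: "composable C k j x y" "composable C k j y z"
  from c(1) show "hcmp C k j (hcmp C k j x y) z = hcmp C k j x (hcmp C k j y z)"
  proof (cases rule: w_composable_cases)
    case 1 then show ?thesis using c(2) by (simp add: w_composable hcmp_assoc)
  next
    case (2 y a z b)
    then show ?thesis using c(2) inj by (auto simp: w_composable_top hcmp_assoc inj_eq)
  qed
next
  fix k j i x y z w
  assume i: "i < j" and c: "composable C k j x y" "composable C k j z w"
    "composable C k i x z" "composable C k i y w"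
  from c(1) show "hcmp C k i (hcmp C k j x y) (hcmp C k j z w) =
      hcmp C k j (hcmp C k i x z) (hcmp C k i y w)"
  proof (cases rule: w_composable_cases)
    case 1
    then show ?thesis using i c(2-4) by (simp add: w_composable interchange[of i j k x y z w])
  next
    case (2 x' a y' b)
    then obtain z' c' w' d where zw: "z = e (z', c')" "w = e (w', d)" "composable B (Suc n) j z' w'"
      using c(2) by (auto simp: w_composable_top)
    then have "composable B (Suc n) i x' z'" "composable B (Suc n) i y' w'"
      using 2 c(3,4) inj by (auto simp: w_composable_top inj_eq)
    then show ?thesis using 2 zw i by (simp add: interchange[of i j "Suc n" x' y' z' w'] ac_simps)
  qed
next
  fix k j x y assume "enat (Suc k) \<le> enat (Suc n)" and c: "composable C k j x y"
  then have "k \<le> n" by simp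
  then have "composable B k j x y" using c by (simp add: w_composable)
  then show "idt C k (hcmp C k j x y) = hcmp C (Suc k) j (idt C k x) (idt C k y)"
    using \<open>k \<le> n\<close> by (cases "k = n") (simp_all add: idt_hcmp)
qed

lemma w_agree: "agree_upto n (trunc n B) (trunc n C)"
  by (auto simp: agree_upto_def fun_eq_iff)

text \<open>Forgetting the labels.\<close>

lemma w_projection:
  assumes F: "F \<in> nfunctors (enat (Suc n)) B C"
  shows "F(Suc n := restrict (\<lambda>y. fst (inv e (F (Suc n) y))) (cells B (Suc n)))
      \<in> nfunctors (enat (Suc n)) B B"
    (is "?G \<in> _")
proof -
  note F' = nfunctorsD[OF F]
  have r: "F (Suc n) y = e (inv e (F (Suc n) y)) \<and> fst (inv e (F (Suc n) y)) \<in> cells B (Suc n)"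
    if "y \<in> cells B (Suc n)" for y
    using F'(2)[OF that] inj by auto
  have r': "dm C n (F (Suc n) y) = dm B n (fst (inv e (F (Suc n) y)))"
    "cd C n (F (Suc n) y) = cd B n (fst (inv e (F (Suc n) y)))" if "y \<in> cells B (Suc n)" for y
    by (simp_all add: weighted_def)
  show ?thesis
  proof (rule nfunctorsI)
    fix k show "?G k \<in> cells B k \<rightarrow>\<^sub>E cells B k"
      using r F'(1)[of k] by (cases "k = Suc n") auto
  next
    fix k x assume x: "x \<in> cells B (Suc k)"
    then have "k \<le> n" using cell_le by fastforce
    then show "?G k (dm B k x) = dm B k (?G (Suc k) x)" "?G k (cd B k x) = cd B k (?G (Suc k) x)"
      using F'(3,4)[OF x] x r' by (cases "k = n"; auto)+
  next
    fix k x assume k: "enat (Suc k) \<le> enat (Suc n)" and x: "x \<in> cells B k"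
    then have "k \<le> n" by simp
    then show "?G (Suc k) (idt B k x) = idt B k (?G k x)"
      using F'(5)[OF k x] idt_cell[OF k x] inj by (cases "k = n") auto
  next
    fix k j x y assume c: "composable B k j x y"
    have F6: "F (Suc n) (hcmp B (Suc n) j x y) =
        e (hcmp B (Suc n) j (fst (inv e (F (Suc n) x))) (fst (inv e (F (Suc n) y))),
          snd (inv e (F (Suc n) x)) + snd (inv e (F (Suc n) y)))" if "k = Suc n"
      using F'(6)[of "Suc n" j x y] c that by (simp add: weighted_def)
    show "?G k (hcmp B k j x y) = hcmp B k j (?G k x) (?G k y)"
    proof (cases "k = Suc n")
      case True
      then show ?thesis using hcmp_cell[OF c] c F6 inj by (simp add: composable_def)
    qed (use F'(6)[OF c] in simp)
  qed
qed

end

text \<open>The universal property of \<open>B\<close> gives a functor to the labelled category that sends the indet \<open>x\<close> to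
  \<open>h x\<close> labelled \<open>w x\<close>. Forgetting the labels yields the identity, so this functor does nothing but
  attach a label to each cell, and the label is the weight.\<close>

lemma (in small_universe) free_weight:
  fixes w :: "'u \<Rightarrow> nat"
  assumes fr: "is_free_on \<kappa> n (nComp \<kappa> n) B (A, X, \<delta>) (f, h)"
  shows "\<exists>\<phi>. weight n B \<phi> \<and> (\<forall>x\<in>X. \<phi> (h x) = w x)"
proof -
  obtain e :: "'u \<times> nat \<Rightarrow> 'u" where inj: "inj e" using ex_pairing by blast
  note fr' = fr[unfolded is_free_on_iff]
  have nB: "is_ncat (enat (Suc n)) B" using fr' by simp
  interpret weighted_ncat n B e by unfold_locales fact+
  have tB: "is_ncat (enat n) (trunc n B)" using trunc_ncat[OF nB, of n] by simp
  note ag = agree_upto_computads[OF w_agree tB, where \<kappa> = \<kappa>]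
  have nA: "is_ncat (enat n) A" using fr' nComp_small_ncat by blast
  have "|cells C k| <o \<kappa>" for k
  proof (cases "k = Suc n")
    case True
    then show ?thesis using fr' by (auto intro!: small_image small_times_nat)
  qed (use fr' in auto)
  then have "C \<in> Obj (CCat \<kappa> n (nComp \<kappa> n))" using weighted_ncat ag(1) fr' by simp
  moreover have "f \<in> Hom (nComp \<kappa> n) A (trunc n C)" using ag(3)[OF nA] fr' by blast
  moreover define g1 where "g1 = restrict (\<lambda>x. e (h x, w x)) X"
  have "attaches n C X \<delta> f g1"
    using fr' by (auto simp: attaches_def g1_def)
  ultimately obtain F where F: "F \<in> nfunctors (enat (Suc n)) B C"
      "trunc_map n F \<in> Hom (nComp \<kappa> n) (trunc n B) (trunc n C)"
      "ncompose A (trunc_map n F) f = f" "compose X (F (Suc n)) h = g1"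
    using fr' by metis
  have hX: "h x \<in> cells B (Suc n)" if "x \<in> X" for x using fr' that by (auto simp: attaches_def)
  have Fh: "F (Suc n) (h x) = e (h x, w x)" if "x \<in> X" for x
    using fun_cong[OF F(4), of x] that by (simp add: compose_def g1_def)
  define G where "G = F(Suc n := restrict (\<lambda>y. fst (inv e (F (Suc n) y))) (cells B (Suc n)))"
  have G: "G \<in> nfunctors (enat (Suc n)) B B" unfolding G_def by (rule w_projection[OF F(1)])
  have tG: "trunc_map n G = trunc_map n F" by (auto simp: trunc_map_def G_def)
  have "compose X (G (Suc n)) h = h"
    using fr' Fh inj hX by (auto simp: attaches_def compose_def G_def fun_eq_iff PiE_iff extensional_def)
  then have GB: "G = nid B"
    using free_endomorphism[OF fr G] F(2,3) tG ag(3)[OF tB] by simp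
  have p: "fst (inv e (F (Suc n) y)) = y" if y: "y \<in> cells B (Suc n)" for y
  proof -
    have "fst (inv e (F (Suc n) y)) = G (Suc n) y" using y by (simp add: G_def)
    also have "\<dots> = y" using y by (simp add: GB)
    finally show ?thesis .
  qed
  define \<phi> where "\<phi> y = snd (inv e (F (Suc n) y))" for y
  show ?thesis unfolding weight_def
  proof (intro exI[of _ \<phi>] conjI ballI allI impI)
    show "\<phi> (h x) = w x" if "x \<in> X" for x using Fh[OF that] inj by (simp add: \<phi>_def)
    show "\<phi> (idt B n x) = 0" if "x \<in> cells B n" for x
      using nfunctorsD(5)[OF F(1), of n x] that inj by (simp add: \<phi>_def)
    show "\<phi> (hcmp B (Suc n) j u v) = \<phi> u + \<phi> v" if "composable B (Suc n) j u v" for j u v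
      using nfunctorsD(6)[OF F(1) that] inj by (simp add: \<phi>_def weighted_def)
  qed
qed

text \<open>Generators that are indecomposable belong to every generating set. Conversely, suppose that some
  presentation had a further indet. The weight counting only that indet vanishes on the
  given generators, hence everywhere, a contradiction.\<close>

lemma (in small_universe) indets_eqI:
  assumes fr: "is_free_on \<kappa> n (nComp \<kappa> n) B (A, X, \<delta>) (f, h)"
    and idt: "\<And>g x. \<lbrakk>g \<in> h ` X; x \<in> cells B n\<rbrakk> \<Longrightarrow> idt B n x \<noteq> g"
    and cmp: "\<And>g j u v. \<lbrakk>g \<in> h ` X; composable B (Suc n) j u v; hcmp B (Suc n) j u v = g\<rbrakk>
      \<Longrightarrow> u = g \<or> v = g"
  shows "indets \<kappa> n (nComp \<kappa> n) B = h ` X"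
proof
  show "h ` X \<subseteq> indets \<kappa> n (nComp \<kappa> n) B"
    using fr unfolding subset_eq indets_iff by blast
  show "indets \<kappa> n (nComp \<kappa> n) B \<subseteq> h ` X"
  proof
    fix y assume "y \<in> indets \<kappa> n (nComp \<kappa> n) B"
    then obtain A' X' \<delta>' f' h' x where fr2: "is_free_on \<kappa> n (nComp \<kappa> n) B (A', X', \<delta>') (f', h')"
      and x: "x \<in> X'" "y = h' x"
      unfolding indets_iff by blast
    have hX: "h z \<in> cells B (Suc n)" if "z \<in> X" for z
      using fr[unfolded is_free_on_iff] that by (auto simp: attaches_def)
    have h'X: "h' z \<in> cells B (Suc n)" if "z \<in> X'" for z
      using fr2[unfolded is_free_on_iff] that by (auto simp: attaches_def)
    have sub: "h ` X \<subseteq> h' ` X'"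
    proof (rule ccontr)
      assume "\<not> h ` X \<subseteq> h' ` X'"
      then obtain z where z: "z \<in> X" "h z \<notin> h' ` X'" by blast
      have hz: "h z \<in> h ` X" using z(1) by blast
      have "h z \<noteq> h z"
      proof (rule free_generated[OF fr2, where Q = "\<lambda>y. y \<noteq> h z"])
        show "h' x \<noteq> h z" if "x \<in> X'" for x using z(2) that by force
        show "idt B n x \<noteq> h z" if "x \<in> cells B n" for x using idt[OF hz that] .
        show "hcmp B (Suc n) j u v \<noteq> h z"
          if "composable B (Suc n) j u v" "u \<noteq> h z" "v \<noteq> h z" for j u v
          using cmp[OF hz that(1)] that(2,3) by blast
      qed (use hX z in blast)
      then show False by simp
    qed
    show "y \<in> h ` X"
    proof (rule ccontr)
      assume ny: "y \<notin> h ` X"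
      obtain \<phi> where w: "weight n B \<phi>" and \<phi>: "\<forall>z\<in>X'. \<phi> (h' z) = (if z = x then 1 else 0)"
        using free_weight[OF fr2, of "\<lambda>z. if z = x then 1 else 0"] by blast
      have "\<phi> (h z) = 0" if zX: "z \<in> X" for z
      proof -
        obtain z' where z': "z' \<in> X'" "h z = h' z'" using subsetD[OF sub imageI[OF zX]] by auto
        have "z' \<noteq> x" using ny x(2) z'(2) imageI[OF zX, of h] by metis
        then show ?thesis using bspec[OF \<phi> z'(1)] z'(2) by simp
      qed
      then have "\<phi> y = 0"
        by (rule free_generated[OF fr, where Q = "\<lambda>y. \<phi> y = 0"]) (use w[unfolded weight_def] h'X x in auto)
      then show False using bspec[OF \<phi> x(1)] x(2) by simp
    qed
  qed
qed

section \<open>Recognising free extensions\<close>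

text \<open>Existence of extensions has to be shown for arbitrary \<open>(n+1)\<close>-categories \<open>C\<close> and functors \<open>g\<close>
  only, which frees the proofs of freeness below from the inductive definition of computads.
  Uniqueness follows from generation.\<close>

lemma (in small_universe) is_free_onI:
  assumes nB: "is_ncat (enat (Suc n)) B" and sB: "\<And>k. |cells B k| <o \<kappa>"
    and tB: "trunc n B \<in> Obj (nComp \<kappa> n)" and X: "X \<subseteq> cells B (Suc n)"
    and gen: "\<And>Q y. \<lbrakk>\<And>x. x \<in> X \<Longrightarrow> Q x; \<And>x. x \<in> cells B n \<Longrightarrow> Q (idt B n x);
        \<And>j u v. \<lbrakk>composable B (Suc n) j u v; Q u; Q v\<rbrakk> \<Longrightarrow> Q (hcmp B (Suc n) j u v);
        y \<in> cells B (Suc n)\<rbrakk> \<Longrightarrow> Q y"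
    and ext: "\<And>C g g1. \<lbrakk>is_ncat (enat (Suc n)) C; g \<in> nfunctors (enat n) (trunc n B) (trunc n C);
        \<And>x. x \<in> X \<Longrightarrow> g1 x \<in> cells C (Suc n) \<and>
          dm C n (g1 x) = g n (dm B n x) \<and> cd C n (g1 x) = g n (cd B n x)\<rbrakk> \<Longrightarrow>
      \<exists>F. lifts n B C g F \<and> (\<forall>x\<in>X. F x = g1 x)"
  shows "is_free_on \<kappa> n (nComp \<kappa> n) B
    (trunc n B, X, restrict (\<lambda>x. (dm B n x, cd B n x)) X) (nid (trunc n B), restrict (\<lambda>x. x) X)"
proof -
  interpret hcat "enat (Suc n)" B by unfold_locales fact
  have ntB: "is_ncat (enat n) (trunc n B)" using trunc_ncat[OF nB, of n] by simp
  let ?\<delta> = "restrict (\<lambda>x. (dm B n x, cd B n x)) X"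
  have par: "?\<delta> \<in> X \<rightarrow>\<^sub>E parallel n (trunc n B)"
    using X by (auto simp: parallel_def dm_glob cd_glob)
  have att: "attaches n B X ?\<delta> (nid (trunc n B)) (restrict (\<lambda>x. x) X)"
    using X dm_cell[OF subsetD[OF X]] cd_cell[OF subsetD[OF X]] by (auto simp: attaches_def)
  have idr: "ncompose (trunc n B) g (nid (trunc n B)) = g"
    if "g \<in> nfunctors (enat n) (trunc n B) D" for g D
    by (rule nfunctors_ext[OF ncompose_functor[OF nid_functor[OF ntB] that ntB] that]) auto
  have univ: "\<exists>!F. F \<in> nfunctors (enat (Suc n)) B C \<and>
      trunc_map n F \<in> Hom (nComp \<kappa> n) (trunc n B) (trunc n C) \<and>
      ncompose (trunc n B) (trunc_map n F) (nid (trunc n B)) = g \<and>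
      compose X (F (Suc n)) (restrict (\<lambda>x. x) X) = g1"
    if C: "C \<in> Obj (CCat \<kappa> n (nComp \<kappa> n))"
      and g: "g \<in> Hom (nComp \<kappa> n) (trunc n B) (trunc n C)" and g1: "attaches n C X ?\<delta> g g1" for C g g1
  proof -
    have g': "g \<in> nfunctors (enat n) (trunc n B) (trunc n C)" using nComp_functor g .
    have nC: "is_ncat (enat (Suc n)) C" using C by simp
    have g1': "g1 x \<in> cells C (Suc n) \<and> dm C n (g1 x) = g n (dm B n x) \<and> cd C n (g1 x) = g n (cd B n x)"
      if "x \<in> X" for x using g1 that by (auto simp: attaches_def)
    have g1e: "g1 \<in> extensional X" using g1 by (auto simp: attaches_def PiE_iff)
    obtain F where F: "lifts n B C g F" "\<forall>x\<in>X. F x = g1 x"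
      using ext[OF nC g' g1'] by blast
    define F1 where "F1 = restrict F (cells B (Suc n))"
    note Ff = lift_functor[OF nB g' F(1), folded F1_def] and F' = F(1)[unfolded lifts_def]
    show ?thesis
    proof (rule ex1I[of _ "g(Suc n := F1)"])
      have "compose X F1 (restrict (\<lambda>x. x) X) = g1"
        by (rule extensionalityI[OF _ g1e]) (use F(2) X in \<open>auto simp: compose_def F1_def\<close>)
      then show "g(Suc n := F1) \<in> nfunctors (enat (Suc n)) B C \<and>
          trunc_map n (g(Suc n := F1)) \<in> Hom (nComp \<kappa> n) (trunc n B) (trunc n C) \<and>
          ncompose (trunc n B) (trunc_map n (g(Suc n := F1))) (nid (trunc n B)) = g \<and>
          compose X ((g(Suc n := F1)) (Suc n)) (restrict (\<lambda>x. x) X) = g1"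
        using Ff g idr[OF g'] by simp
    next
      fix G assume G: "G \<in> nfunctors (enat (Suc n)) B C \<and>
          trunc_map n G \<in> Hom (nComp \<kappa> n) (trunc n B) (trunc n C) \<and>
          ncompose (trunc n B) (trunc_map n G) (nid (trunc n B)) = g \<and>
          compose X (G (Suc n)) (restrict (\<lambda>x. x) X) = g1"
      then have Gn: "G \<in> nfunctors (enat (Suc n)) B C" by blast
      have "trunc_map n G \<in> nfunctors (enat n) (trunc n B) (trunc n C)"
        using trunc_map_functor[OF Gn, of n] by simp
      then have tG: "trunc_map n G = g" using G idr by metis
      then have low: "G k = g k" if "k \<le> n" for k
        using that fun_cong[OF tG, of k] by (auto simp: trunc_map_def)
      have GX: "G (Suc n) x = g1 x" if "x \<in> X" for x
      proof -
        have "compose X (G (Suc n)) (restrict (\<lambda>x. x) X) x = g1 x" using G by simp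
        then show ?thesis using that by (simp add: compose_def)
      qed
      have top: "G (Suc n) y = F y" if "y \<in> cells B (Suc n)" for y
        by (rule gen[where Q = "\<lambda>y. G (Suc n) y = F y"])
          (use GX F(2) F' nfunctorsD(5,6)[OF Gn] low that in auto)
      show "G = g(Suc n := F1)"
      proof (rule nfunctors_ext[OF Gn Ff(1)])
        fix k x assume x: "x \<in> cells B k"
        then consider "k \<le> n" | "k = Suc n" using cell_le[OF x] by fastforce
        then show "G k x = (g(Suc n := F1)) k x"
          by cases (use x low top in \<open>auto simp: F1_def\<close>)
      qed
    qed
  qed
  show ?thesis unfolding is_free_on_iff
    using nB sB tB par att univ nComp_nid[OF ntB] small_subset[OF sB X] by simp
qed


section \<open>Dimensions without generators\<close>

text \<open>If all \<open>(n+1)\<close>-cells are identities, composites along \<open>n\<close>-cells are trivial and those along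
  lower cells are governed by the nullary interchange law.\<close>

lemma idle_extension:
  assumes nB: "is_ncat (enat (Suc n)) B" and nC: "is_ncat (enat (Suc n)) C"
    and g: "g \<in> nfunctors (enat n) (trunc n B) (trunc n C)"
    and idle: "\<And>y. y \<in> cells B (Suc n) \<Longrightarrow> \<exists>x\<in>cells B n. y = idt B n x"
  shows "lifts n B C g (\<lambda>y. idt C n (g n (dm B n y)))"
proof -
  interpret B: hcat "enat (Suc n)" B by unfold_locales fact
  interpret C: hcat "enat (Suc n)" C by unfold_locales fact
  note G = nfunctorsD[OF g]
  define F where "F y = idt C n (g n (dm B n y))" for y
  have eq: "y = idt B n (dm B n y)" "cd B n y = dm B n y" if y: "y \<in> cells B (Suc n)" for y
    using idle[OF y] B.dm_idt B.cd_idt by auto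
  have gc: "g n x \<in> cells C n" if "x \<in> cells B n" for x using G(2)[of x n] that by simp
  have "F y \<in> cells C (Suc n) \<and> dm C n (F y) = g n (dm B n y) \<and> cd C n (F y) = g n (cd B n y)"
    if y: "y \<in> cells B (Suc n)" for y
    using eq(2)[OF y] gc[OF B.dm_cell[OF y]] C.idt_cell[of n] C.dm_idt[of n] C.cd_idt[of n]
    by (simp add: F_def)
  moreover have "F (idt B n x) = idt C n (g n x)" if "x \<in> cells B n" for x
    using that by (simp add: F_def B.dm_idt)
  moreover have "F (hcmp B (Suc n) j u v) = hcmp C (Suc n) j (F u) (F v)"
    if c: "composable B (Suc n) j u v" for j u v
  proof (cases "j < n")
    case True
    have "composable B n j (dm B n u) (dm B n v)" using B.composable_dm c True .
    moreover from this have "composable (trunc n B) n j (dm B n u) (dm B n v)" by simp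
    moreover have "composable C n j (g n (dm B n u)) (g n (dm B n v))"
      using nfunctors_composable[OF g trunc_ncat[OF nB, of n] calculation(2)] by simp
    ultimately show ?thesis
      using G(6)[of n j "dm B n u" "dm B n v"] by (simp add: F_def B.dm_hcmp[OF c True] C.idt_hcmp)
  next
    case False
    then have j: "j = n" using c by (auto simp: composable_def)
    have uv: "u \<in> cells B (Suc n)" "v \<in> cells B (Suc n)" "dm B n u = cd B n v"
      using c unfolding j B.composable_top by auto
    then have "dm B n u = dm B n v" using eq by simp
    moreover have "F v \<in> cells C (Suc n)" "dm C n (F v) = g n (dm B n v)"
      using C.idt_cell[of n] C.dm_idt[of n] gc[OF B.dm_cell[OF uv(2)]] by (auto simp: F_def)
    ultimately show ?thesis
      using C.unit_right[of n "Suc n" "F v"] B.dm_hcmp_top[OF c[unfolded j]]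
      by (simp add: j F_def Suc_diff_le)
  qed
  ultimately show ?thesis unfolding lifts_def F_def by blast
qed

lemma (in small_universe) free_on_nothing:
  assumes nB: "is_ncat (enat (Suc n)) B" and sB: "\<And>k. |cells B k| <o \<kappa>"
    and tB: "trunc n B \<in> Obj (nComp \<kappa> n)"
    and idle: "\<And>y. y \<in> cells B (Suc n) \<Longrightarrow> \<exists>x\<in>cells B n. y = idt B n x"
  shows "is_free_on \<kappa> n (nComp \<kappa> n) B
    (trunc n B, {}, restrict (\<lambda>x. (dm B n x, cd B n x)) {}) (nid (trunc n B), restrict (\<lambda>x. x) {})"
proof (rule is_free_onI[OF nB sB tB])
  show "\<exists>F. lifts n B C g F \<and> (\<forall>x\<in>{}. F x = g1 x)"
    if "is_ncat (enat (Suc n)) C" "g \<in> nfunctors (enat n) (trunc n B) (trunc n C)" for C g g1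
    using idle_extension[OF nB that idle] by blast
next
  fix Q y assume "\<And>x. x \<in> cells B n \<Longrightarrow> Q (idt B n x)" "y \<in> cells B (Suc n)"
  then show "Q y" using idle by blast
qed simp


section \<open>Computads of all dimensions\<close>

text \<open>The indets of dimension \<open>k + 1\<close>.\<close>

definition gens :: "'u rel \<Rightarrow> nat \<Rightarrow> 'u ncat \<Rightarrow> 'u set" where
  "gens \<kappa> k A = indets \<kappa> k (nComp \<kappa> k) (trunc (Suc k) A)"

text \<open>The inductive definition of computads unwound, for all dimensions including \<open>\<infinity>\<close> at once.\<close>

definition computad :: "'u rel \<Rightarrow> enat \<Rightarrow> 'u ncat \<Rightarrow> bool" where
  "computad \<kappa> N A \<longleftrightarrow> is_ncat N A \<and> (\<forall>k. |cells A k| <o \<kappa>) \<and>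
    (\<forall>k. enat (Suc k) \<le> N \<longrightarrow> (\<exists>P \<eta>. is_free_on \<kappa> k (nComp \<kappa> k) (trunc (Suc k) A) P \<eta>))"

definition computad_maps :: "'u rel \<Rightarrow> enat \<Rightarrow> 'u ncat \<Rightarrow> 'u ncat \<Rightarrow> 'u nmap set" where
  "computad_maps \<kappa> N A B = {f \<in> nfunctors N A B.
    \<forall>k. enat (Suc k) \<le> N \<longrightarrow> f (Suc k) ` gens \<kappa> k A \<subseteq> gens \<kappa> k B}"

lemma gens_trunc [simp]: "k < n \<Longrightarrow> gens \<kappa> k (trunc n A) = gens \<kappa> k A"
  by (simp add: gens_def)

lemma trunc_map_apply [simp]: "k \<le> n \<Longrightarrow> trunc_map n f k = f k"
  by (simp add: trunc_map_def)

lemma nComp_Obj: "Obj (nComp \<kappa> n) = {A. computad \<kappa> (enat n) A}"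
proof (induction n)
  case 0
  then show ?case by (auto simp: computad_def zero_enat_def)
next
  case (Suc n)
  show ?case
  proof (intro set_eqI iffI; unfold mem_Collect_eq)
    fix A assume "A \<in> Obj (nComp \<kappa> (Suc n))"
    then obtain P \<eta> where fr: "is_free_on \<kappa> n (nComp \<kappa> n) A P \<eta>" by (auto simp del: split_paired_Ex)
    then have A: "is_ncat (enat (Suc n)) A" "\<And>k. |cells A k| <o \<kappa>" "trunc n A \<in> Obj (nComp \<kappa> n)"
      by (auto simp: is_free_on_def)
    then have "computad \<kappa> (enat n) (trunc n A)" using Suc by simp
    then show "computad \<kappa> (enat (Suc n)) A"
      using A fr trunc_id[OF A(1)] unfolding computad_def
      by (auto simp: le_Suc_eq min_def simp del: split_paired_Ex)
  next
    fix A assume A: "computad \<kappa> (enat (Suc n)) A"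
    then have "is_ncat (enat (Suc n)) A" unfolding computad_def by (elim conjE)
    then have "trunc (Suc n) A = A" by (rule trunc_id)
    moreover have "\<exists>P \<eta>. is_free_on \<kappa> n (nComp \<kappa> n) (trunc (Suc n) A) P \<eta>"
      using A unfolding computad_def by blast
    ultimately show "A \<in> Obj (nComp \<kappa> (Suc n))" by simp
  qed
qed

lemma nComp_Hom:
  assumes "is_ncat (enat n) A" "is_ncat (enat n) B"
  shows "Hom (nComp \<kappa> n) A B = computad_maps \<kappa> (enat n) A B"
  using assms
proof (induction n arbitrary: A B)
  case 0
  then show ?case by (auto simp: computad_maps_def zero_enat_def)
next
  case (Suc n)
  have t: "is_ncat (enat n) (trunc n A)" "is_ncat (enat n) (trunc n B)"
    using Suc.prems trunc_ncat[of "enat (Suc n)" _ n] by auto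
  have g: "indets \<kappa> n (nComp \<kappa> n) A = gens \<kappa> n A" "indets \<kappa> n (nComp \<kappa> n) B = gens \<kappa> n B"
    using Suc.prems by (simp_all add: gens_def trunc_id)
  show ?case
    using trunc_map_functor[of _ "enat (Suc n)" A B n]
    by (auto simp: Suc.IH[OF t] g computad_maps_def le_Suc_eq less_Suc_eq_le image_subset_iff)
qed

lemma Comp_Obj: "Obj (Comp \<kappa>) = {A. computad \<kappa> \<infinity> A}"
proof (intro set_eqI iffI; unfold mem_Collect_eq)
  fix A assume "A \<in> Obj (Comp \<kappa>)"
  then have A: "is_ncat \<infinity> A" "\<And>k. |cells A k| <o \<kappa>" "\<And>n. computad \<kappa> (enat n) (trunc n A)"
    by (auto simp: Comp_def nComp_Obj)
  have "\<exists>P \<eta>. is_free_on \<kappa> k (nComp \<kappa> k) (trunc (Suc k) A) P \<eta>" for k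
    using A(3)[of "Suc k"] unfolding computad_def by (metis min.idem order_refl trunc_trunc)
  then show "computad \<kappa> \<infinity> A" using A by (simp add: computad_def)
next
  fix A assume A: "computad \<kappa> \<infinity> A"
  have "computad \<kappa> (enat n) (trunc n A)" for n
  proof -
    have "|{} :: 'a set| <o \<kappa>"
      using A card_of_empty[of "cells A 0"] ordLeq_ordLess_trans unfolding computad_def by blast
    then show ?thesis
      using A trunc_ncat[of \<infinity> A n] unfolding computad_def
      by (auto simp: min_def simp del: split_paired_Ex)
  qed
  then show "A \<in> Obj (Comp \<kappa>)" using A by (simp add: Comp_def nComp_Obj computad_def)
qed

lemma Comp_Hom:
  assumes "is_ncat \<infinity> A" "is_ncat \<infinity> B"
  shows "Hom (Comp \<kappa>) A B = computad_maps \<kappa> \<infinity> A B"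
proof -
  have t: "is_ncat (enat n) (trunc n A)" "is_ncat (enat n) (trunc n B)" for n
    using assms trunc_ncat[of \<infinity> _ n] by auto
  show ?thesis
  proof (intro set_eqI iffI)
    fix f assume f: "f \<in> Hom (Comp \<kappa>) A B"
    then have n: "f \<in> nfunctors \<infinity> A B" by (simp add: Comp_def)
    have "trunc_map (Suc k) f \<in> computad_maps \<kappa> (enat (Suc k)) (trunc (Suc k) A) (trunc (Suc k) B)" for k
      using f by (simp add: Comp_def nComp_Hom[OF t] del: nComp.simps)
    then have "f (Suc k) ` gens \<kappa> k A \<subseteq> gens \<kappa> k B" for k
      unfolding computad_maps_def by fastforce
    then show "f \<in> computad_maps \<kappa> \<infinity> A B" using n by (simp add: computad_maps_def)
  next
    fix f assume f: "f \<in> computad_maps \<kappa> \<infinity> A B"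
    then have n: "f \<in> nfunctors \<infinity> A B" by (simp add: computad_maps_def)
    have "trunc_map n f \<in> computad_maps \<kappa> (enat n) (trunc n A) (trunc n B)" for n
      using f trunc_map_functor[OF n, of n] by (auto simp: computad_maps_def)
    then show "f \<in> Hom (Comp \<kappa>) A B"
      using n by (simp add: Comp_def nComp_Hom[OF t] del: nComp.simps)
  qed
qed


section \<open>Doubly degenerate cells\<close>

locale commutative_monoid_on =
  fixes M :: "'a set" and f :: "'a \<Rightarrow> 'a \<Rightarrow> 'a" and e :: 'a
  assumes closed [simp]: "\<lbrakk>x \<in> M; y \<in> M\<rbrakk> \<Longrightarrow> f x y \<in> M" and unit_closed [simp]: "e \<in> M"
    and unit [simp]: "x \<in> M \<Longrightarrow> f e x = x"
    and comm: "\<lbrakk>x \<in> M; y \<in> M\<rbrakk> \<Longrightarrow> f x y = f y x"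
    and assoc: "\<lbrakk>x \<in> M; y \<in> M; z \<in> M\<rbrakk> \<Longrightarrow> f (f x y) z = f x (f y z)"
begin

lemma left_comm: "\<lbrakk>x \<in> M; y \<in> M; z \<in> M\<rbrakk> \<Longrightarrow> f x (f y z) = f y (f x z)"
  by (metis assoc comm)

lemma medial: "\<lbrakk>x \<in> M; y \<in> M; z \<in> M; w \<in> M\<rbrakk> \<Longrightarrow> f (f x y) (f z w) = f (f x z) (f y w)"
  by (metis assoc comm closed)

text \<open>Extending \<open>\<gamma>\<close> to multisets by folding. The steps must commute for all arguments, so outside \<open>T\<close> and
  \<open>M\<close> they are made trivial.\<close>

lemma multiset_extension:
  assumes \<gamma>: "\<And>t. t \<in> T \<Longrightarrow> \<gamma> t \<in> M"
  shows "\<exists>\<Phi>. \<Phi> {#} = e \<and> (\<forall>t\<in>T. \<Phi> {#t#} = \<gamma> t) \<and> (\<forall>\<tau>. set_mset \<tau> \<subseteq> T \<longrightarrow> \<Phi> \<tau> \<in> M) \<and>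
    (\<forall>\<sigma> \<tau>. set_mset \<sigma> \<subseteq> T \<longrightarrow> set_mset \<tau> \<subseteq> T \<longrightarrow> \<Phi> (\<sigma> + \<tau>) = f (\<Phi> \<sigma>) (\<Phi> \<tau>))"
proof -
  define step where "step t a = (if t \<in> T \<and> a \<in> M then f (\<gamma> t) a else a)" for t a
  interpret s: comp_fun_commute step
    by unfold_locales (auto simp: step_def fun_eq_iff \<gamma> left_comm)
  let ?\<Phi> = "fold_mset step e"
  have M: "?\<Phi> \<tau> \<in> M" if "set_mset \<tau> \<subseteq> T" for \<tau>
    using that by (induction \<tau>) (auto simp: step_def \<gamma>)
  have cons: "?\<Phi> (add_mset t \<tau>) = f (\<gamma> t) (?\<Phi> \<tau>)" if "t \<in> T" "set_mset \<tau> \<subseteq> T" for t \<tau>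
    using that M by (simp add: step_def)
  show ?thesis
  proof (intro exI[of _ ?\<Phi>] conjI ballI allI impI)
    show "?\<Phi> {#t#} = \<gamma> t" if "t \<in> T" for t
      using that \<gamma> comm[of "\<gamma> t" e] by (simp add: step_def)
    show "?\<Phi> (\<sigma> + \<tau>) = f (?\<Phi> \<sigma>) (?\<Phi> \<tau>)" if "set_mset \<sigma> \<subseteq> T" "set_mset \<tau> \<subseteq> T" for \<sigma> \<tau>
      using that
    proof (induction \<sigma>)
      case (add t \<sigma>)
      then have "?\<Phi> (add_mset t \<sigma> + \<tau>) = f (\<gamma> t) (f (?\<Phi> \<sigma>) (?\<Phi> \<tau>))"
        using cons[of t "\<sigma> + \<tau>"] by simp
      moreover have "?\<Phi> (add_mset t \<sigma>) = f (\<gamma> t) (?\<Phi> \<sigma>)"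
        using add by (intro cons) auto
      ultimately show ?case using add.prems M \<gamma> by (simp add: assoc del: s.fold_mset_add_mset)
    qed (use M in simp)
  qed (use M in auto)
qed

end

text \<open>Evaluate \<open>(x \<cdot> e) \<cdot> (e \<cdot> y)\<close> and its variants in both orders.\<close>

lemma eckmann_hilton:
  assumes "e \<in> M" "\<And>x y. \<lbrakk>x \<in> M; y \<in> M\<rbrakk> \<Longrightarrow> f x y \<in> M"
    and f: "\<And>x. x \<in> M \<Longrightarrow> f x e = x" "\<And>x. x \<in> M \<Longrightarrow> f e x = x"
    and g: "\<And>x. x \<in> M \<Longrightarrow> g x e = x" "\<And>x. x \<in> M \<Longrightarrow> g e x = x"
    and ic: "\<And>x y z w. \<lbrakk>x \<in> M; y \<in> M; z \<in> M; w \<in> M\<rbrakk> \<Longrightarrow> f (g x y) (g z w) = g (f x z) (f y w)"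
    and x: "x \<in> M" and y: "y \<in> M"
  shows "g x y = f x y" "f x y = f y x"
proof -
  have "f x y = f (g x e) (g e y)" using x y g by simp
  also have "\<dots> = g x y" using ic[of x e e y] x y assms(1) f by simp
  finally show 1: "g x y = f x y" ..
  have "f x y = f (g e x) (g y e)" using x y g by simp
  also have "\<dots> = g y x" using ic[of e x y e] x y assms(1) f by simp
  also have "\<dots> = f (g y e) (g e x)" using ic[of y e e x] x y assms(1) f by simp
  finally show "f x y = f y x" using x y g by simp
qed

context hcat
begin

lemma idm_shift: "idm A j (Suc m) x = dm A j (idm A (Suc j) m x)"
  and icd_shift: "icd A j (Suc m) x = cd A j (icd A (Suc j) m x)"
  and iidt_shift: "iidt A (Suc j) m (idt A j x) = iidt A j (Suc m) x"
  by (induction m arbitrary: x) auto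

lemma idm_iidt:
  assumes "x \<in> cells A j" "enat (j + m) \<le> n"
  shows "idm A j m (iidt A j m x) = x" "icd A j m (iidt A j m x) = x"
proof -
  have "idm A j m (iidt A j m x) = x \<and> icd A j m (iidt A j m x) = x"
    using assms(2)
  proof (induction m)
    case (Suc m)
    then have m: "enat (j + m) \<le> n" by (simp add: order_trans[OF _ Suc.prems])
    then show ?case using Suc iidt_cell[OF assms(1) m] by (simp add: dm_idt cd_idt)
  qed simp
  then show "idm A j m (iidt A j m x) = x" "icd A j m (iidt A j m x) = x" by auto
qed

lemma idm_hcmp_below:
  assumes "composable A (i + m) j x y" "j < i"
  shows "idm A i m (hcmp A (i + m) j x y) = hcmp A i j (idm A i m x) (idm A i m y)"
    and "icd A i m (hcmp A (i + m) j x y) = hcmp A i j (icd A i m x) (icd A i m y)"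
proof -
  show "idm A i m (hcmp A (i + m) j x y) = hcmp A i j (idm A i m x) (idm A i m y)"
    using assms(1)
  proof (induction m arbitrary: x y)
    case (Suc m)
    then have "composable A (i + m) j (dm A (i + m) x) (dm A (i + m) y)"
      using composable_dm[of "i + m"] assms(2) by simp
    then show ?case using Suc assms(2) by (simp add: dm_hcmp)
  qed simp
  show "icd A i m (hcmp A (i + m) j x y) = hcmp A i j (icd A i m x) (icd A i m y)"
    using assms(1)
  proof (induction m arbitrary: x y)
    case (Suc m)
    then have "composable A (i + m) j (cd A (i + m) x) (cd A (i + m) y)"
      using composable_cd[of "i + m"] assms(2) by simp
    then show ?case using Suc assms(2) by (simp add: cd_hcmp)
  qed simp
qed

text \<open>Only the boundary in dimension 1 is prescribed. In the dimensions above it domain and codomain may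
  differ, as they do for transitions.\<close>

definition degenerate :: "nat \<Rightarrow> 'u \<Rightarrow> 'u set" where
  "degenerate m o' = {x \<in> cells A (Suc m). idm A 1 m x = idt A 0 o' \<and> icd A 1 m x = idt A 0 o'}"

text \<open>On these cells compositions along 0-cells and along 1-cells are both defined and share their
  units, so interchange makes them equal and commutative.\<close>

lemma degenerate_monoid:
  assumes o': "o' \<in> cells A 0" and m: "0 < m" and n: "enat (Suc m) \<le> n"
  shows "commutative_monoid_on (degenerate m o') (hcmp A (Suc m) 0) (iidt A 0 (Suc m) o')"
    and "\<lbrakk>x \<in> degenerate m o'; y \<in> degenerate m o'\<rbrakk> \<Longrightarrow> hcmp A (Suc m) 1 x y = hcmp A (Suc m) 0 x y"
    and "\<lbrakk>x \<in> degenerate m o'; y \<in> degenerate m o'\<rbrakk> \<Longrightarrow> composable A (Suc m) 0 x y"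
proof -
  let ?M = "degenerate m o'" and ?e = "iidt A 0 (Suc m) o'"
  have n1: "enat (Suc 0) \<le> n" using n m by (metis Suc_leI enat_ord_simps(1) le_SucI order_trans)
  have i1: "idt A 0 o' \<in> cells A 1" using idt_cell[OF n1 o'] by simp
  have e1: "?e = iidt A 1 m (idt A 0 o')" using iidt_shift[of 0 m o'] by simp
  have e: "?e \<in> ?M"
    using iidt_cell[OF o', of "Suc m"] n idm_iidt[OF i1, of m] unfolding degenerate_def e1[symmetric]
    by (simp add: e1 iidt_shift)
  have b0: "idm A 0 (Suc m) x = o'" "icd A 0 (Suc m) x = o'" if "x \<in> ?M" for x
    using that dm_idt[OF n1 o'] cd_idt[OF n1 o'] unfolding idm_shift icd_shift degenerate_def by auto
  have c0: "composable A (Suc m) 0 x y" if "x \<in> ?M" "y \<in> ?M" for x y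
    using that b0 by (auto simp: composable_def degenerate_def)
  have c1: "composable A (Suc m) 1 x y" if "x \<in> ?M" "y \<in> ?M" for x y
    using that m by (auto simp: composable_def degenerate_def)
  have ii: "hcmp A 1 0 (idt A 0 o') (idt A 0 o') = idt A 0 o'"
    using unit_right[of 0 1 "idt A 0 o'"] i1 dm_idt[OF n1 o'] by simp
  have f: "hcmp A (Suc m) 0 x y \<in> ?M" if "x \<in> ?M" "y \<in> ?M" for x y
    using idm_hcmp_below[of 1 m 0 x y] c0[OF that] hcmp_cell[OF c0[OF that]] that ii
    by (simp add: degenerate_def)
  have u0: "hcmp A (Suc m) 0 x ?e = x" "hcmp A (Suc m) 0 ?e x = x" if "x \<in> ?M" for x
    using unit_right[of 0 "Suc m" x] unit_left[of 0 "Suc m" x] b0[OF that] that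
    by (simp_all add: degenerate_def)
  have u1: "hcmp A (Suc m) 1 x ?e = x" "hcmp A (Suc m) 1 ?e x = x" if "x \<in> ?M" for x
    using unit_right[of 1 "Suc m" x] unit_left[of 1 "Suc m" x] that m
    unfolding e1 by (simp_all add: degenerate_def)
  have ic: "hcmp A (Suc m) 0 (hcmp A (Suc m) 1 x y) (hcmp A (Suc m) 1 z w) =
      hcmp A (Suc m) 1 (hcmp A (Suc m) 0 x z) (hcmp A (Suc m) 0 y w)"
    if "x \<in> ?M" "y \<in> ?M" "z \<in> ?M" "w \<in> ?M" for x y z w
    by (rule interchange) (use c0 c1 that in auto)
  note eh = eckmann_hilton[where M = ?M and e = ?e and f = "hcmp A (Suc m) 0" and g = "hcmp A (Suc m) 1",
      OF e f u0 u1 ic]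
  show "commutative_monoid_on ?M (hcmp A (Suc m) 0) ?e"
    by unfold_locales (use f e u0 eh(2) hcmp_assoc c0 in auto)
  show "\<lbrakk>x \<in> ?M; y \<in> ?M\<rbrakk> \<Longrightarrow> hcmp A (Suc m) 1 x y = hcmp A (Suc m) 0 x y" using eh(1) by blast
  show "\<lbrakk>x \<in> ?M; y \<in> ?M\<rbrakk> \<Longrightarrow> composable A (Suc m) 0 x y" by (rule c0)
qed

end


section \<open>Petri nets as computads\<close>

text \<open>Transport along an injective encoding of cells.\<close>

definition image_ncat :: "('a \<Rightarrow> 'b) \<Rightarrow> 'a ncat \<Rightarrow> 'b ncat" where
  "image_ncat c A = \<lparr>cells = \<lambda>k. c ` cells A k, dm = \<lambda>k u. c (dm A k (inv c u)),
    cd = \<lambda>k u. c (cd A k (inv c u)), idt = \<lambda>k u. c (idt A k (inv c u)),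
    hcmp = \<lambda>k j u v. c (hcmp A k j (inv c u) (inv c v))\<rparr>"

lemma image_ncat_simps [simp]:
  assumes "inj c"
  shows "cells (image_ncat c A) k = c ` cells A k"
    "dm (image_ncat c A) k (c x) = c (dm A k x)" "cd (image_ncat c A) k (c x) = c (cd A k x)"
    "idt (image_ncat c A) k (c x) = c (idt A k x)"
    "hcmp (image_ncat c A) k j (c x) (c y) = c (hcmp A k j x y)"
  using assms by (simp_all add: image_ncat_def)

lemma image_ncat_iter [simp]:
  assumes "inj c"
  shows "idm (image_ncat c A) j m (c x) = c (idm A j m x)"
    "icd (image_ncat c A) j m (c x) = c (icd A j m x)"
    "iidt (image_ncat c A) j m (c x) = c (iidt A j m x)"
  by (induction m arbitrary: x) (simp_all add: assms)

lemma composable_image_ncat: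
  assumes "inj c"
  shows "composable (image_ncat c A) k j u v \<longleftrightarrow>
    (\<exists>x y. u = c x \<and> v = c y \<and> composable A k j x y)"
  using assms by (auto simp: composable_def inj_eq)

lemma image_ncat:
  assumes A: "is_ncat n A" and c: "inj c"
  shows "is_ncat n (image_ncat c A)"
proof -
  interpret hcat n A by unfold_locales fact
  show ?thesis
  proof (rule is_ncatI, unfold composable_image_ncat[OF c])
    fix k j x y z
    assume "\<exists>xa ya. x = c xa \<and> y = c ya \<and> composable A k j xa ya"
      "\<exists>x ya. y = c x \<and> z = c ya \<and> composable A k j x ya"
    then show "hcmp (image_ncat c A) k j (hcmp (image_ncat c A) k j x y) z =
        hcmp (image_ncat c A) k j x (hcmp (image_ncat c A) k j y z)"
      using c by (auto simp: inj_eq hcmp_assoc)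
  next
    fix k j i x y z w
    assume "i < j" "\<exists>xa ya. x = c xa \<and> y = c ya \<and> composable A k j xa ya"
      "\<exists>x y. z = c x \<and> w = c y \<and> composable A k j x y"
      "\<exists>xa y. x = c xa \<and> z = c y \<and> composable A k i xa y"
      "\<exists>x ya. y = c x \<and> w = c ya \<and> composable A k i x ya"
    then show "hcmp (image_ncat c A) k i (hcmp (image_ncat c A) k j x y) (hcmp (image_ncat c A) k j z w) =
        hcmp (image_ncat c A) k j (hcmp (image_ncat c A) k i x z) (hcmp (image_ncat c A) k i y w)"
      using c by (auto simp: inj_eq intro: interchange)
  qed (use c in \<open>auto simp: cells_empty dm_glob cd_glob idt_cell dm_idt cd_idt hcmp_cell dm_hcmp_top
      cd_hcmp_top dm_hcmp cd_hcmp unit_right unit_left idt_hcmp\<close>)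
qed

type_synonym marking = "nat multiset \<times> nat multiset"

text \<open>What a multiset of transitions consumes.\<close>

definition net_input :: "(nat \<Rightarrow> nat multiset) \<Rightarrow> nat multiset \<Rightarrow> nat multiset" where
  "net_input inn \<tau> = sum_mset (image_mset inn \<tau>)"

lemma net_input_simps [simp]:
  "net_input inn {#} = {#}" "net_input inn (add_mset t \<tau>) = inn t + net_input inn \<tau>"
  "net_input inn (\<sigma> + \<tau>) = net_input inn \<sigma> + net_input inn \<tau>"
  by (simp_all add: net_input_def)

text \<open>A pair \<open>(m, \<tau>)\<close> stands for the 3-cell from \<open>m + input \<tau>\<close> to \<open>m\<close> that fires the transitions in \<open>\<tau>\<close> and
  leaves \<open>m\<close> untouched. Since no transition produces anything, firing sequences have no order and
  every 3-cell is of this form. A 2-cell \<open>m\<close> is \<open>(m, 0)\<close>, the only cell in dimensions 0 and 1 is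
  \<open>(0, 0)\<close>, and above dimension 3 all cells are identities. With this encoding an identity is
  represented by the same pair as the cell that it belongs to.\<close>

definition markings :: "nat set \<Rightarrow> nat set \<Rightarrow> nat \<Rightarrow> marking set" where
  "markings S T k = {(m, \<tau>). set_mset m \<subseteq> (if 2 \<le> k then S else {}) \<and>
    set_mset \<tau> \<subseteq> (if 3 \<le> k then T else {})}"

text \<open>Compositions along 0- and 1-cells put markings side by side. Along a 2-cell, \<open>(m, \<sigma>)\<close> after
  \<open>(m + input \<sigma>, \<tau>)\<close> fires \<open>\<sigma> + \<tau>\<close> and ends in \<open>m\<close>. Along higher cells only equal cells compose.\<close>

definition raw_net :: "enat \<Rightarrow> nat set \<Rightarrow> nat set \<Rightarrow> (nat \<Rightarrow> nat multiset) \<Rightarrow> marking ncat" where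
  "raw_net N S T inn = \<lparr>
    cells = \<lambda>k. if enat k \<le> N then markings S T k else {},
    dm = \<lambda>k x. if k \<le> 1 then ({#}, {#}) else if k = 2 then (fst x + net_input inn (snd x), {#}) else x,
    cd = \<lambda>k x. if k \<le> 1 then ({#}, {#}) else if k = 2 then (fst x, {#}) else x,
    idt = \<lambda>k x. x,
    hcmp = \<lambda>k j x y. if j \<le> 1 then (fst x + fst y, snd x + snd y)
      else if j = 2 then (fst x, snd x + snd y) else x\<rparr>"

lemma raw_net_iter:
  "idm (raw_net N S T inn) j m x = (if m = 0 \<or> 3 \<le> j then x else if j = 2
    then (fst x + net_input inn (snd x), {#}) else ({#}, {#}))"
  "icd (raw_net N S T inn) j m x = (if m = 0 \<or> 3 \<le> j then x else if j = 2
    then (fst x, {#}) else ({#}, {#}))"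
  "iidt (raw_net N S T inn) j m x = x"
  by (induction m arbitrary: x) (auto simp: raw_net_def)

lemma composable_raw_net: "composable (raw_net N S T inn) k j x y \<longleftrightarrow>
    j < k \<and> enat k \<le> N \<and> x \<in> markings S T k \<and> y \<in> markings S T k \<and>
    (j = 2 \<longrightarrow> fst x + net_input inn (snd x) = fst y) \<and> (3 \<le> j \<longrightarrow> x = y)"
  unfolding composable_def raw_net_iter by (auto simp: raw_net_def)

lemma net_input_subset:
  "\<lbrakk>\<And>t. t \<in> T \<Longrightarrow> set_mset (inn t) \<subseteq> S; set_mset \<tau> \<subseteq> T\<rbrakk> \<Longrightarrow> set_mset (net_input inn \<tau>) \<subseteq> S"
  by (induction \<tau>) auto

lemma raw_net_ncat:
  assumes "\<And>t. t \<in> T \<Longrightarrow> set_mset (inn t) \<subseteq> S"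
  shows "is_ncat N (raw_net N S T inn)"
proof -
  have lt: "enat k \<le> N" if "enat (Suc k) \<le> N" for k
    using that by (meson enat_ord_simps(1) le_SucI order_refl order_trans)
  note sub = net_input_subset[of T inn S, OF assms]
  note cells = markings_def
  show ?thesis
  proof (rule is_ncatI, unfold composable_raw_net raw_net_iter)
    fix k x assume x: "x \<in> cells (raw_net N S T inn) (Suc k)"
    consider "k \<le> 1" | "k = 2" | "3 \<le> k" by linarith
    then show "dm (raw_net N S T inn) k x \<in> cells (raw_net N S T inn) k"
      "cd (raw_net N S T inn) k x \<in> cells (raw_net N S T inn) k"
      by (cases; use x sub lt[of k] in \<open>auto simp: raw_net_def markings_def split: if_splits\<close>)+
  qed (auto simp: raw_net_def markings_def not_le[symmetric] ac_simps split: if_splits)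
qed

text \<open>Some encoding of markings as cells; one exists whenever the type of cells is infinite.\<close>

definition code :: "marking \<Rightarrow> 'u" where
  "code = (SOME c. inj c)"

definition net :: "enat \<Rightarrow> nat set \<Rightarrow> nat set \<Rightarrow> (nat \<Rightarrow> nat multiset) \<Rightarrow> 'u ncat" where
  "net N S T inn = image_ncat code (raw_net N S T inn)"

lemma ex_marking_to_nat: "\<exists>c :: marking \<Rightarrow> nat. inj c"
proof -
  define p :: "nat multiset \<Rightarrow> nat list" where "p M = (SOME xs. mset xs = M)" for M
  have p: "mset (p M) = M" for M unfolding p_def using ex_mset[of M] by (rule someI_ex)
  have "inj (\<lambda>x. to_nat (p (fst x), p (snd x)))"
    by (rule injI) (metis p from_nat_to_nat prod.collapse prod.inject)
  then show ?thesis by blast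
qed

context small_universe
begin

lemma inj_code [simp]: "inj (code :: marking \<Rightarrow> 'u)"
proof -
  obtain c :: "marking \<Rightarrow> nat" where "inj c" using ex_marking_to_nat by blast
  moreover obtain d :: "nat \<Rightarrow> 'u" where "inj d"
    using infinite_countable_subset[OF infinite_universe] by blast
  ultimately have "inj (d \<circ> c)" by (rule inj_compose[rotated])
  then show ?thesis unfolding code_def by (rule someI[where P = inj])
qed

lemma code_eq_iff [simp]: "(code x :: 'u) = code y \<longleftrightarrow> x = y"
  by (simp add: inj_eq)

lemma small_codes: "|(code :: marking \<Rightarrow> 'u) ` X| <o \<kappa>"
proof -
  obtain c :: "marking \<Rightarrow> nat" where "inj c" using ex_marking_to_nat by blast
  then have "|X| \<le>o |UNIV :: nat set|"
    by (metis card_of_ordLeq inj_on_subset subset_UNIV)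
  then have "|X| \<le>o natLeq" using card_of_nat ordLeq_ordIso_trans by blast
  then show ?thesis by (intro small_image countable_small)
qed

lemma net_simps [simp]:
  fixes N S T inn defines "B \<equiv> net N S T inn :: 'u ncat"
  shows "cells B k = (if enat k \<le> N then code ` markings S T k else {})"
    "k \<le> 1 \<Longrightarrow> dm B k (code x) = code ({#}, {#})" "k \<le> 1 \<Longrightarrow> cd B k (code x) = code ({#}, {#})"
    "dm B 2 (code x) = code (fst x + net_input inn (snd x), {#})" "cd B 2 (code x) = code (fst x, {#})"
    "3 \<le> k \<Longrightarrow> dm B k (code x) = code x" "3 \<le> k \<Longrightarrow> cd B k (code x) = code x"
    "idt B k (code x) = code x"
    "j \<le> 1 \<Longrightarrow> hcmp B k j (code x) (code y) = code (fst x + fst y, snd x + snd y)"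
    "hcmp B k 2 (code x) (code y) = code (fst x, snd x + snd y)"
    "3 \<le> j \<Longrightarrow> hcmp B k j (code x) (code y) = code x"
  by (simp_all add: B_def net_def raw_net_def)

lemma composable_net: "composable (net N S T inn :: 'u ncat) k j u v \<longleftrightarrow>
    (\<exists>x y. u = code x \<and> v = code y \<and> j < k \<and> enat k \<le> N \<and> x \<in> markings S T k \<and> y \<in> markings S T k \<and>
    (j = 2 \<longrightarrow> fst x + net_input inn (snd x) = fst y) \<and> (3 \<le> j \<longrightarrow> x = y))"
  unfolding net_def composable_image_ncat[OF inj_code] composable_raw_net by blast

lemma net_ncat: "(\<And>t. t \<in> T \<Longrightarrow> set_mset (inn t) \<subseteq> S) \<Longrightarrow> is_ncat N (net N S T inn :: 'u ncat)"
  unfolding net_def by (rule image_ncat[OF raw_net_ncat inj_code])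

lemma trunc_net:
  assumes "enat k \<le> N"
  shows "trunc k (net N S T inn :: 'u ncat) = net (enat k) S T inn"
proof -
  have "enat x \<le> N" if "x \<le> k" for x
    using that assms by (meson enat_ord_simps(1) order_trans)
  then show ?thesis
    by (auto simp: trunc_def net_def image_ncat_def raw_net_def fun_eq_iff)
qed


definition net_gens :: "nat set \<Rightarrow> nat set \<Rightarrow> nat \<Rightarrow> 'u set" where
  "net_gens S T k = (if k = 1 then (\<lambda>s. code ({#s#}, {#})) ` S
    else if k = 2 then (\<lambda>t. code ({#}, {#t#})) ` T else {})"

lemma net_small: "|cells (net N S T inn :: 'u ncat) k| <o \<kappa>"
  using small_codes[of "markings S T k"] small_codes[of "{}"] by simp

lemma markings_iff: "(m, \<tau>) \<in> markings S T k \<longleftrightarrow>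
    set_mset m \<subseteq> (if 2 \<le> k then S else {}) \<and> set_mset \<tau> \<subseteq> (if 3 \<le> k then T else {})"
  by (simp add: markings_def)

text \<open>The 2-cells of \<open>C\<close> between identities of a 0-cell form a commutative monoid, into which the
  values on places extend additively.\<close>

lemma net_free_places:
  assumes wf: "\<And>t. t \<in> T \<Longrightarrow> set_mset (inn t) \<subseteq> S" and B: "B = (net (enat (Suc 1)) S T inn :: 'u ncat)"
    and tB: "trunc 1 B \<in> Obj (nComp \<kappa> 1)"
  shows "is_free_on \<kappa> 1 (nComp \<kappa> 1) B
    (trunc 1 B, net_gens S T 1, restrict (\<lambda>x. (dm B 1 x, cd B 1 x)) (net_gens S T 1))
    (nid (trunc 1 B), restrict (\<lambda>x. x) (net_gens S T 1))"
proof (rule is_free_onI[OF _ _ tB])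
  show "is_ncat (enat (Suc 1)) B" unfolding B using net_ncat wf .
  show "|cells B k| <o \<kappa>" for k unfolding B by (rule net_small)
  show "net_gens S T 1 \<subseteq> cells B (Suc 1)" by (auto simp: B net_gens_def markings_iff)
next
  fix Q y
  assume Q: "\<And>x. x \<in> net_gens S T 1 \<Longrightarrow> Q x" "\<And>x. x \<in> cells B 1 \<Longrightarrow> Q (idt B 1 x)"
    "\<And>j u v. composable B (Suc 1) j u v \<Longrightarrow> Q u \<Longrightarrow> Q v \<Longrightarrow> Q (hcmp B (Suc 1) j u v)"
  assume "y \<in> cells B (Suc 1)"
  then obtain m where y: "y = code (m, {#})" and m: "set_mset m \<subseteq> S"
    by (auto simp: B markings_def)
  show "Q y" unfolding y using m
  proof (induction m)
    case empty
    then show ?case using Q(2)[of "code ({#}, {#})"] by (simp add: B markings_iff)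
  next
    case (add s m)
    then show ?case
      using Q(3)[of 0 "code ({#s#}, {#})" "code (m, {#})"] Q(1)[of "code ({#s#}, {#})"]
      by (auto simp: B net_gens_def composable_net markings_iff)
  qed
next
  fix C g g1
  assume nC: "is_ncat (enat (Suc 1)) C" and g: "g \<in> nfunctors (enat 1) (trunc 1 B) (trunc 1 C)"
    and g1: "\<And>x. x \<in> net_gens S T 1 \<Longrightarrow> g1 x \<in> cells C (Suc 1) \<and>
      dm C 1 (g1 x) = g 1 (dm B 1 x) \<and> cd C 1 (g1 x) = g 1 (cd B 1 x)"
  interpret C: hcat "enat (Suc 1)" C by unfold_locales fact
  note G = nfunctorsD[OF g]
  let ?z = "code ({#}, {#}) :: 'u"
  define o' where "o' = g 0 ?z"
  have o': "o' \<in> cells C 0" using G(2)[of ?z 0] by (simp add: o'_def B markings_iff)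
  have g1z: "g 1 ?z = idt C 0 o'" using G(5)[of 0 ?z] by (simp add: o'_def B markings_iff)
  define \<gamma> where "\<gamma> s = g1 (code ({#s#}, {#}))" for s
  have dg: "x \<in> C.degenerate 1 o' \<longleftrightarrow> x \<in> cells C (Suc 1) \<and> dm C 1 x = g 1 ?z \<and> cd C 1 x = g 1 ?z" for x
    by (simp add: C.degenerate_def g1z[simplified])
  have \<gamma>: "\<gamma> s \<in> C.degenerate 1 o'" if "s \<in> S" for s
    unfolding dg using g1[of "code ({#s#}, {#})"] that by (auto simp: \<gamma>_def net_gens_def B)
  note dm = C.degenerate_monoid[OF o' zero_less_one order_refl]
  interpret M: commutative_monoid_on "C.degenerate 1 o'" "hcmp C (Suc 1) 0" "iidt C 0 (Suc 1) o'"
    by (rule dm(1))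
  obtain \<Phi> where \<Phi>': "\<Phi> {#} = iidt C 0 (Suc 1) o' \<and> (\<forall>t\<in>S. \<Phi> {#t#} = \<gamma> t) \<and>
      (\<forall>\<tau>. set_mset \<tau> \<subseteq> S \<longrightarrow> \<Phi> \<tau> \<in> C.degenerate 1 o') \<and>
      (\<forall>\<sigma> \<tau>. set_mset \<sigma> \<subseteq> S \<longrightarrow> set_mset \<tau> \<subseteq> S \<longrightarrow> \<Phi> (\<sigma> + \<tau>) = hcmp C (Suc 1) 0 (\<Phi> \<sigma>) (\<Phi> \<tau>))"
    using M.multiset_extension[of S \<gamma>, OF \<gamma>] ..
  have \<Phi>: "\<Phi> {#} = iidt C 0 (Suc 1) o'" "\<And>\<tau>. set_mset \<tau> \<subseteq> S \<Longrightarrow> \<Phi> \<tau> \<in> C.degenerate 1 o'" "\<And>t. t \<in> S \<Longrightarrow> \<Phi> {#t#} = \<gamma> t"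
    "\<And>\<sigma> \<tau>. \<lbrakk>set_mset \<sigma> \<subseteq> S; set_mset \<tau> \<subseteq> S\<rbrakk> \<Longrightarrow> \<Phi> (\<sigma> + \<tau>) = hcmp C (Suc 1) 0 (\<Phi> \<sigma>) (\<Phi> \<tau>)"
    using \<Phi>' by simp_all
  define F where "F u = \<Phi> (fst (inv code u))" for u :: 'u
  have cell: "F y \<in> cells C (Suc 1) \<and> dm C 1 (F y) = g 1 (dm B 1 y) \<and> cd C 1 (F y) = g 1 (cd B 1 y)"
    if "y \<in> cells B (Suc 1)" for y
    using that \<Phi>(2)[unfolded dg] by (auto simp: B markings_def F_def)
  have idt: "F (idt B 1 x) = idt C 1 (g 1 x)" if "x \<in> cells B 1" for x
    using that \<Phi>(1) g1z by (auto simp: B markings_def F_def)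
  have cmp: "F (hcmp B (Suc 1) j u v) = hcmp C (Suc 1) j (F u) (F v)"
    if "composable B (Suc 1) j u v" for j u v
  proof -
    obtain m m' where uv: "u = code (m, {#})" "v = code (m', {#})" "set_mset m \<subseteq> S" "set_mset m' \<subseteq> S"
        "j = 0 \<or> j = 1"
      using \<open>composable B (Suc 1) j u v\<close> unfolding B composable_net
      by (fastforce simp: markings_def)
    then show ?thesis using \<Phi>(4)[of m m'] dm(2)[OF \<Phi>(2)[of m] \<Phi>(2)[of m']]
      by (auto simp: B F_def)
  qed
  have "lifts 1 B C g F" using cell idt cmp unfolding lifts_def by simp
  then show "\<exists>F. lifts 1 B C g F \<and> (\<forall>x\<in>net_gens S T 1. F x = g1 x)"
    using \<Phi>(3) by (intro exI[of _ F]) (auto simp: net_gens_def F_def \<gamma>_def)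
qed

text \<open>The functor must send \<open>(m, \<tau>)\<close> to the sum of the identity of \<open>m\<close> and the images of the transitions
  in \<open>\<tau>\<close>. Sums are preserved because the degenerate 3-cells form a commutative monoid. For the
  composite along a 2-cell, write the earlier marking as \<open>m + input \<tau>\<close>; interchange then
  splits off the identity of \<open>m\<close>, and what is left is \<open>(\<Phi> \<tau> + 0) \<circ> (input \<tau> + \<Phi> \<tau>') = \<Phi> \<tau> + \<Phi> \<tau>'\<close>.\<close>

lemma net_free_transitions:
  assumes wf: "\<And>t. t \<in> T \<Longrightarrow> set_mset (inn t) \<subseteq> S" and B: "B = (net (enat (Suc 2)) S T inn :: 'u ncat)"
    and tB: "trunc 2 B \<in> Obj (nComp \<kappa> 2)"
  shows "is_free_on \<kappa> 2 (nComp \<kappa> 2) B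
    (trunc 2 B, net_gens S T 2, restrict (\<lambda>x. (dm B 2 x, cd B 2 x)) (net_gens S T 2))
    (nid (trunc 2 B), restrict (\<lambda>x. x) (net_gens S T 2))"
proof (rule is_free_onI[OF _ _ tB])
  show "is_ncat (enat (Suc 2)) B" unfolding B using net_ncat wf .
  show "|cells B k| <o \<kappa>" for k unfolding B by (rule net_small)
  show "net_gens S T 2 \<subseteq> cells B (Suc 2)" by (auto simp: B net_gens_def markings_iff)
next
  fix Q y
  assume Q: "\<And>x. x \<in> net_gens S T 2 \<Longrightarrow> Q x" "\<And>x. x \<in> cells B 2 \<Longrightarrow> Q (idt B 2 x)"
    "\<And>j u v. composable B (Suc 2) j u v \<Longrightarrow> Q u \<Longrightarrow> Q v \<Longrightarrow> Q (hcmp B (Suc 2) j u v)"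
  assume "y \<in> cells B (Suc 2)"
  then obtain m \<tau> where y: "y = code (m, \<tau>)" and m: "set_mset m \<subseteq> S" "set_mset \<tau> \<subseteq> T"
    by (auto simp: B markings_def)
  show "Q y" unfolding y using m(2)
  proof (induction \<tau>)
    case empty
    then show ?case using Q(2)[of "code (m, {#})"] m(1) by (simp add: B markings_iff)
  next
    case (add t \<tau>)
    then show ?case
      using Q(3)[of 0 "code ({#}, {#t#})" "code (m, \<tau>)"] Q(1)[of "code ({#}, {#t#})"] m(1)
      by (auto simp: B net_gens_def composable_net markings_iff)
  qed
next
  fix C g g1
  assume nC: "is_ncat (enat (Suc 2)) C" and g: "g \<in> nfunctors (enat 2) (trunc 2 B) (trunc 2 C)"
    and g1: "\<And>x. x \<in> net_gens S T 2 \<Longrightarrow> g1 x \<in> cells C (Suc 2) \<and>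
      dm C 2 (g1 x) = g 2 (dm B 2 x) \<and> cd C 2 (g1 x) = g 2 (cd B 2 x)"
  interpret C: hcat "enat (Suc 2)" C by unfold_locales fact
  note G = nfunctorsD[OF g]
  let ?z = "code ({#}, {#}) :: 'u"
  define o' where "o' = g 0 ?z"
  define p where "p m = g 2 (code (m, {#}))" for m
  have o': "o' \<in> cells C 0" using G(2)[of ?z 0] by (simp add: o'_def B markings_iff)
  have g1z: "g 1 ?z = idt C 0 o'" using G(5)[of 0 ?z] by (simp add: o'_def B markings_iff)
  have p0: "p {#} = idt C 1 (idt C 0 o')"
    using G(5)[of 1 ?z] g1z by (simp add: p_def B markings_iff numeral_2_eq_2)
  have pc: "p m \<in> cells C 2" "dm C 1 (p m) = idt C 0 o'" "cd C 1 (p m) = idt C 0 o'" if "set_mset m \<subseteq> S" for m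
    using G(2)[of "code (m, {#})" 2] G(3,4)[of "code (m, {#})" 1] that g1z
    by (simp_all add: p_def B markings_iff numeral_2_eq_2)
  have padd: "p (m + m') = hcmp C 2 0 (p m) (p m')" "composable C 2 0 (p m) (p m')"
    if "set_mset m \<subseteq> S" "set_mset m' \<subseteq> S" for m m'
  proof -
    have c: "composable (trunc 2 B) 2 0 (code (m, {#})) (code (m', {#}))"
      using that by (simp add: B composable_net markings_iff)
    show "p (m + m') = hcmp C 2 0 (p m) (p m')" using G(6)[OF c] by (simp add: p_def B)
    have "is_ncat (enat (Suc 2)) B" unfolding B using net_ncat wf .
    then have "is_ncat (enat 2) (trunc 2 B)" by (rule trunc_ncat) simp
    from nfunctors_composable[OF g this c] show "composable C 2 0 (p m) (p m')" by (simp add: p_def)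
  qed
  let ?D = "C.degenerate 2 o'" and ?e = "iidt C 0 3 o'"
  have dg: "x \<in> ?D \<longleftrightarrow> x \<in> cells C 3 \<and> dm C 1 (dm C 2 x) = idt C 0 o' \<and> cd C 1 (cd C 2 x) = idt C 0 o'" for x
    by (simp add: C.degenerate_def numeral_2_eq_2 numeral_3_eq_3)
  have e: "?e = idt C 2 (p {#})" by (simp add: p0 numeral_2_eq_2 numeral_3_eq_3)
  note dm = C.degenerate_monoid[OF o' zero_less_numeral order_refl, simplified]
  interpret M: commutative_monoid_on ?D "hcmp C 3 0" ?e
    by (rule dm(1))
  define I where "I m = idt C 2 (p m)" for m
  have I: "I m \<in> ?D" "dm C 2 (I m) = p m" "cd C 2 (I m) = p m" if "set_mset m \<subseteq> S" for m
    using C.idt_cell[of 2 "p m"] C.dm_idt[of 2 "p m"] C.cd_idt[of 2 "p m"] pc[OF that]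
    by (simp_all add: dg I_def)
  have Iadd: "I (m + m') = hcmp C 3 0 (I m) (I m')"
    if "set_mset m \<subseteq> S" "set_mset m' \<subseteq> S" for m m'
    using padd[OF that] C.idt_hcmp[of 2 0 "p m" "p m'"] by (simp add: I_def)
  define \<gamma> where "\<gamma> t = g1 (code ({#}, {#t#}))" for t
  have \<gamma>: "\<gamma> t \<in> ?D" "dm C 2 (\<gamma> t) = p (inn t)" "cd C 2 (\<gamma> t) = p {#}" if "t \<in> T" for t
    using g1[of "code ({#}, {#t#})"] that pc wf[OF that] pc[of "{#}"]
    by (auto simp: dg \<gamma>_def net_gens_def B p_def)
  obtain \<Phi> where \<Phi>': "\<Phi> {#} = ?e \<and> (\<forall>t\<in>T. \<Phi> {#t#} = \<gamma> t) \<and>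
      (\<forall>\<tau>. set_mset \<tau> \<subseteq> T \<longrightarrow> \<Phi> \<tau> \<in> ?D) \<and>
      (\<forall>\<sigma> \<tau>. set_mset \<sigma> \<subseteq> T \<longrightarrow> set_mset \<tau> \<subseteq> T \<longrightarrow> \<Phi> (\<sigma> + \<tau>) = hcmp C 3 0 (\<Phi> \<sigma>) (\<Phi> \<tau>))"
    using M.multiset_extension[of T \<gamma>, OF \<gamma>(1)] ..
  have \<Phi>: "\<Phi> {#} = ?e" "\<And>\<tau>. set_mset \<tau> \<subseteq> T \<Longrightarrow> \<Phi> \<tau> \<in> ?D" "\<And>t. t \<in> T \<Longrightarrow> \<Phi> {#t#} = \<gamma> t"
    "\<And>\<sigma> \<tau>. \<lbrakk>set_mset \<sigma> \<subseteq> T; set_mset \<tau> \<subseteq> T\<rbrakk> \<Longrightarrow> \<Phi> (\<sigma> + \<tau>) = hcmp C 3 0 (\<Phi> \<sigma>) (\<Phi> \<tau>)"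
    using \<Phi>' by simp_all
  have cons: "\<Phi> (add_mset t \<tau>) = hcmp C 3 0 (\<gamma> t) (\<Phi> \<tau>)" if "t \<in> T" "set_mset \<tau> \<subseteq> T" for t \<tau>
    using \<Phi>(4)[of "{#t#}" \<tau>] that by (simp add: \<Phi>(3))
  have in_sub: "set_mset (net_input inn \<tau>) \<subseteq> S" if "set_mset \<tau> \<subseteq> T" for \<tau>
    by (rule net_input_subset[OF wf that])
  have bd: "dm C 2 (hcmp C 3 0 x y) = hcmp C 2 0 (dm C 2 x) (dm C 2 y)"
    "cd C 2 (hcmp C 3 0 x y) = hcmp C 2 0 (cd C 2 x) (cd C 2 y)"
    if "x \<in> ?D" "y \<in> ?D" for x y
    using C.dm_hcmp[of 2 0 x y] C.cd_hcmp[of 2 0 x y] dm(3)[OF that] by simp_all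
  have \<Phi>b: "dm C 2 (\<Phi> \<tau>) = p (net_input inn \<tau>) \<and> cd C 2 (\<Phi> \<tau>) = p {#}" if "set_mset \<tau> \<subseteq> T" for \<tau>
    using that
  proof (induction \<tau>)
    case empty
    then show ?case using I(2,3)[of "{#}"] by (simp add: \<Phi>(1) e I_def)
  next
    case (add t \<tau>)
    then show ?case
      using padd(1)[of "inn t" "net_input inn \<tau>"] padd(1)[of "{#}" "{#}"] wf[of t] in_sub[of \<tau>]
      using add.prems
      by (simp add: \<Phi>(2) cons \<gamma> bd)
  qed
  \<comment> \<open>\<open>I m\<close> is the image of the identity of \<open>m\<close>.\<close>
  define F where "F u = hcmp C 3 0 (I (fst (inv code u))) (\<Phi> (snd (inv code u)))" for u :: 'u
  have Fc: "F (code (m, \<tau>)) = hcmp C 3 0 (I m) (\<Phi> \<tau>)" for m \<tau> by (simp add: F_def)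
  have FD: "F (code (m, \<tau>)) \<in> ?D" if "set_mset m \<subseteq> S" "set_mset \<tau> \<subseteq> T" for m \<tau>
    using I(1) \<Phi>(2) that by (simp add: Fc)
  have Fb: "dm C 2 (F (code (m, \<tau>))) = p (m + net_input inn \<tau>)" "cd C 2 (F (code (m, \<tau>))) = p m"
    if "set_mset m \<subseteq> S" "set_mset \<tau> \<subseteq> T" for m \<tau>
    using I[OF that(1)] \<Phi>(2)[OF that(2)] \<Phi>b[OF that(2)] padd(1)[OF that(1) in_sub[OF that(2)]]
      padd(1)[OF that(1), of "{#}"]
    by (simp_all add: Fc bd)
  have cell: "F y \<in> cells C 3 \<and> dm C 2 (F y) = g 2 (dm B 2 y) \<and> cd C 2 (F y) = g 2 (cd B 2 y)"
    if "y \<in> cells B 3" for y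
    using that FD[unfolded dg] Fb by (auto simp: B markings_def p_def)
  have idt: "F (idt B 2 x) = idt C 2 (g 2 x)" if "x \<in> cells B 2" for x
  proof -
    obtain m where "x = code (m, {#})" "set_mset m \<subseteq> S" using \<open>x \<in> cells B 2\<close> by (auto simp: B markings_def)
    then show ?thesis using I(1)[of m] M.comm[of "I m" ?e] by (simp add: B Fc \<Phi>(1) I_def p_def)
  qed
  have c2: "composable C 3 2 x y \<longleftrightarrow> dm C 2 x = cd C 2 y" if "x \<in> ?D" "y \<in> ?D" for x y
    using that C.composable_top[of 2] by (simp add: dg)
  have idl: "hcmp C 3 2 (idt C 2 (cd C 2 x)) x = x" "hcmp C 3 2 x (idt C 2 (dm C 2 x)) = x"
    if "x \<in> ?D" for x
    using C.unit_left[of 2 "3" x] C.unit_right[of 2 "3" x] that by (simp_all add: dg)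
  have ic: "hcmp C 3 2 (hcmp C 3 0 x z) (hcmp C 3 0 y w) =
      hcmp C 3 0 (hcmp C 3 2 x y) (hcmp C 3 2 z w)"
    if "x \<in> ?D" "y \<in> ?D" "z \<in> ?D" "w \<in> ?D" "dm C 2 x = cd C 2 y" "dm C 2 z = cd C 2 w" for x y z w
    by (rule C.interchange[symmetric]) (use that c2 dm(3) in auto)
  have cmp: "F (hcmp B 3 j u v) = hcmp C 3 j (F u) (F v)"
    if "composable B 3 j u v" for j u v
  proof -
    obtain m \<tau> m' \<tau>' where uv: "u = code (m, \<tau>)" "v = code (m', \<tau>')" "set_mset m \<subseteq> S" "set_mset m' \<subseteq> S"
        "set_mset \<tau> \<subseteq> T" "set_mset \<tau>' \<subseteq> T" and j: "j \<le> 1 \<or> j = 2 \<and> m' = m + net_input inn \<tau>"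
      using \<open>composable B 3 j u v\<close> unfolding B composable_net by (fastforce simp: markings_def)
    from j show ?thesis
    proof
      assume "j \<le> 1"
      have 0: "hcmp C 3 0 (F u) (F v) = F (code (m + m', \<tau> + \<tau>'))"
        using uv I(1) \<Phi>(2) by (simp add: Fc Iadd \<Phi>(4) M.medial)
      have "j = 0 \<or> j = 1" using \<open>j \<le> 1\<close> by auto
      then have "hcmp C 3 j (F u) (F v) = hcmp C 3 0 (F u) (F v)"
        using dm(2)[of "F u" "F v"] FD uv by auto
      then show ?thesis using 0 \<open>j \<le> 1\<close> uv by (simp add: B)
    next
      assume j: "j = 2 \<and> m' = m + net_input inn \<tau>"
      let ?i = "I (net_input inn \<tau>)"
      have i: "?i \<in> ?D" using I(1) in_sub uv by blast
      have m: "I m \<in> ?D" "\<Phi> \<tau> \<in> ?D" "\<Phi> \<tau>' \<in> ?D" using I(1) \<Phi>(2) uv by auto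
      have b: "dm C 2 (\<Phi> \<tau>) = p (net_input inn \<tau>)" "cd C 2 (\<Phi> \<tau>') = p {#}" using \<Phi>b uv by auto
      have e': "?e = I {#}" by (simp add: e I_def)
      have "hcmp C 3 2 (\<Phi> \<tau>) (hcmp C 3 0 ?i (\<Phi> \<tau>')) =
          hcmp C 3 2 (hcmp C 3 0 (\<Phi> \<tau>) ?e) (hcmp C 3 0 ?i (\<Phi> \<tau>'))"
        using m M.comm[of "\<Phi> \<tau>" ?e] by simp
      also have "\<dots> = hcmp C 3 0 (hcmp C 3 2 (\<Phi> \<tau>) ?i) (hcmp C 3 2 ?e (\<Phi> \<tau>'))"
        by (rule ic) (use m i b I in_sub uv in \<open>auto simp: e'\<close>)
      also have "\<dots> = hcmp C 3 0 (\<Phi> \<tau>) (\<Phi> \<tau>')"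
        using idl(2)[OF m(2)] idl(1)[OF m(3)] b by (simp add: I_def e)
      finally have 1: "hcmp C 3 2 (\<Phi> \<tau>) (hcmp C 3 0 ?i (\<Phi> \<tau>')) = hcmp C 3 0 (\<Phi> \<tau>) (\<Phi> \<tau>')" .
      have "hcmp C 3 2 (F u) (F v) =
          hcmp C 3 2 (hcmp C 3 0 (I m) (\<Phi> \<tau>)) (hcmp C 3 0 (I m) (hcmp C 3 0 ?i (\<Phi> \<tau>')))"
        using uv j m i in_sub by (simp add: Fc Iadd M.assoc)
      also have "\<dots> = hcmp C 3 0 (hcmp C 3 2 (I m) (I m))
          (hcmp C 3 2 (\<Phi> \<tau>) (hcmp C 3 0 ?i (\<Phi> \<tau>')))"
      proof (rule ic)
        show "dm C 2 (\<Phi> \<tau>) = cd C 2 (hcmp C 3 0 ?i (\<Phi> \<tau>'))"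
          using b i m in_sub uv I(3) padd(1)[of "net_input inn \<tau>" "{#}"] by (simp add: bd)
      qed (use m i I uv in auto)
      also have "hcmp C 3 2 (I m) (I m) = I m"
        using idl(1)[OF m(1)] I(3)[OF uv(3)] by (simp add: I_def)
      finally show ?thesis using j uv 1 by (simp add: B Fc \<Phi>(4))
    qed
  qed
  have "lifts 2 B C g F" using cell idt cmp unfolding lifts_def by simp
  then show "\<exists>F. lifts 2 B C g F \<and> (\<forall>x\<in>net_gens S T 2. F x = g1 x)"
  proof (intro exI[of _ F] conjI ballI)
    fix x assume "x \<in> net_gens S T 2"
    then obtain t where "t \<in> T" "x = code ({#}, {#t#})" by (auto simp: net_gens_def)
    then show "F x = g1 x" using \<Phi>(3) \<gamma>(1)[of t] e by (simp add: Fc I_def[of "{#}"] e[symmetric] \<gamma>_def)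
  qed
qed

lemma net_free:
  assumes wf: "\<And>t. t \<in> T \<Longrightarrow> set_mset (inn t) \<subseteq> S" and B: "B = (net (enat (Suc n)) S T inn :: 'u ncat)"
    and tB: "trunc n B \<in> Obj (nComp \<kappa> n)"
  shows "is_free_on \<kappa> n (nComp \<kappa> n) B
    (trunc n B, net_gens S T n, restrict (\<lambda>x. (dm B n x, cd B n x)) (net_gens S T n))
    (nid (trunc n B), restrict (\<lambda>x. x) (net_gens S T n))"
proof -
  consider "n = 1" | "n = 2" | "n = 0 \<or> 3 \<le> n" by linarith
  then show ?thesis
  proof cases
    case 1 then show ?thesis using net_free_places[of T inn S B] wf B tB by blast
  next
    case 2 then show ?thesis using net_free_transitions[of T inn S B] wf B tB by blast
  next
    case 3
    have "is_ncat (enat (Suc n)) B" unfolding B using net_ncat wf .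
    moreover have "|cells B k| <o \<kappa>" for k unfolding B by (rule net_small)
    moreover have "\<exists>x\<in>cells B n. y = idt B n x" if "y \<in> cells B (Suc n)" for y
      using that 3 by (auto simp: B markings_def)
    moreover have "net_gens S T n = {}" using 3 by (auto simp: net_gens_def)
    ultimately show ?thesis using free_on_nothing[OF _ _ tB] by simp
  qed
qed

lemma net_in_nComp:
  assumes wf: "\<And>t. t \<in> T \<Longrightarrow> set_mset (inn t) \<subseteq> S"
  shows "(net (enat n) S T inn :: 'u ncat) \<in> Obj (nComp \<kappa> n)"
proof (induction n)
  case 0
  then show ?case using net_ncat[of T inn S "enat 0"] wf net_small[of "enat 0"] by (simp add: zero_enat_def)
next
  case (Suc n)
  then have "trunc n (net (enat (Suc n)) S T inn :: 'u ncat) \<in> Obj (nComp \<kappa> n)"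
    by (simp add: trunc_net)
  from net_free[OF wf refl this] show ?case by (simp del: split_paired_Ex) blast
qed

lemma net_computad:
  assumes wf: "\<And>t. t \<in> T \<Longrightarrow> set_mset (inn t) \<subseteq> S"
  shows "computad \<kappa> N (net N S T inn :: 'u ncat)"
  unfolding computad_def
proof (intro conjI allI impI)
  fix k assume "enat (Suc k) \<le> N"
  then show "\<exists>P \<eta>. is_free_on \<kappa> k (nComp \<kappa> k) (trunc (Suc k) (net N S T inn :: 'u ncat)) P \<eta>"
    using net_in_nComp[of T inn S "Suc k", OF wf] by (simp add: trunc_net)
qed (use net_ncat[OF wf] net_small in auto)

lemma gens_net:
  assumes wf: "\<And>t. t \<in> T \<Longrightarrow> set_mset (inn t) \<subseteq> S" and k: "enat (Suc k) \<le> N"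
  shows "gens \<kappa> k (net N S T inn :: 'u ncat) = net_gens S T k"
proof -
  define B where "B = (net (enat (Suc k)) S T inn :: 'u ncat)"
  have "trunc k B \<in> Obj (nComp \<kappa> k)"
    using net_in_nComp[of T inn S k, OF wf] by (simp add: B_def trunc_net)
  note fr = net_free[OF wf B_def this]
  have im: "restrict (\<lambda>x. x) (net_gens S T k) ` net_gens S T k = net_gens S T k" by auto
  have "indets \<kappa> k (nComp \<kappa> k) B = restrict (\<lambda>x. x) (net_gens S T k) ` net_gens S T k"
  proof (rule indets_eqI[OF fr], unfold im)
    fix g x assume "g \<in> net_gens S T k" "x \<in> cells B k"
    then show "idt B k x \<noteq> g"
      by (auto simp: net_gens_def B_def markings_def split: if_splits)
  next
    fix g j u v assume g: "g \<in> net_gens S T k" and c: "composable B (Suc k) j u v"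
      and h: "hcmp B (Suc k) j u v = g"
    obtain m \<tau> m' \<tau>' where uv: "u = code (m, \<tau>)" "v = code (m', \<tau>')"
        "(m, \<tau>) \<in> markings S T (Suc k)" "(m', \<tau>') \<in> markings S T (Suc k)"
        "j = 2 \<longrightarrow> m + net_input inn \<tau> = m'" "3 \<le> j \<longrightarrow> u = v" "j < Suc k"
      using c unfolding B_def composable_net by auto
    consider "j \<le> 1" | "j = 2" | "3 \<le> j" by linarith
    then show "u = g \<or> v = g"
    proof cases
      case 1
      then have "g = code (m + m', \<tau> + \<tau>')" using h uv by (simp add: B_def)
      then show ?thesis using g uv(1-4)
        by (auto simp: net_gens_def union_is_single markings_iff split: if_splits)
    next
      case 2
      then have "g = code (m, \<tau> + \<tau>')" "k \<ge> 2" using h uv by (simp_all add: B_def)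
      then show ?thesis using g uv(1-5) 2
        by (auto simp: net_gens_def union_is_single markings_iff split: if_splits)
    next
      case 3
      then show ?thesis using h uv by (simp add: B_def)
    qed
  qed
  then show ?thesis unfolding im gens_def using k by (simp add: trunc_net B_def)
qed

definition net_map :: "enat \<Rightarrow> nat set \<Rightarrow> nat set \<Rightarrow> (nat \<Rightarrow> nat) \<Rightarrow> (nat \<Rightarrow> nat) \<Rightarrow> 'u nmap" where
  "net_map N S T \<alpha> \<beta> = (\<lambda>k. restrict (\<lambda>u. code (image_mset \<alpha> (fst (inv code u)), image_mset \<beta> (snd (inv code u))))
    (cells (net N S T (\<lambda>_. {#})) k))"

lemma net_map_code:
  "\<lbrakk>enat k \<le> N; (m, \<tau>) \<in> markings S T k\<rbrakk> \<Longrightarrow>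
    net_map N S T \<alpha> \<beta> k (code (m, \<tau>)) = code (image_mset \<alpha> m, image_mset \<beta> \<tau>)"
  by (simp add: net_map_def)

lemma net_map_computad_map:
  assumes wf: "\<And>t. t \<in> T \<Longrightarrow> set_mset (inn t) \<subseteq> S" "\<And>t. t \<in> T' \<Longrightarrow> set_mset (inn' t) \<subseteq> S'"
    and \<alpha>: "\<alpha> ` S \<subseteq> S'" and \<beta>: "\<beta> ` T \<subseteq> T'"
    and inn: "\<And>t. t \<in> T \<Longrightarrow> inn' (\<beta> t) = image_mset \<alpha> (inn t)"
  shows "net_map N S T \<alpha> \<beta> \<in> computad_maps \<kappa> N (net N S T inn) (net N S' T' inn')"
proof -
  let ?A = "net N S T inn :: 'u ncat" and ?B = "net N S' T' inn' :: 'u ncat" and ?f = "net_map N S T \<alpha> \<beta> :: 'u nmap"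
  have ni: "net_input inn' (image_mset \<beta> \<tau>) = image_mset \<alpha> (net_input inn \<tau>)" if "set_mset \<tau> \<subseteq> T" for \<tau>
    using that by (induction \<tau>) (auto simp: inn)
  have mk: "(image_mset \<alpha> m, image_mset \<beta> \<tau>) \<in> markings S' T' k" if "(m, \<tau>) \<in> markings S T k" for m \<tau> k
    using that \<alpha> \<beta> by (auto simp: markings_iff image_subset_iff subset_iff split: if_splits)
  interpret A: hcat N ?A by unfold_locales (rule net_ncat[OF wf(1)])
  have "?f \<in> nfunctors N ?A ?B"
  proof (rule nfunctorsI)
    fix k show "?f k \<in> cells ?A k \<rightarrow>\<^sub>E cells ?B k"
      using mk by (auto simp: net_map_def)
  next
    fix k x assume x: "x \<in> cells ?A (Suc k)"
    then obtain m \<tau> where m: "x = code (m, \<tau>)" "(m, \<tau>) \<in> markings S T (Suc k)" "enat (Suc k) \<le> N"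
      by (auto split: if_splits)
    have c: "dm ?A k x \<in> cells ?A k" "cd ?A k x \<in> cells ?A k" using A.dm_cell[OF x] A.cd_cell[OF x] by auto
    consider "k \<le> 1" | "k = 2" | "3 \<le> k" by linarith
    then show "?f k (dm ?A k x) = dm ?B k (?f (Suc k) x)" "?f k (cd ?A k x) = cd ?B k (?f (Suc k) x)"
      by (cases; use m c ni in \<open>auto simp: net_map_def markings_iff split: if_splits\<close>)+
  next
    fix k x assume "enat (Suc k) \<le> N" "x \<in> cells ?A k"
    then show "?f (Suc k) (idt ?A k x) = idt ?B k (?f k x)"
      using A.idt_cell[of k x] by (auto simp: net_map_def split: if_splits)
  next
    fix k j u v assume c: "composable ?A k j u v"
    then obtain m \<tau> m' \<tau>' where uv: "u = code (m, \<tau>)" "v = code (m', \<tau>')"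
        "(m, \<tau>) \<in> markings S T k" "(m', \<tau>') \<in> markings S T k" "enat k \<le> N"
      unfolding composable_net by auto
    have h: "hcmp ?A k j u v \<in> cells ?A k" using A.hcmp_cell[OF c] .
    consider "j \<le> 1" | "j = 2" | "3 \<le> j" by linarith
    then show "?f k (hcmp ?A k j u v) = hcmp ?B k j (?f k u) (?f k v)"
      by cases (use uv h in \<open>auto simp: net_map_def\<close>)
  qed
  moreover have "?f (Suc k) ` net_gens S T k \<subseteq> net_gens S' T' k" if "enat (Suc k) \<le> N" for k
    using that \<alpha> \<beta> by (auto simp: net_gens_def net_map_code markings_iff split: if_splits)
  ultimately show ?thesis
    by (simp add: computad_maps_def gens_net[OF wf(1)] gens_net[OF wf(2)])
qed

end


section \<open>Functors out of computads with few generators\<close>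

definition idle_above :: "nat \<Rightarrow> 'u ncat \<Rightarrow> bool" where
  "idle_above n A \<longleftrightarrow> (\<forall>k\<ge>n. \<forall>y\<in>cells A (Suc k). \<exists>x\<in>cells A k. y = idt A k x)"

lemma enat_Suc_le: "enat (Suc k) \<le> N \<Longrightarrow> enat k \<le> N"
  by (meson enat_ord_simps(1) le_SucI order_refl order_trans)

lemma idle_functors_eq:
  assumes A: "is_ncat N A" and idle: "idle_above n A"
    and f: "f \<in> nfunctors N A B" and g: "g \<in> nfunctors N A B"
    and eq: "\<And>k x. \<lbrakk>k \<le> n; x \<in> cells A k\<rbrakk> \<Longrightarrow> f k x = g k x"
  shows "f = g"
proof (rule nfunctors_ext[OF f g])
  interpret hcat N A by unfold_locales fact
  fix k x assume "x \<in> cells A k"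
  then show "f k x = g k x"
  proof (induction k arbitrary: x)
    case (Suc k)
    show ?case
    proof (cases "Suc k \<le> n")
      case False
      then obtain y where y: "y \<in> cells A k" "x = idt A k y"
        using idle Suc.prems unfolding idle_above_def by (metis not_less_eq_eq)
      then show ?thesis
        using Suc.IH[OF y(1)] cell_le[OF Suc.prems] nfunctorsD(5)[OF f] nfunctorsD(5)[OF g] by simp
    qed (use eq Suc.prems in blast)
  qed (use eq in simp)
qed

lemma functor_from_truncs:
  assumes A: "is_ncat N A" and e: "\<And>k. f k \<in> extensional (cells A k)"
    and t: "\<And>n. enat n \<le> N \<Longrightarrow> trunc_map n f \<in> nfunctors (enat n) (trunc n A) (trunc n B)"
  shows "f \<in> nfunctors N A B"
proof (rule nfunctorsI)
  interpret hcat N A by unfold_locales fact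
  fix k show "f k \<in> cells A k \<rightarrow>\<^sub>E cells B k"
    using nfunctorsD(2)[OF t[of k], of _ k] e[of k] cell_le[of _ k] by (auto simp: PiE_iff)
next
  interpret hcat N A by unfold_locales fact
  fix k x assume x: "x \<in> cells A (Suc k)"
  note l = cell_le[OF x]
  show "f k (dm A k x) = dm B k (f (Suc k) x)" "f k (cd A k x) = cd B k (f (Suc k) x)"
    using nfunctorsD(3,4)[OF t[OF l], of x k] x by simp_all
next
  fix k x assume l: "enat (Suc k) \<le> N" and x: "x \<in> cells A k"
  show "f (Suc k) (idt A k x) = idt B k (f k x)"
    using nfunctorsD(5)[OF t[OF l], of k x] x by simp
next
  interpret hcat N A by unfold_locales fact
  fix k j x y assume c: "composable A k j x y"
  then have "enat k \<le> N" using cell_le by (auto simp: composable_def)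
  from nfunctorsD(6)[OF t[OF this], of k j x y] c
  show "f k (hcmp A k j x y) = hcmp B k j (f k x) (f k y)" by simp
qed

primrec idle_extend :: "'u ncat \<Rightarrow> 'u ncat \<Rightarrow> nat \<Rightarrow> 'u nmap \<Rightarrow> 'u nmap" where
  "idle_extend A B n g 0 = g 0"
| "idle_extend A B n g (Suc k) = (if Suc k \<le> n then g (Suc k)
    else restrict (\<lambda>y. idt B k (idle_extend A B n g k (dm A k y))) (cells A (Suc k)))"

lemma idle_extend_low: "k \<le> n \<Longrightarrow> idle_extend A B n g k = g k"
  by (cases k) auto

text \<open>The truncations of the extension are functors by induction on the dimension.\<close>

lemma (in small_universe) idle_extend_functor:
  assumes A: "is_ncat N A" and B: "is_ncat N B" and idle: "idle_above n A" and n: "enat n \<le> N"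
    and g: "g \<in> nfunctors (enat n) (trunc n A) (trunc n B)"
  shows "idle_extend A B n g \<in> nfunctors N A B"
proof (rule functor_from_truncs[OF A])
  let ?f = "idle_extend A B n g"
  note G = nfunctorsD[OF g]
  show "?f k \<in> extensional (cells A k)" for k
  proof (cases "k \<le> n")
    case True
    then show ?thesis using G(1)[of k] by (simp add: idle_extend_low PiE_iff)
  next
    case False
    then show ?thesis by (cases k) auto
  qed
  have gt: "trunc_map n ?f = g"
    using G(1) by (auto simp: trunc_map_def fun_eq_iff idle_extend_low PiE_iff extensional_def)
  have up: "trunc_map (n + l) ?f \<in> nfunctors (enat (n + l)) (trunc (n + l) A) (trunc (n + l) B)"
    if "enat (n + l) \<le> N" for l
    using that
  proof (induction l)
    case 0
    then show ?case using g gt by simp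
  next
    case (Suc l)
    let ?k = "n + l" and ?A = "trunc (Suc (n + l)) A" and ?B = "trunc (Suc (n + l)) B"
    have l: "enat (Suc ?k) \<le> N" using Suc.prems by simp
    have nA: "is_ncat (enat (Suc ?k)) ?A" and nB: "is_ncat (enat (Suc ?k)) ?B"
      using trunc_ncat[OF A l] trunc_ncat[OF B l] by auto
    let ?h = "trunc_map ?k ?f"
    have h: "?h \<in> nfunctors (enat ?k) (trunc ?k ?A) (trunc ?k ?B)"
      using Suc.IH[OF enat_Suc_le[OF l]] by simp
    have id: "\<exists>x\<in>cells ?A ?k. y = idt ?A ?k x" if "y \<in> cells ?A (Suc ?k)" for y
      using idle that by (auto simp: idle_above_def)
    have eq: "trunc_map (Suc ?k) ?f = ?h(Suc ?k := restrict (\<lambda>y. idt ?B ?k (?h ?k (dm ?A ?k y))) (cells ?A (Suc ?k)))"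
      by (auto simp: trunc_map_def fun_eq_iff le_Suc_eq)
    from lift_functor(1)[OF nA h idle_extension[OF nA nB h id]]
    show ?case unfolding eq[symmetric] by simp
  qed
  show "trunc_map k ?f \<in> nfunctors (enat k) (trunc k A) (trunc k B)" if "enat k \<le> N" for k
  proof (cases "n \<le> k")
    case True
    then show ?thesis using up[of "k - n"] that by simp
  next
    case False
    then have "trunc_map k ?f = trunc_map k g"
      by (auto simp: trunc_map_def fun_eq_iff idle_extend_low)
    then show ?thesis using trunc_map_functor[OF g, of k] False by simp
  qed
qed

context small_universe
begin

text \<open>Generation and weights in every dimension, for one and the same set of generators. Its
  members are indets, so maps of computads send them to indets.\<close>

lemma computad_presentation:
  assumes A: "computad \<kappa> N A" and k: "enat (Suc k) \<le> N"
  shows "\<exists>G\<subseteq>gens \<kappa> k A. generated_by k A G \<and> (\<forall>w. \<exists>\<phi>. weight k A \<phi> \<and> (\<forall>g\<in>G. \<phi> g = w g))"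
proof -
  obtain P \<eta> where fr0: "is_free_on \<kappa> k (nComp \<kappa> k) (trunc (Suc k) A) P \<eta>"
    using A k unfolding computad_def by blast
  obtain A0 X \<delta> f h where P: "P = (A0, X, \<delta>)" "\<eta> = (f, h)" by (metis prod.exhaust)
  note fr = fr0[unfolded P]
  show ?thesis
  proof (intro exI[of _ "h ` X"] conjI allI)
    show "h ` X \<subseteq> gens \<kappa> k A" unfolding gens_def subset_eq indets_iff using fr by blast
    show "generated_by k A (h ` X)" unfolding generated_by_def
    proof (intro allI impI ballI)
      fix Q y assume Q: "(\<forall>g\<in>h ` X. Q g) \<and> (\<forall>x\<in>cells A k. Q (idt A k x)) \<and>
        (\<forall>j u v. composable A (Suc k) j u v \<longrightarrow> Q u \<longrightarrow> Q v \<longrightarrow> Q (hcmp A (Suc k) j u v))"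
        and y: "y \<in> cells A (Suc k)"
      show "Q y" by (rule free_generated[OF fr, where Q = Q]) (use Q y in auto)
    qed
    show "\<exists>\<phi>. weight k A \<phi> \<and> (\<forall>g\<in>h ` X. \<phi> g = w g)" for w
      using free_weight[OF fr, of "\<lambda>x. w (h x)"] by (auto simp: weight_def)
  qed
qed

lemma computad_mapsD:
  assumes "f \<in> computad_maps \<kappa> N A B"
  shows "f \<in> nfunctors N A B"
    and "\<lbrakk>enat (Suc k) \<le> N; x \<in> gens \<kappa> k A\<rbrakk> \<Longrightarrow> f (Suc k) x \<in> gens \<kappa> k B"
  using assms unfolding computad_maps_def by blast+

lemma gens_cell: "x \<in> gens \<kappa> k A \<Longrightarrow> x \<in> cells A (Suc k)"
  unfolding gens_def using indets_cell by fastforce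

lemma computad_maps_compose:
  assumes f: "f \<in> computad_maps \<kappa> N A B" and g: "g \<in> computad_maps \<kappa> N B C" and A: "is_ncat N A"
  shows "ncompose A g f \<in> computad_maps \<kappa> N A C"
  using ncompose_functor[OF computad_mapsD(1)[OF f] computad_mapsD(1)[OF g] A]
    computad_mapsD(2)[OF f] computad_mapsD(2)[OF g]
  by (auto simp: computad_maps_def gens_cell)

lemma idle_if_no_gens:
  assumes A: "computad \<kappa> N A" and none: "\<And>k. \<lbrakk>n \<le> k; enat (Suc k) \<le> N\<rbrakk> \<Longrightarrow> gens \<kappa> k A = {}"
  shows "idle_above n A"
  unfolding idle_above_def
proof (intro allI impI ballI)
  have nA: "is_ncat N A" using A by (simp add: computad_def)
  interpret hcat N A by unfold_locales fact
  fix k y assume k: "n \<le> k" and y: "y \<in> cells A (Suc k)"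
  have l: "enat (Suc k) \<le> N" using cell_le[OF y] .
  obtain G where G: "G \<subseteq> gens \<kappa> k A" and gen: "generated_by k A G"
    using computad_presentation[OF A l] by blast
  show "\<exists>x\<in>cells A k. y = idt A k x"
  proof (rule generated_by_induct[OF gen y])
    show "\<exists>x\<in>cells A k. g = idt A k x" if "g \<in> G" for g using that G none[OF k l] by blast
    show "\<exists>x'\<in>cells A k. idt A k x = idt A k x'" if "x \<in> cells A k" for x using that by blast
    show "\<exists>x\<in>cells A k. hcmp A (Suc k) j u v = idt A k x"
      if c: "composable A (Suc k) j u v"
        and uv: "\<exists>x\<in>cells A k. u = idt A k x" "\<exists>x\<in>cells A k. v = idt A k x" for j u v
    proof -
      from uv obtain a b where ab: "a \<in> cells A k" "b \<in> cells A k" "u = idt A k a" "v = idt A k b" by blast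
      show "\<exists>x\<in>cells A k. hcmp A (Suc k) j u v = idt A k x"
      proof (cases "j < k")
        case True
        have "composable A k j a b" using composable_dm[OF c True] ab l by (simp add: dm_idt)
        then show ?thesis using idt_hcmp[OF l] hcmp_cell ab by metis
      next
        case False
        then have j: "j = k" using c by (auto simp: composable_def)
        have "a = b" using c ab l unfolding j composable_top by (simp add: dm_idt cd_idt)
        then show ?thesis using unit_right[of k "Suc k" u] ab idt_cell[OF l] l
          by (auto simp: j dm_idt Suc_diff_le)
      qed
    qed
  qed
qed


section \<open>Identifying the two places\<close>

text \<open>These are the nets \<open>D\<close>, \<open>P\<close>, \<open>Z\<close> and \<open>W\<close> of the introduction and the maps between them. All four
  encode markings by the same pairs, so \<open>netP\<close> and \<open>netW\<close> agree literally below dimension 3 and the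
  cells of \<open>netZ\<close> are cells of \<open>netP\<close>.\<close>

abbreviation netD :: "enat \<Rightarrow> 'u ncat" where "netD N \<equiv> net N {0} {} (\<lambda>_. {#0, 1#})"
abbreviation netP :: "enat \<Rightarrow> 'u ncat" where "netP N \<equiv> net N {0, 1} {0} (\<lambda>_. {#0, 1#})"
abbreviation netZ :: "enat \<Rightarrow> 'u ncat" where "netZ N \<equiv> net N {0} {0} (\<lambda>_. {#0, 0#})"
abbreviation netW :: "enat \<Rightarrow> 'u ncat" where "netW N \<equiv> net N {0, 1} {0, 1} (\<lambda>_. {#0, 1#})"

abbreviation incl :: "enat \<Rightarrow> nat \<Rightarrow> 'u nmap" where "incl N s \<equiv> net_map N {0} {} (\<lambda>_. s) (\<lambda>t. t)"
abbreviation collapse :: "enat \<Rightarrow> 'u nmap" where "collapse N \<equiv> net_map N {0, 1} {0} (\<lambda>_. 0) (\<lambda>t. t)"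
abbreviation forget :: "enat \<Rightarrow> 'u nmap" where "forget N \<equiv> net_map N {0, 1} {0, 1} (\<lambda>_. 0) (\<lambda>_. 0)"
abbreviation swap :: "enat \<Rightarrow> 'u nmap" where "swap N \<equiv> net_map N {0, 1} {0} (\<lambda>s. 1 - s) (\<lambda>t. t)"

lemma net_computads:
  "computad \<kappa> N (netD N :: 'u ncat)" "computad \<kappa> N (netP N :: 'u ncat)"
  "computad \<kappa> N (netZ N :: 'u ncat)" "computad \<kappa> N (netW N :: 'u ncat)"
  by (rule net_computad; simp)+

lemma net_ncats:
  "is_ncat N (netD N :: 'u ncat)" "is_ncat N (netP N :: 'u ncat)"
  "is_ncat N (netZ N :: 'u ncat)" "is_ncat N (netW N :: 'u ncat)"
  by (rule net_ncat; simp)+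

lemma net_maps:
  "s \<le> 1 \<Longrightarrow> incl N s \<in> computad_maps \<kappa> N (netD N) (netP N)"
  "collapse N \<in> computad_maps \<kappa> N (netP N) (netZ N)"
  "forget N \<in> computad_maps \<kappa> N (netW N) (netZ N)"
  "swap N \<in> computad_maps \<kappa> N (netP N) (netP N)"
  by (rule net_map_computad_map; auto)+

lemma net_map_cells:
  assumes "x \<in> cells (net N S T inn :: 'u ncat) k" "net_map N S T \<alpha> \<beta> \<in> computad_maps \<kappa> N (net N S T inn) B"
  obtains m \<tau> where "x = code (m, \<tau>)" "(m, \<tau>) \<in> markings S T k" "enat k \<le> N"
    "net_map N S T \<alpha> \<beta> k x = (code (image_mset \<alpha> m, image_mset \<beta> \<tau>) :: 'u)"
  using assms net_map_code by (auto split: if_splits)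

lemma image_zero: "set_mset m \<subseteq> {0 :: nat} \<Longrightarrow> image_mset (\<lambda>_. 0) m = m"
  by (induction m) auto

lemma net_input_collapse:
  "image_mset (\<lambda>_. 0) (net_input (\<lambda>_. {#0, Suc 0#}) \<tau>) = net_input (\<lambda>_. {#0, 0#}) \<tau>"
  by (induction \<tau>) auto

text \<open>The assumption says that \<open>g\<close> agrees on the two places, hence \<open>g\<close> is invariant under moving tokens
  between them. The cells of \<open>netZ\<close> are the cells of \<open>netP\<close> with all tokens in place 0, and \<open>g'\<close> is the
  restriction of \<open>g\<close> to them. The inclusion is not a functor, as domains in \<open>netP\<close> involve place 1,
  but after applying \<open>g\<close> the difference disappears.\<close>

lemma collapse_coequalizes:
  assumes N: "3 \<le> N" and E: "is_ncat N E" and g: "g \<in> computad_maps \<kappa> N (netP N) E"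
    and eq: "ncompose (netD N) g (incl N 0) = ncompose (netD N) g (incl N 1)"
  shows "\<exists>g'\<in>computad_maps \<kappa> N (netZ N) E. ncompose (netP N) g' (collapse N) = g"
proof -
  let ?P = "netP N :: 'u ncat" and ?Z = "netZ N :: 'u ncat"
  interpret E: hcat N E by unfold_locales fact
  have gf: "g \<in> nfunctors N ?P E" using computad_mapsD(1)[OF g] .
  note G = nfunctorsD[OF gf]
  interpret Z: hcat N ?Z by unfold_locales (rule net_ncats)
  have mZ: "markings {0} {0} k \<subseteq> markings {0, 1} {0} k" for k by (auto simp: markings_def)
  have single: "g k (code ({#s#}, {#})) = g k (code ({#0#}, {#}))"
    if "s \<in> {0, 1}" "2 \<le> k" "enat k \<le> N" for s k
  proof -
    have c: "(code ({#0#}, {#}) :: 'u) \<in> cells (netD N) k" and m: "({#0#}, {#}) \<in> markings {0} {} k"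
      using that by (simp_all add: markings_iff)
    have "g k (code ({#0#}, {#})) = ncompose (netD N) g (incl N 0) k (code ({#0#}, {#}))"
      using c net_map_code[OF that(3) m] by simp
    also have "\<dots> = g k (code ({#1#}, {#}))"
      unfolding eq using c net_map_code[OF that(3) m] by simp
    finally show ?thesis using that(1) by auto
  qed
  have star: "g k (code (m, \<tau>)) = g k (code (image_mset (\<lambda>_. 0) m, \<tau>))"
    if "(m, \<tau>) \<in> markings {0, 1} {0} k" "enat k \<le> N" for m \<tau> k
    using that
  proof (induction m)
    case (add s m)
    then have k: "2 \<le> k" "s \<in> {0, 1}" "(m, \<tau>) \<in> markings {0, 1} {0} k"
      by (auto simp: markings_iff split: if_splits)
    have split: "g k (code (add_mset a l, \<tau>)) = hcmp E k 0 (g k (code ({#a#}, {#}))) (g k (code (l, \<tau>)))"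
      if "a \<in> {0, 1}" "(l, \<tau>) \<in> markings {0, 1} {0} k" for a l
    proof -
      have "composable ?P k 0 (code ({#a#}, {#})) (code (l, \<tau>))"
        using that k add.prems by (auto simp: composable_net markings_iff)
      from G(6)[OF this] show ?thesis by simp
    qed
    have z: "(image_mset (\<lambda>_. 0) m, \<tau>) \<in> markings {0, 1} {0} k"
      using k by (auto simp: markings_iff split: if_splits)
    show ?case using split[OF k(2,3)] split[OF _ z, of 0] add.IH[OF k(3) add.prems(2)]
        single[OF k(2,1) add.prems(2)] by simp
  qed simp
  define g' where "g' = (\<lambda>k. restrict (g k) (cells ?Z k))"
  have Zc: "x \<in> cells ?P k" if "x \<in> cells ?Z k" for x k
    using that mZ by (auto split: if_splits)
  have gf': "g' \<in> nfunctors N ?Z E"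
  proof (rule nfunctorsI)
    fix k
    have "\<forall>x\<in>cells ?Z k. g k x \<in> cells E k" using G(2)[OF Zc] by blast
    then show "g' k \<in> cells ?Z k \<rightarrow>\<^sub>E cells E k" unfolding g'_def restrict_PiE_iff .
  next
    fix k x assume x: "x \<in> cells ?Z (Suc k)"
    then obtain m \<tau> where m: "x = code (m, \<tau>)" "(m, \<tau>) \<in> markings {0} {0} (Suc k)" "enat (Suc k) \<le> N"
      by (auto split: if_splits)
    have c: "dm ?Z k x \<in> cells ?Z k" "cd ?Z k x \<in> cells ?Z k" using Z.dm_cell[OF x] Z.cd_cell[OF x] by auto
    have "g k (dm ?Z k x) = g k (dm ?P k x)"
    proof -
      consider "k \<le> 1" | "k = 2" | "3 \<le> k" by linarith
      then show ?thesis
      proof cases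
        case 2
        let ?p = "net_input (\<lambda>_. {#0, 1#}) \<tau>"
        have "set_mset ?p \<subseteq> {0, 1}" by (rule net_input_subset[where T = UNIV]) auto
        then have "(m + ?p, {#}) \<in> markings {0, 1} {0} k" using m 2 by (auto simp: markings_iff)
        from star[OF this enat_Suc_le[OF m(3)]] show ?thesis
          using m 2 by (simp add: net_input_collapse image_zero markings_iff)
      qed (use m in auto)
    qed
    then show "g' k (dm ?Z k x) = dm E k (g' (Suc k) x)"
      using c x G(3)[OF Zc[OF x]] by (simp add: g'_def del: net_simps)
    have "cd ?Z k x = cd ?P k x"
    proof -
      consider "k \<le> 1" | "k = 2" | "3 \<le> k" by linarith
      then show ?thesis by cases (use m in auto)
    qed
    then show "g' k (cd ?Z k x) = cd E k (g' (Suc k) x)"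
      using c x G(4)[OF Zc[OF x]] by (simp add: g'_def del: net_simps)
  next
    fix k x assume k: "enat (Suc k) \<le> N" and x: "x \<in> cells ?Z k"
    have "idt ?Z k x = idt ?P k x" using x by (auto split: if_splits)
    then show "g' (Suc k) (idt ?Z k x) = idt E k (g' k x)"
      using x Z.idt_cell[OF k x] G(5)[OF k Zc[OF x]] by (simp add: g'_def del: net_simps)
  next
    fix k j u v assume c: "composable ?Z k j u v"
    then obtain m \<tau> m' \<tau>' where uv: "u = code (m, \<tau>)" "v = code (m', \<tau>')"
        "(m, \<tau>) \<in> markings {0} {0} k" "(m', \<tau>') \<in> markings {0} {0} k" "enat k \<le> N" "j < k"
        "j = 2 \<longrightarrow> m + net_input (\<lambda>_. {#0, 0#}) \<tau> = m'" "3 \<le> j \<longrightarrow> u = v"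
      unfolding composable_net by auto
    have uvc: "u \<in> cells ?Z k" "v \<in> cells ?Z k" "hcmp ?Z k j u v \<in> cells ?Z k"
      using c Z.hcmp_cell by (auto simp: composable_def)
    have "g k (hcmp ?Z k j u v) = hcmp E k j (g k u) (g k v)"
    proof -
      consider "j \<le> 1" | "j = 2" | "3 \<le> j" by linarith
      then show ?thesis
      proof cases
        case 1
        then have "composable ?P k j u v" using uv mZ unfolding composable_net by fastforce
        from G(6)[OF this] show ?thesis using uv 1 by simp
      next
        case 3
        then have "composable ?P k j u v" using uv mZ unfolding composable_net by fastforce
        from G(6)[OF this] show ?thesis using uv 3 by simp
      next
        case 2
        \<comment> \<open>Replace \<open>v\<close> by a cell of \<open>netP\<close> with the same image that is composable with \<open>u\<close> in \<open>netP\<close>.\<close>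
        let ?p = "net_input (\<lambda>_. {#0, 1#}) \<tau>"
        have p: "set_mset ?p \<subseteq> {0, 1}" by (rule net_input_subset[where T = UNIV]) auto
        then have mk: "(m + ?p, \<tau>') \<in> markings {0, 1} {0} k"
          using uv 2 by (auto simp: markings_iff split: if_splits)
        have "image_mset (\<lambda>_. 0) (m + ?p) = m'"
          using uv(3,7) 2 by (auto simp: markings_iff net_input_collapse image_zero split: if_splits)
        then have v: "g k v = g k (code (m + ?p, \<tau>'))" using star[OF mk uv(5)] uv(2) by simp
        have "composable ?P k 2 u (code (m + ?p, \<tau>'))"
          using uv 2 mk mZ[of k] unfolding composable_net by auto
        from G(6)[OF this] show ?thesis using uv 2 v by simp
      qed
    qed
    then show "g' k (hcmp ?Z k j u v) = hcmp E k j (g' k u) (g' k v)"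
      using uvc by (simp add: g'_def del: net_simps)
  qed
  have "g' (Suc k) ` gens \<kappa> k ?Z \<subseteq> gens \<kappa> k E" if k: "enat (Suc k) \<le> N" for k
  proof -
    have "gens \<kappa> k ?Z \<subseteq> gens \<kappa> k ?P" using k by (auto simp: gens_net net_gens_def)
    moreover have "g' (Suc k) x = g (Suc k) x" if "x \<in> gens \<kappa> k ?Z" for x
      using gens_cell[OF that] unfolding g'_def by simp
    ultimately show ?thesis using computad_mapsD(2)[OF g k] by auto
  qed
  then have g'm: "g' \<in> computad_maps \<kappa> N ?Z E" using gf' by (simp add: computad_maps_def)
  have "ncompose ?P g' (collapse N) = g"
  proof (rule nfunctors_ext[OF ncompose_functor[OF computad_mapsD(1)[OF net_maps(2)] gf' net_ncats(2)] gf])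
    fix k x assume x: "x \<in> cells ?P k"
    from net_map_cells[OF x net_maps(2)] obtain m \<tau> where m: "x = code (m, \<tau>)"
      "(m, \<tau>) \<in> markings {0, 1} {0} k" "enat k \<le> N"
      "collapse N k x = (code (image_mset (\<lambda>_. 0) m, image_mset (\<lambda>t. t) \<tau>) :: 'u)" by blast
    have z: "(code (image_mset (\<lambda>_. 0) m, \<tau>) :: 'u) \<in> cells ?Z k"
      using m(2,3) by (auto simp: markings_iff split: if_splits)
    have "ncompose ?P g' (collapse N) k x = g' k (code (image_mset (\<lambda>_. 0) m, \<tau>))"
      using x m(4) by simp
    also have "\<dots> = g k (code (image_mset (\<lambda>_. 0) m, \<tau>))" using z by (simp add: g'_def)
    also have "\<dots> = g k x" using star[OF m(2,3)] m(1) by simp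
    finally show "ncompose ?P g' (collapse N) k x = g k x" .
  qed
  then show ?thesis using g'm by blast
qed


section \<open>Separating the two matchings\<close>

lemma markings_1: "x \<in> markings S T k \<Longrightarrow> k \<le> 1 \<Longrightarrow> x = ({#}, {#})"
  and markings_2: "x \<in> markings S T 2 \<Longrightarrow> snd x = {#}"
  by (auto simp: markings_def)

text \<open>A functor to a net assigns markings to cells; these are its compatibility conditions in terms of
  markings.\<close>

lemma map_to_net:
  fixes p :: "'u ncat"
  assumes \<rho>: "\<rho> \<in> computad_maps \<kappa> N p (net N S T inn)" and p: "is_ncat N p"
    and wf: "\<forall>t\<in>T. set_mset (inn t) \<subseteq> S"
  defines "a \<equiv> \<lambda>k y. inv code (\<rho> k y)"
  shows "y \<in> cells p k \<Longrightarrow> \<rho> k y = code (a k y)"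
    and "y \<in> cells p k \<Longrightarrow> a k y \<in> markings S T k"
    and "\<lbrakk>enat (Suc k) \<le> N; y \<in> cells p k\<rbrakk> \<Longrightarrow> a (Suc k) (idt p k y) = a k y"
    and "\<lbrakk>composable p k j u v; j \<le> 1\<rbrakk> \<Longrightarrow>
      a k (hcmp p k j u v) = (fst (a k u) + fst (a k v), snd (a k u) + snd (a k v))"
    and "composable p k 2 u v \<Longrightarrow> a k (hcmp p k 2 u v) = (fst (a k u), snd (a k u) + snd (a k v)) \<and>
      fst (a k u) + net_input inn (snd (a k u)) = fst (a k v)"
    and "y \<in> cells p 3 \<Longrightarrow> a 2 (dm p 2 y) = (fst (a 3 y) + net_input inn (snd (a 3 y)), {#})"
    and "y \<in> cells p 3 \<Longrightarrow> a 2 (cd p 2 y) = (fst (a 3 y), {#})"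
    and "\<lbrakk>y \<in> gens \<kappa> 1 p; 2 \<le> N\<rbrakk> \<Longrightarrow> \<exists>s\<in>S. a 2 y = ({#s#}, {#})"
    and "\<lbrakk>y \<in> gens \<kappa> 2 p; 3 \<le> N\<rbrakk> \<Longrightarrow> \<exists>t\<in>T. a 3 y = ({#}, {#t#})"
    and "\<lbrakk>enat (Suc k) \<le> N; net_gens S T k = ({} :: 'u set)\<rbrakk> \<Longrightarrow> gens \<kappa> k p = {}"
proof -
  interpret hcat N p by unfold_locales fact
  let ?B = "net N S T inn :: 'u ncat"
  note R = nfunctorsD[OF computad_mapsD(1)[OF \<rho>]]
  have 1: "\<rho> k y = code (a k y) \<and> a k y \<in> markings S T k" if "y \<in> cells p k" for k y
    using R(2)[OF that] by (auto simp: a_def split: if_splits)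
  have ai: "a k y = x" if "\<rho> k y = code x" for k y x using that by (simp add: a_def)
  show "y \<in> cells p k \<Longrightarrow> \<rho> k y = code (a k y)" "y \<in> cells p k \<Longrightarrow> a k y \<in> markings S T k"
    using 1 by blast+
  show "\<lbrakk>enat (Suc k) \<le> N; y \<in> cells p k\<rbrakk> \<Longrightarrow> a (Suc k) (idt p k y) = a k y"
    using R(5)[of k y] 1[of y k] by (intro ai) simp
  show "a k (hcmp p k j u v) = (fst (a k u) + fst (a k v), snd (a k u) + snd (a k v))"
    if c: "composable p k j u v" "j \<le> 1"
    using R(6)[OF c(1)] 1[of u k] 1[of v k] c by (intro ai) (simp add: composable_def)
  show "a k (hcmp p k 2 u v) = (fst (a k u), snd (a k u) + snd (a k v)) \<and>
      fst (a k u) + net_input inn (snd (a k u)) = fst (a k v)" if c: "composable p k 2 u v"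
  proof
    have uv: "u \<in> cells p k" "v \<in> cells p k" using c by (simp_all add: composable_def)
    show "a k (hcmp p k 2 u v) = (fst (a k u), snd (a k u) + snd (a k v))"
      using R(6)[OF c] 1[OF uv(1)] 1[OF uv(2)] by (intro ai) simp
    show "fst (a k u) + net_input inn (snd (a k u)) = fst (a k v)"
      using nfunctors_composable[OF computad_mapsD(1)[OF \<rho>] p c] 1[OF uv(1)] 1[OF uv(2)]
      unfolding composable_net by auto
  qed
  show "a 2 (dm p 2 y) = (fst (a 3 y) + net_input inn (snd (a 3 y)), {#})"
    "a 2 (cd p 2 y) = (fst (a 3 y), {#})" if "y \<in> cells p 3"
    using R(3,4)[of y 2] that 1[OF that] by (intro ai; simp)+
  have gB: "gens \<kappa> k ?B = net_gens S T k" if "enat (Suc k) \<le> N" for k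
    by (rule gens_net) (use wf that in auto)
  show "\<exists>s\<in>S. a 2 y = ({#s#}, {#})" if y: "y \<in> gens \<kappa> 1 p" and N: "2 \<le> N"
  proof -
    have l: "enat (Suc 1) \<le> N" using N by (simp add: numeral_eq_enat numeral_2_eq_2)
    have "\<rho> 2 y \<in> net_gens S T 1"
      using computad_mapsD(2)[OF \<rho> l y] gB[OF l] unfolding Suc_1 by simp
    then show ?thesis by (auto simp: net_gens_def a_def)
  qed
  show "\<exists>t\<in>T. a 3 y = ({#}, {#t#})" if y: "y \<in> gens \<kappa> 2 p" and N: "3 \<le> N"
  proof -
    have l: "enat (Suc 2) \<le> N" using N by (simp add: numeral_eq_enat)
    have "\<rho> 3 y \<in> net_gens S T 2"
      using computad_mapsD(2)[OF \<rho> l y] gB[OF l] by simp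
    then show ?thesis by (auto simp: net_gens_def a_def)
  qed
  show "gens \<kappa> k p = {}" if k: "enat (Suc k) \<le> N" and e: "net_gens S T k = ({} :: 'u set)"
    using computad_mapsD(2)[OF \<rho> k] gB[OF k] e by auto
qed

lemma net_input_const: "net_input (\<lambda>_. c) \<sigma> = net_input (\<lambda>_. c) \<tau>" if "size \<sigma> = size \<tau>"
proof -
  have "net_input (\<lambda>_. c) \<sigma> = repeat_mset (size \<sigma>) c" for \<sigma> by (induction \<sigma>) auto
  then show ?thesis using that by simp
qed

lemma add_eq_single: "M + M' = {#x#} \<longleftrightarrow> M = {#} \<and> M' = {#x#} \<or> M = {#x#} \<and> M' = {#}"
  by (auto simp: union_is_single)

lemma replicate_mset_add: "replicate_mset (m + n) x = replicate_mset m x + replicate_mset n x"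
  by (induction m) auto

text \<open>Here \<open>p\<close> is to be the product of \<open>netP\<close> with itself over \<open>netZ\<close>, with projections \<open>\<rho>\<close> and \<open>\<rho>'\<close>. The weight
  \<open>\<phi>\<close> on 2-cells counts the places over \<open>(0, 0)\<close>. On the domain of a generating 3-cell it is 1
  if the inputs are matched as \<open>(0,0) + (1,1)\<close>, and 0 if they are matched as \<open>(0,1) + (1,0)\<close>. The weights
  \<open>\<psi>\<close> and \<open>\<psi>'\<close> on 3-cells count generators of the former and of the latter kind, and \<open>f\<close> sends these
  to the two transitions of \<open>netW\<close>.\<close>

lemma separating_map:
  fixes p :: "'u ncat"
  assumes N: "3 \<le> N" and p: "computad \<kappa> N p"
    and \<rho>: "\<rho> \<in> computad_maps \<kappa> N p (netP N)" "\<rho>' \<in> computad_maps \<kappa> N p (netP N)"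
    and sq: "ncompose p (collapse N) \<rho> = ncompose p (collapse N) \<rho>'"
  shows "\<exists>f\<in>computad_maps \<kappa> N p (netW N).
    ncompose p (forget N) f = ncompose p (collapse N) \<rho>' \<and>
    (\<forall>k x. k \<le> 2 \<longrightarrow> x \<in> cells p k \<longrightarrow> f k x = \<rho>' k x) \<and>
    (\<forall>h\<in>computad_maps \<kappa> N (netP N) p. ncompose (netP N) \<rho> h = nid (netP N) \<longrightarrow>
      (ncompose (netP N) \<rho>' h = nid (netP N) \<longrightarrow> f 3 (h 3 (code ({#}, {#0#}))) = code ({#}, {#0#})) \<and>
      (ncompose (netP N) \<rho>' h = swap N \<longrightarrow> f 3 (h 3 (code ({#}, {#0#}))) = code ({#}, {#1#})))"
proof -
  have np: "is_ncat N p" using p by (simp add: computad_def)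
  interpret hcat N p by unfold_locales fact
  let ?P = "netP N :: 'u ncat" and ?W = "netW N :: 'u ncat"
  define inP where "inP = (\<lambda>_ :: nat. {#0 :: nat, 1#})"
  have N2: "2 \<le> N" "enat (Suc 1) \<le> N" "enat (Suc 2) \<le> N" "enat 3 \<le> N" "enat 2 \<le> N"
    using N by (auto simp: numeral_eq_enat intro: order_trans[of _ "enat 3"])
  define a where "a k y = inv code (\<rho> k y)" for k y
  define b where "b k y = inv code (\<rho>' k y)" for k y
  have wf: "\<forall>t\<in>{0}. set_mset (inP t) \<subseteq> {0, 1}" by (simp add: inP_def)
  note A = map_to_net[OF \<rho>(1)[folded inP_def] np wf, folded a_def]
  note B = map_to_net[OF \<rho>(2)[folded inP_def] np wf, folded b_def]
  have same: "size (fst (a k y)) = size (fst (b k y)) \<and> snd (a k y) = snd (b k y)" if y: "y \<in> cells p k" for k y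
  proof -
    have l: "enat k \<le> N" using cell_le[OF y] .
    have "collapse N k (\<rho> k y) = (collapse N k (\<rho>' k y) :: 'u)"
      using fun_cong[OF fun_cong[OF sq], of k y] y by simp
    then have "image_mset (\<lambda>_. 0 :: nat) (fst (a k y)) = image_mset (\<lambda>_. 0) (fst (b k y)) \<and> snd (a k y) = snd (b k y)"
      using A(1,2)[OF y] B(1,2)[OF y] net_map_code[OF l, of "fst (a k y)" "snd (a k y)"]
        net_map_code[OF l, of "fst (b k y)" "snd (b k y)"] by simp
    then show ?thesis by (metis size_image_mset)
  qed
  have "Suc 2 = 3" by simp
  note gen2 = generated_by_induct[where k = 1 and A = p, unfolded Suc_1]
    and gen3 = generated_by_induct[where k = 2 and A = p, unfolded \<open>Suc 2 = 3\<close>]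
  have w2: "\<phi> (idt p 1 x) = 0" if "weight 1 p \<phi>" "x \<in> cells p 1" for \<phi> x
    using that unfolding weight_def by blast
  have w2': "\<phi> (hcmp p 2 j u v) = \<phi> u + \<phi> v" if "weight 1 p \<phi>" "composable p 2 j u v" for \<phi> j u v
    using that unfolding weight_def Suc_1 by blast
  have w3: "\<phi> (idt p 2 x) = 0" if "weight 2 p \<phi>" "x \<in> cells p 2" for \<phi> x
    using that unfolding weight_def by blast
  have w3': "\<phi> (hcmp p 3 j u v) = \<phi> u + \<phi> v" if "weight 2 p \<phi>" "composable p 3 j u v" for \<phi> j u v
    using that unfolding weight_def \<open>Suc 2 = 3\<close> by blast
  let ?o = "({#0#}, {#}) :: marking" and ?t = "({#}, {#0#}) :: marking"
  obtain G1 where G1: "G1 \<subseteq> gens \<kappa> 1 p" "generated_by 1 p G1"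
    "\<forall>w. \<exists>\<phi>. weight 1 p \<phi> \<and> (\<forall>g\<in>G1. \<phi> g = w g)"
    using computad_presentation[OF p N2(2)] by blast
  from G1(3)[rule_format, of "\<lambda>g. if a 2 g = ?o \<and> b 2 g = ?o then 1 else 0"]
  obtain \<phi> where \<phi>: "weight 1 p \<phi>" "\<forall>g\<in>G1. \<phi> g = (if a 2 g = ?o \<and> b 2 g = ?o then 1 else 0)"
    by blast
  \<comment> \<open>The value of \<open>\<phi>\<close> on cells with a single token can be read off from the projections alone.\<close>
  define R where "R y \<longleftrightarrow> y \<in> cells p 2 \<and> (fst (a 2 y) = {#} \<longrightarrow> \<phi> y = 0) \<and>
      (size (fst (a 2 y)) = 1 \<longrightarrow> \<phi> y = (if a 2 y = ?o \<and> b 2 y = ?o then 1 else 0))" for y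
  have cl2: "R y" if "y \<in> cells p 2" for y
  proof (rule gen2[OF G1(2) that])
    fix g assume g: "g \<in> G1"
    then have "g \<in> cells p 2" using G1(1) gens_cell[of g 1 p] unfolding Suc_1 by blast
    moreover obtain s where "a 2 g = ({#s#}, {#})" using A(8)[OF _ N2(1)] G1(1) g by blast
    ultimately show "R g" using \<phi>(2) g by (simp add: R_def)
  next
    fix x assume x: "x \<in> cells p 1"
    have "a 2 (idt p 1 x) = ({#}, {#})"
      using A(3)[OF N2(2) x, unfolded Suc_1] markings_1[OF A(2)[OF x]] by simp
    then show "R (idt p 1 x)"
      using w2[OF \<phi>(1) x] idt_cell[OF N2(2) x, unfolded Suc_1] by (simp add: R_def)
  next
    fix j u v assume c: "composable p 2 j u v" and "R u" "R v"
    note u = \<open>R u\<close>[unfolded R_def] and v = \<open>R v\<close>[unfolded R_def]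
    let ?h = "hcmp p 2 j u v"
    have j: "j \<le> 1" using c by (auto simp: composable_def)
    have ab: "a 2 ?h = (fst (a 2 u) + fst (a 2 v), {#})" "b 2 ?h = (fst (b 2 u) + fst (b 2 v), {#})"
      using A(4)[OF c j] B(4)[OF c j] markings_2[OF A(2)] markings_2[OF B(2)] u v by auto
    have e: "a 2 y = (fst (a 2 y), {#})" "b 2 y = (fst (b 2 y), {#})" if "y \<in> cells p 2" for y
      using markings_2[OF A(2)[OF that]] markings_2[OF B(2)[OF that]] by (metis prod.collapse)+
    have z: "fst (b 2 y) = {#}" if "fst (a 2 y) = {#}" "y \<in> cells p 2" for y
      using same[OF that(2)] that(1) by simp
    have "size (fst (a 2 ?h)) = 1 \<longrightarrow> \<phi> ?h = (if a 2 ?h = ?o \<and> b 2 ?h = ?o then 1 else 0)"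
    proof
      assume "size (fst (a 2 ?h)) = 1"
      then have "size (fst (a 2 u)) + size (fst (a 2 v)) = 1" using ab by simp
      then consider "fst (a 2 u) = {#}" "size (fst (a 2 v)) = 1" | "fst (a 2 v) = {#}" "size (fst (a 2 u)) = 1"
        by (metis add_is_1 size_eq_0_iff_empty One_nat_def)
      then show "\<phi> ?h = (if a 2 ?h = ?o \<and> b 2 ?h = ?o then 1 else 0)"
      proof cases
        case 1
        then have "a 2 ?h = a 2 v" "b 2 ?h = b 2 v" using ab e[of v] z[of u] u v by auto
        then show ?thesis using 1 u v w2'[OF \<phi>(1) c] by simp
      next
        case 2
        then have "a 2 ?h = a 2 u" "b 2 ?h = b 2 u" using ab e[of u] z[of v] u v by auto
        then show ?thesis using 2 u v w2'[OF \<phi>(1) c] by simp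
      qed
    qed
    then show "R ?h"
      using hcmp_cell[OF c] ab u v w2'[OF \<phi>(1) c] by (simp add: R_def)
  qed
  obtain G2 where G2: "G2 \<subseteq> gens \<kappa> 2 p" "generated_by 2 p G2"
    "\<forall>w. \<exists>\<phi>. weight 2 p \<phi> \<and> (\<forall>g\<in>G2. \<phi> g = w g)"
    using computad_presentation[OF p N2(3)] by blast
  from G2(3)[rule_format, of "\<lambda>g. if \<phi> (dm p 2 g) = 1 then 1 else 0"]
  obtain \<psi> where \<psi>: "weight 2 p \<psi>" "\<forall>g\<in>G2. \<psi> g = (if \<phi> (dm p 2 g) = 1 then 1 else 0)" by blast
  from G2(3)[rule_format, of "\<lambda>g. if \<phi> (dm p 2 g) = 1 then 0 else 1"]
  obtain \<psi>' where \<psi>': "weight 2 p \<psi>'" "\<forall>g\<in>G2. \<psi>' g = (if \<phi> (dm p 2 g) = 1 then 0 else 1)" by blast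
  have G2c: "g \<in> cells p 3" if "g \<in> G2" for g
    using gens_cell[of g 2 p] G2(1) that by auto
  have j3: "j \<le> 1 \<or> j = 2" if "composable p 3 j u v" for j u v
    using that by (auto simp: composable_def)
  have total: "\<psi> y + \<psi>' y = size (snd (b 3 y))" if "y \<in> cells p 3" for y
  proof (rule gen3[OF G2(2) that])
    fix g assume g: "g \<in> G2"
    then obtain t where "b 3 g = ({#}, {#t#})" using B(9)[OF _ N] G2(1) by blast
    then show "\<psi> g + \<psi>' g = size (snd (b 3 g))" using \<psi>(2) \<psi>'(2) g by simp
  next
    fix x assume x: "x \<in> cells p 2"
    have "snd (b 3 (idt p 2 x)) = {#}" using B(3)[OF N2(3) x] markings_2[OF B(2)[OF x]] by simp
    then show "\<psi> (idt p 2 x) + \<psi>' (idt p 2 x) = size (snd (b 3 (idt p 2 x)))"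
      using w3[OF \<psi>(1) x] w3[OF \<psi>'(1) x] by simp
  next
    fix j u v assume c: "composable p 3 j u v"
      and uv: "\<psi> u + \<psi>' u = size (snd (b 3 u))" "\<psi> v + \<psi>' v = size (snd (b 3 v))"
    have "snd (b 3 (hcmp p 3 j u v)) = snd (b 3 u) + snd (b 3 v)"
      using j3[OF c] B(4)[OF c] B(5)[of 3 u v] c by auto
    then show "\<psi> (hcmp p 3 j u v) + \<psi>' (hcmp p 3 j u v) = size (snd (b 3 (hcmp p 3 j u v)))"
      using w3'[OF \<psi>(1) c] w3'[OF \<psi>'(1) c] uv by simp
  qed
  \<comment> \<open>Likewise for \<open>\<psi>\<close> on cells over the transition. The clause for cells without transitions makes
      the induction pass through composites along 2-cells, where the other factor is such a cell.\<close>
  define Q where "Q y \<longleftrightarrow> y \<in> cells p 3 \<and> (snd (a 3 y) = {#} \<longrightarrow> \<psi> y = 0 \<and> \<phi> (dm p 2 y) = \<phi> (cd p 2 y)) \<and>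
      (a 3 y = ?t \<longrightarrow> \<psi> y = (if \<phi> (dm p 2 y) = 1 then 1 else 0))" for y
  have cl3: "Q y" if "y \<in> cells p 3" for y
  proof (rule gen3[OF G2(2) that])
    fix g assume g: "g \<in> G2"
    then obtain t where "a 3 g = ({#}, {#t#})" using A(9)[OF _ N] G2(1) by blast
    then show "Q g" using \<psi>(2) g G2c[OF g] by (simp add: Q_def)
  next
    fix x assume x: "x \<in> cells p 2"
    have "snd (a 3 (idt p 2 x)) = {#}" using A(3)[OF N2(3) x] markings_2[OF A(2)[OF x]] by simp
    then show "Q (idt p 2 x)"
      using w3[OF \<psi>(1) x] dm_idt[OF N2(3) x] cd_idt[OF N2(3) x] idt_cell[OF N2(3) x]
      by (auto simp: Q_def)
  next
    fix j u v assume c: "composable p 3 j u v" and u: "Q u" and v: "Q v"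
    let ?h = "hcmp p 3 j u v"
    have uv: "u \<in> cells p 3" "v \<in> cells p 3" using u v by (auto simp: Q_def)
    have h: "?h \<in> cells p 3" "\<psi> ?h = \<psi> u + \<psi> v" using hcmp_cell[OF c] w3'[OF \<psi>(1) c] by auto
    from j3[OF c] show "Q ?h"
    proof
      assume j: "j \<le> 1"
      then have c': "composable p (Suc 2) j u v" "j < 2" using c by auto
      have d: "\<phi> (dm p 2 ?h) = \<phi> (dm p 2 u) + \<phi> (dm p 2 v)" "\<phi> (cd p 2 ?h) = \<phi> (cd p 2 u) + \<phi> (cd p 2 v)"
        using dm_hcmp[OF c'] cd_hcmp[OF c'] w2'[OF \<phi>(1) composable_dm[OF c']]
          w2'[OF \<phi>(1) composable_cd[OF c']] by simp_all
      have ah: "a 3 ?h = (fst (a 3 u) + fst (a 3 v), snd (a 3 u) + snd (a 3 v))" using A(4)[OF c j] .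
      have z: "\<phi> (dm p 2 y) = 0" if "a 3 y = ({#}, {#})" "y \<in> cells p 3" for y
        using A(6)[OF that(2)] that(1) cl2[of "dm p 2 y"] dm_cell[of y 2] that(2)
        by (simp add: R_def)
      have "\<psi> ?h = (if \<phi> (dm p 2 ?h) = 1 then 1 else 0)" if "a 3 ?h = ?t"
      proof -
        have f: "fst (a 3 u) = {#}" "fst (a 3 v) = {#}" and s: "snd (a 3 u) + snd (a 3 v) = {#0#}"
          using that ah by auto
        from s consider "snd (a 3 u) = {#}" "snd (a 3 v) = {#0#}" | "snd (a 3 u) = {#0#}" "snd (a 3 v) = {#}"
          unfolding add_eq_single by blast
        then show ?thesis
        proof cases
          case 1
          then have "a 3 u = ({#}, {#})" "a 3 v = ?t" using f by (metis prod.collapse)+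
          then show ?thesis using z[OF _ uv(1)] u v h d by (simp add: Q_def)
        next
          case 2
          then have "a 3 v = ({#}, {#})" "a 3 u = ?t" using f by (metis prod.collapse)+
          then show ?thesis using z[OF _ uv(2)] u v h d by (simp add: Q_def)
        qed
      qed
      then show ?thesis using u v h d ah by (simp add: Q_def)
    next
      assume j: "j = 2"
      have c': "composable p (Suc 2) 2 u v" "composable p 3 2 u v" using c j by auto
      have d: "dm p 2 ?h = dm p 2 v" "cd p 2 ?h = cd p 2 u" "dm p 2 u = cd p 2 v"
        using dm_hcmp_top[OF c'(1)] cd_hcmp_top[OF c'(1)] c'(1) unfolding j composable_top by auto
      have ah: "a 3 ?h = (fst (a 3 u), snd (a 3 u) + snd (a 3 v))"
        "fst (a 3 u) + net_input inP (snd (a 3 u)) = fst (a 3 v)" using A(5)[OF c'(2)] j by auto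
      have "\<psi> ?h = (if \<phi> (dm p 2 ?h) = 1 then 1 else 0)" if "a 3 ?h = ?t"
      proof -
        have f: "fst (a 3 u) = {#}" and s: "snd (a 3 u) + snd (a 3 v) = {#0#}"
          using that ah by auto
        from s consider "snd (a 3 u) = {#}" "snd (a 3 v) = {#0#}" | "snd (a 3 u) = {#0#}" "snd (a 3 v) = {#}"
          unfolding add_eq_single by blast
        then show ?thesis
        proof cases
          case 1
          then have "a 3 v = ?t" using f ah(2) by (metis net_input_simps(1) add_0 prod.collapse)
          then show ?thesis using 1 u v h d by (simp add: Q_def)
        next
          case 2
          then have "a 3 u = ?t" using f by (metis prod.collapse)
          then show ?thesis using 2 u v h d by (simp add: Q_def)
        qed
      qed
      then show ?thesis using u v h d ah by (simp add: Q_def)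
    qed
  qed
  define F where "F y = (code (fst (b 3 y), replicate_mset (\<psi> y) 0 + replicate_mset (\<psi>' y) 1) :: 'u)" for y
  let ?p3 = "trunc 3 p" and ?W3 = "trunc 3 ?W"
  have \<rho>'f: "\<rho>' \<in> nfunctors N p ?P" using computad_mapsD(1)[OF \<rho>(2)] .
  note R' = nfunctorsD[OF \<rho>'f]
  \<comment> \<open>In dimensions up to 2, \<open>f\<close> is to be \<open>\<rho>'\<close>.\<close>
  have eqPW: "(trunc 2 ?P) = trunc 2 ?W"
    using N2(5) by (auto simp: trunc_net net_def raw_net_def image_ncat_def markings_def fun_eq_iff)
  have g2: "trunc_map 2 \<rho>' \<in> nfunctors (enat 2) (trunc 2 ?p3) (trunc 2 ?W3)"
    using trunc_map_functor[OF \<rho>'f N2(5)] unfolding eqPW by simp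
  have bm: "set_mset (fst (b 3 y)) \<subseteq> {0, 1} \<and> set_mset (snd (b 3 y)) \<subseteq> {0}"
    if "y \<in> cells p 3" for y
    using B(2)[OF that] by (cases "b 3 y") (simp add: markings_iff)
  have "lifts 2 ?p3 ?W3 (trunc_map 2 \<rho>') F"
    unfolding lifts_def
  proof (intro conjI ballI allI impI)
    show "F y \<in> cells ?W3 (Suc 2)" if "y \<in> cells ?p3 (Suc 2)" for y
      using bm that N2(4) by (auto simp: F_def markings_iff split: if_splits)
  next
    fix y assume "y \<in> cells ?p3 (Suc 2)"
    then have y: "y \<in> cells p 3" by simp
    have "net_input inP (snd (b 3 y)) = net_input inP (replicate_mset (\<psi> y) 0 + replicate_mset (\<psi>' y) 1)"
      unfolding inP_def by (rule net_input_const) (simp add: total[OF y])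
    then show "dm ?W3 2 (F y) = trunc_map 2 \<rho>' 2 (dm ?p3 2 y)" "cd ?W3 2 (F y) = trunc_map 2 \<rho>' 2 (cd ?p3 2 y)"
      using R'(3,4)[of y 2] y B(1)[OF y] by (simp_all add: F_def inP_def)
  next
    fix x assume "x \<in> cells ?p3 2"
    then have x: "x \<in> cells p 2" by simp
    have i: "idt p 2 x \<in> cells p 3" using idt_cell[OF N2(3) x] by simp
    have "b 3 (idt p 2 x) = b 2 x" using B(3)[OF N2(3) x] by simp
    then show "F (idt ?p3 2 x) = idt ?W3 2 (trunc_map 2 \<rho>' 2 x)"
      using i w3[OF \<psi>(1) x] w3[OF \<psi>'(1) x] B(1)[OF x] markings_2[OF B(2)[OF x]]
      by (simp add: F_def) (metis prod.collapse)
  next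
    fix j u v assume "composable ?p3 (Suc 2) j u v"
    then have c: "composable p 3 j u v" by simp
    have uv: "u \<in> cells p 3" "v \<in> cells p 3" "hcmp p 3 j u v \<in> cells p 3"
      using c hcmp_cell[OF c] by (auto simp: composable_def)
    from j3[OF c] show "F (hcmp ?p3 (Suc 2) j u v) = hcmp ?W3 (Suc 2) j (F u) (F v)"
    proof
      assume j: "j \<le> 1"
      show ?thesis using uv j B(4)[OF c j] w3'[OF \<psi>(1) c] w3'[OF \<psi>'(1) c]
        by (simp add: F_def replicate_mset_add ac_simps)
    next
      assume j: "j = 2"
      show ?thesis using uv j B(5)[OF c[unfolded j]] w3'[OF \<psi>(1) c] w3'[OF \<psi>'(1) c]
        by (simp add: F_def replicate_mset_add ac_simps)
    qed
  qed
  moreover have "is_ncat (enat (Suc 2)) ?p3" using trunc_ncat[OF np N2(4)] by simp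
  ultimately have ex: "(trunc_map 2 \<rho>')(3 := restrict F (cells p 3)) \<in> nfunctors (enat 3) ?p3 ?W3"
    using lift_functor(1)[OF _ g2] by simp
  have idle: "idle_above 3 p"
  proof (rule idle_if_no_gens[OF p])
    fix k assume "3 \<le> k" "enat (Suc k) \<le> N"
    then show "gens \<kappa> k p = {}" by (intro A(10)) (auto simp: net_gens_def)
  qed
  define f where "f = idle_extend p ?W 3 ((trunc_map 2 \<rho>')(3 := restrict F (cells p 3)))"
  have ff: "f \<in> nfunctors N p ?W"
    unfolding f_def by (rule idle_extend_functor[OF np net_ncats(4) idle N2(4) ex])
  have low: "f k x = \<rho>' k x" if "k \<le> 2" "x \<in> cells p k" for k x
    using that by (simp add: f_def idle_extend_low)
  have f3: "f 3 y = code (fst (b 3 y), replicate_mset (\<psi> y) 0 + replicate_mset (\<psi>' y) 1)" if "y \<in> cells p 3" for y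
    using that by (simp add: f_def idle_extend_low F_def)
  have fm: "f \<in> computad_maps \<kappa> N p ?W"
  proof -
    have "f (Suc k) y \<in> gens \<kappa> k ?W" if k: "enat (Suc k) \<le> N" and y: "y \<in> gens \<kappa> k p" for k y
    proof -
      have gW: "gens \<kappa> k ?W = net_gens {0, 1} {0, 1} k" by (rule gens_net[OF _ k]) simp
      have yc: "y \<in> cells p (Suc k)" using gens_cell[OF y] .
      consider "k = 1" | "k = 2" | "net_gens {0, 1} {0} k = ({} :: 'u set)" unfolding net_gens_def by fastforce
      then show ?thesis
      proof cases
        case 1
        have "y \<in> cells p 2" using yc unfolding 1 Suc_1 .
        moreover obtain s where "s \<in> {0, 1}" "b 2 y = ({#s#}, {#})" using B(8)[OF _ N2(1)] y 1 by blast
        ultimately show ?thesis using low[of 2 y] B(1)[of y 2] unfolding gW unfolding 1 Suc_1 by (auto simp: net_gens_def)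
      next
        case 2
        have y3: "y \<in> cells p 3" using yc 2 by simp
        obtain t where "b 3 y = ({#}, {#t#})" using B(9)[OF _ N] y 2 by blast
        then have b3: "fst (b 3 y) = {#}" "\<psi> y + \<psi>' y = 1" using total[OF y3] by simp_all
        then have "f 3 y = code ({#}, {#0#}) \<or> f 3 y = code ({#}, {#1#})"
          using f3[OF y3] by (auto simp: add_is_1)
        then show ?thesis unfolding gW by (auto simp: 2 net_gens_def)
      next
        case 3
        then show ?thesis using A(10)[OF k] y by blast
      qed
    qed
    then show ?thesis using ff by (auto simp: computad_maps_def)
  qed
  have over: "ncompose p (forget N) f = ncompose p (collapse N) \<rho>'"
  proof (rule idle_functors_eq[OF np idle])
    show "ncompose p (forget N) f \<in> nfunctors N p (netZ N)"
      by (rule ncompose_functor[OF ff computad_mapsD(1)[OF net_maps(3)] np])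
    show "ncompose p (collapse N) \<rho>' \<in> nfunctors N p (netZ N)"
      by (rule ncompose_functor[OF \<rho>'f computad_mapsD(1)[OF net_maps(2)] np])
  next
    fix k x assume k: "k \<le> 3" and x: "x \<in> cells p k"
    have l: "enat k \<le> N" using cell_le[OF x] .
    have bk: "(fst (b k x), snd (b k x)) \<in> markings {0, 1} {0} k" using B(2)[OF x] by simp
    have "forget N k (f k x) = (collapse N k (\<rho>' k x) :: 'u)"
    proof (cases "k = 3")
      case True
      have x3: "x \<in> cells p 3" using x True by simp
      have m: "(fst (b 3 x), replicate_mset (\<psi> x) 0 + replicate_mset (\<psi>' x) 1) \<in> markings {0, 1} {0, 1} 3"
        using bm[OF x3] by (auto simp: markings_iff split: if_splits)
      have "snd (b 3 x) = replicate_mset (\<psi> x + \<psi>' x) 0"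
        unfolding total[OF x3] using bm[OF x3] by (metis set_mset_subset_singletonD replicate_mset_0 size_empty size_replicate_mset)
      then have "image_mset (\<lambda>_. 0) (replicate_mset (\<psi> x) (0::nat) + replicate_mset (\<psi>' x) 1) = snd (b 3 x)"
        by (simp add: replicate_mset_add)
      then show ?thesis
        using net_map_code[OF N2(4) m, of "\<lambda>_. 0" "\<lambda>_. 0"] net_map_code[OF N2(4) bk[unfolded True], of "\<lambda>_. 0" "\<lambda>t. t"]
          f3[OF x3] B(1)[OF x3] by (simp add: True)
    next
      case False
      then have k2: "k \<le> 2" using k by simp
      have s: "snd (b k x) = {#}" using bk k2 by (cases "b k x") (simp add: markings_iff)
      have m: "(fst (b k x), {#}) \<in> markings {0, 1} {0, 1} k"
        using bk s by (cases "b k x") (simp add: markings_iff)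
      show ?thesis
        using low[OF k2 x] B(1)[OF x] s net_map_code[OF l m, of "\<lambda>_. 0" "\<lambda>_. 0"]
          net_map_code[OF l bk, of "\<lambda>_. 0" "\<lambda>t. t"] by (metis image_mset_empty prod.collapse)
    qed
    then show "ncompose p (forget N) f k x = ncompose p (collapse N) \<rho>' k x" using x by simp
  qed
  \<comment> \<open>For a section \<open>h\<close> of \<open>\<rho>\<close>, the weight \<open>\<phi>\<close> of the domain of the image of the transition
      depends only on where \<open>\<rho>'\<close> sends the image of place 0. Place 1 contributes nothing, as it is
      not over place 0.\<close>
  have val: "f 3 (h 3 (code ?t)) = code ({#}, replicate_mset c 0 + replicate_mset (1 - c) 1)"
    if h: "h \<in> computad_maps \<kappa> N ?P p" and \<rho>h: "ncompose ?P \<rho> h = nid ?P" and \<rho>'t: "b 3 (h 3 (code ?t)) = ?t"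
      and s: "b 2 (h 2 (code ({#0#}, {#}))) = ({#c'#}, {#})" and c: "c = (if c' = 0 then 1 else 0)" for h c c'
  proof -
    note H = nfunctorsD[OF computad_mapsD(1)[OF h]]
    have mk: "(code ?t :: 'u) \<in> cells ?P 3" "(code ({#s#}, {#}) :: 'u) \<in> cells ?P 2" if "s \<le> 1" for s
      using that N2 by (auto simp: markings_iff numeral_eq_enat le_Suc_eq)
    have ah: "a k (h k (code x)) = x" if "(code x :: 'u) \<in> cells ?P k" for k x
      using fun_cong[OF fun_cong[OF \<rho>h], of k "code x"] that by (simp add: a_def del: net_simps)
    let ?y = "h 3 (code ?t)" and ?u = "h 2 (code ({#0#}, {#}))" and ?v = "h 2 (code ({#1#}, {#}))"
    have y: "?y \<in> cells p 3" and u: "?u \<in> cells p 2" and v: "?v \<in> cells p 2"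
      using H(2) mk[of 0] mk[of 1] by auto
    have comp: "composable ?P 2 0 (code ({#0#}, {#})) (code ({#1#}, {#}) :: 'u)"
      using N2 by (simp add: composable_net markings_iff numeral_eq_enat)
    have "dm p 2 ?y = h 2 (dm ?P 2 (code ?t))" using H(3)[of "code ?t" 2] mk(1)[of 0] by simp
    also have "dm ?P 2 (code ?t :: 'u) = hcmp ?P 2 0 (code ({#0#}, {#})) (code ({#1#}, {#}))" by simp
    also have "h 2 \<dots> = hcmp p 2 0 ?u ?v" using H(6)[OF comp] .
    finally have "\<phi> (dm p 2 ?y) = \<phi> ?u + \<phi> ?v"
      using w2'[OF \<phi>(1) nfunctors_composable[OF computad_mapsD(1)[OF h] net_ncats(2) comp]] by simp
    moreover have "\<phi> ?v = 0" using cl2[OF v] ah[OF mk(2)[of 1]] by (simp add: R_def)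
    moreover have "\<phi> ?u = c" using cl2[OF u] ah[OF mk(2)[of 0]] s c by (simp add: R_def)
    ultimately have "\<psi> ?y = c" using cl3[OF y] ah[OF mk(1)[of 0]] c by (simp add: Q_def split: if_splits)
    moreover have "\<psi> ?y + \<psi>' ?y = 1" using total[OF y] \<rho>'t by simp
    ultimately show ?thesis using f3[OF y] \<rho>'t by (metis add_diff_cancel_left' fst_conv)
  qed
  have bh: "b k (h k (code x)) = inv code (ncompose ?P \<rho>' h k (code x))" if "(code x :: 'u) \<in> cells ?P k" for h k x
    using that by (simp add: b_def del: net_simps)
  have mk3: "?t \<in> markings {0, 1} {0} 3" "?o \<in> markings {0, 1} {0} 2" by (simp_all add: markings_iff)
  then have mk: "(code ?t :: 'u) \<in> cells ?P 3" "(code ?o :: 'u) \<in> cells ?P 2" using N2 by simp_all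
  show ?thesis
  proof (intro bexI[OF _ fm] conjI allI ballI impI over low)
    fix h assume h: "h \<in> computad_maps \<kappa> N ?P p" "ncompose ?P \<rho> h = nid ?P" "ncompose ?P \<rho>' h = nid ?P"
    have "b 3 (h 3 (code ?t)) = ?t" "b 2 (h 2 (code ?o)) = ?o"
      using bh[OF mk(1), of h] bh[OF mk(2), of h] mk unfolding h(3) by (simp_all del: net_simps)
    from val[OF h(1,2) this refl] show "f 3 (h 3 (code ?t)) = code ?t" by simp
  next
    fix h assume h: "h \<in> computad_maps \<kappa> N ?P p" "ncompose ?P \<rho> h = nid ?P" "ncompose ?P \<rho>' h = swap N"
    have "b 3 (h 3 (code ?t)) = ?t" "b 2 (h 2 (code ?o)) = ({#1#}, {#})"
      using bh[OF mk(1), of h] bh[OF mk(2), of h] net_map_code[OF N2(4) mk3(1), of "\<lambda>s. 1 - s" "\<lambda>t. t"]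
        net_map_code[OF N2(5) mk3(2), of "\<lambda>s. 1 - s" "\<lambda>t. t"]
      unfolding h(3) by (simp_all del: net_simps)
    from val[OF h(1,2) this refl] show "f 3 (h 3 (code ?t)) = code ({#}, {#1#})" by simp
  qed
qed

end


section \<open>Slices of computads are not cartesian closed\<close>

text \<open>The category of \<open>N\<close>-computads for \<open>3 \<le> N \<le> \<infinity>\<close>, with morphisms between computads in the unwound
  form.\<close>

locale computad_category = small_universe \<kappa> for \<kappa> :: "'u rel" +
  fixes N :: enat and C :: "('u ncat, 'u nmap) cat"
  assumes dim: "3 \<le> N"
    and Obj_C: "Obj C = {A. computad \<kappa> N A}"
    and Hom_C: "\<And>A B. \<lbrakk>computad \<kappa> N A; computad \<kappa> N B\<rbrakk> \<Longrightarrow> Hom C A B = computad_maps \<kappa> N A B"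
    and Ident_C: "Ident C = nid" and Cmp_C: "Cmp C = (\<lambda>A B C. ncompose A)"
begin

lemma computad_ncat: "computad \<kappa> N A \<Longrightarrow> is_ncat N A"
  by (simp add: computad_def)

lemma nid_computad_map: "is_ncat N A \<Longrightarrow> nid A \<in> computad_maps \<kappa> N A A"
  using nid_functor by (auto simp: computad_maps_def gens_cell)

lemma is_category: "category C"
proof
  fix a b c d f g h assume "a \<in> Obj C" "b \<in> Obj C" "c \<in> Obj C" "d \<in> Obj C"
    "f \<in> Hom C a b" "g \<in> Hom C b c" "h \<in> Hom C c d"
  then have *: "f \<in> computad_maps \<kappa> N a b" by (simp add: Obj_C Hom_C)
  show "Cmp C a b d (Cmp C b c d h g) f = Cmp C a c d h (Cmp C a b c g f)"
    using nfunctorsD(2)[OF computad_mapsD(1)[OF *]]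
    by (auto simp: Cmp_C ncompose_def compose_def fun_eq_iff restrict_def)
next
  fix a b f assume "a \<in> Obj C" "b \<in> Obj C" "f \<in> Hom C a b"
  then have *: "f \<in> nfunctors N a b" and a: "is_ncat N a" and b: "is_ncat N b"
    using computad_mapsD(1) computad_ncat by (auto simp: Obj_C Hom_C)
  show "Cmp C a b b (Ident C b) f = f"
    unfolding Cmp_C Ident_C
    by (rule nfunctors_ext[OF ncompose_functor[OF * nid_functor[OF b] a] *])
      (use nfunctorsD(2)[OF *] in auto)
  show "Cmp C a a b f (Ident C a) = f"
    unfolding Cmp_C Ident_C
    by (rule nfunctors_ext[OF ncompose_functor[OF nid_functor[OF a] * a] *]) auto
qed (auto simp: Obj_C Hom_C Cmp_C Ident_C computad_ncat intro: computad_maps_compose nid_computad_map)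

theorem not_locally_cartesian_closed: "\<not> locally_cartesian_closed C"
proof
  assume lcc: "locally_cartesian_closed C"
  let ?D = "netD N :: 'u ncat" and ?P = "netP N :: 'u ncat" and ?Z = "netZ N :: 'u ncat" and ?W = "netW N :: 'u ncat"
  let ?r = "collapse N :: 'u nmap" and ?w = "forget N :: 'u nmap" and ?i = "incl N 0 :: 'u nmap"
    and ?j = "incl N 1 :: 'u nmap" and ?s = "swap N :: 'u nmap"
  define S where "S = slice C ?Z"
  interpret C: category C by (rule is_category)
  have Z: "?Z \<in> Obj C" using net_computads by (simp add: Obj_C)
  interpret S: category S unfolding S_def by (rule slice_category[OF is_category Z])
  have cc: "cartesian_closed S" using lcc Z unfolding S_def locally_cartesian_closed_def by blast
  have SO: "(A, p) \<in> Obj S \<longleftrightarrow> computad \<kappa> N A \<and> p \<in> computad_maps \<kappa> N A ?Z" for A p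
    using net_computads(3)[of N] by (auto simp: S_def slice_def Obj_C Hom_C)
  have SH: "h \<in> Hom S (A, p) (B, q) \<longleftrightarrow> h \<in> computad_maps \<kappa> N A B \<and> ncompose A q h = p"
    if "computad \<kappa> N A" "computad \<kappa> N B" for A B h p q
    using that by (simp add: S_def slice_def Hom_C Cmp_C)
  have SC: "Cmp S (A, p) (B, q) (E, t) = ncompose A" for A B E p q t
    by (simp add: S_def slice_def Cmp_C)
  note nc = net_computads[of N] and nn = net_ncats[of N]
  have im: "?i \<in> computad_maps \<kappa> N ?D ?P" and jm: "?j \<in> computad_maps \<kappa> N ?D ?P"
    using net_maps(1)[of 0 N] net_maps(1)[of 1 N] by auto
  note rm = net_maps(2)[of N] and wm = net_maps(3)[of N] and sm = net_maps(4)[of N]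
  have zm: "nid ?Z \<in> computad_maps \<kappa> N ?Z ?Z" by (rule nid_computad_map[OF nn(3)])
  define d where "d = ncompose ?D ?r ?i"
  have dm: "d \<in> computad_maps \<kappa> N ?D ?Z"
    unfolding d_def by (rule computad_maps_compose[OF im rm nn(1)])
  have rj: "ncompose ?D ?r ?j = d"
    unfolding d_def
  proof (rule nfunctors_ext)
    show "ncompose ?D ?r ?j \<in> nfunctors N ?D ?Z" "ncompose ?D ?r ?i \<in> nfunctors N ?D ?Z"
      using computad_maps_compose[OF _ rm nn(1)] im jm computad_mapsD(1) by blast+
    fix k x assume x: "x \<in> cells ?D k"
    from net_map_cells[OF x im] obtain m \<tau> where m: "x = code (m, \<tau>)" "(m, \<tau>) \<in> markings {0} {} k" "enat k \<le> N" by blast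
    have "(image_mset (\<lambda>_. s) m, \<tau>) \<in> markings {0, 1} {0} k" if "s \<le> 1" for s
      using m(2) that by (auto simp: markings_iff split: if_splits)
    from net_map_code[OF m(3) this, of 0] net_map_code[OF m(3) this, of 1]
    show "ncompose ?D ?r ?j k x = ncompose ?D ?r ?i k x"
      using x net_map_code[OF m(3,2)] by (simp add: m(1) image_mset.compositionality comp_def)
  qed
  have rs: "ncompose ?P ?r ?s = ?r"
  proof (rule nfunctors_ext)
    show "ncompose ?P ?r ?s \<in> nfunctors N ?P ?Z" "?r \<in> nfunctors N ?P ?Z"
      using computad_maps_compose[OF sm rm nn(2)] rm computad_mapsD(1) by blast+
    fix k x assume x: "x \<in> cells ?P k"
    from net_map_cells[OF x sm] obtain m \<tau> where m: "x = code (m, \<tau>)" "(m, \<tau>) \<in> markings {0, 1} {0} k" "enat k \<le> N" by blast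
    have "(image_mset (\<lambda>s. 1 - s) m, \<tau>) \<in> markings {0, 1} {0} k"
      using m(2) by (auto simp: markings_iff split: if_splits)
    from net_map_code[OF m(3) this]
    show "ncompose ?P ?r ?s k x = ?r k x"
      using x net_map_code[OF m(3,2)] by (simp add: m(1) image_mset.compositionality comp_def)
  qed
  have rid: "ncompose ?P ?r (nid ?P) = ?r" "ncompose ?P (nid ?Z) ?r = ?r"
    using C.id_left[of ?P ?Z ?r] C.id_right[of ?P ?Z ?r] nc rm by (simp_all add: Obj_C Hom_C Cmp_C Ident_C)
  have obj: "(?P, ?r) \<in> Obj S" "(?D, d) \<in> Obj S" "(?W, ?w) \<in> Obj S" "(?Z, nid ?Z) \<in> Obj S"
    using nc rm dm wm zm by (simp_all add: SO del: net_simps)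
  have hom: "?i \<in> Hom S (?D, d) (?P, ?r)" "?j \<in> Hom S (?D, d) (?P, ?r)"
    "?r \<in> Hom S (?P, ?r) (?Z, nid ?Z)"
    "nid ?P \<in> Hom S (?P, ?r) (?P, ?r)" "?s \<in> Hom S (?P, ?r) (?P, ?r)"
    using nc im jm rm sm rj rs rid nid_computad_map[OF nn(2)] unfolding d_def
    by (simp_all add: SH del: net_simps)
  obtain q \<rho> \<rho>' where q: "is_product S (?P, ?r) (?P, ?r) q \<rho> \<rho>'"
    using cc obj unfolding cartesian_closed_def by blast
  obtain dq \<sigma> \<sigma>' where dq: "is_product S (?D, d) (?P, ?r) dq \<sigma> \<sigma>'"
    using cc obj unfolding cartesian_closed_def by blast
  obtain e p \<pi> \<pi>' ev where ex: "is_exponential S (?P, ?r) (?W, ?w) e p \<pi> \<pi>' ev"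
    using cc obj unfolding cartesian_closed_def by blast
  obtain Q t where Q: "q = (Q, t)" by (cases q)
  obtain E y where E: "dq = (E, y)" by (cases dq)
  have qQ: "computad \<kappa> N Q" "\<rho> \<in> computad_maps \<kappa> N Q ?P" "\<rho>' \<in> computad_maps \<kappa> N Q ?P"
    "ncompose Q ?r \<rho> = t" "ncompose Q ?r \<rho>' = t"
    using q nc unfolding is_product_def Q by (auto simp: SO SH simp del: net_simps)
  have dE: "computad \<kappa> N E" "\<sigma> \<in> computad_maps \<kappa> N E ?D"
    using dq nc unfolding is_product_def E by (auto simp: SO SH simp del: net_simps)
  have sq: "ncompose Q ?r \<rho> = ncompose Q ?r \<rho>'" using qQ by simp
  obtain f where f: "f \<in> computad_maps \<kappa> N Q ?W" "ncompose Q ?w f = ncompose Q ?r \<rho>'"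
    and low: "\<forall>k x. k \<le> 2 \<longrightarrow> x \<in> cells Q k \<longrightarrow> f k x = \<rho>' k x"
    and sep: "\<forall>h\<in>computad_maps \<kappa> N ?P Q. ncompose ?P \<rho> h = nid ?P \<longrightarrow>
      (ncompose ?P \<rho>' h = nid ?P \<longrightarrow> f 3 (h 3 (code ({#}, {#0#}))) = code ({#}, {#0#})) \<and>
      (ncompose ?P \<rho>' h = ?s \<longrightarrow> f 3 (h 3 (code ({#}, {#0#}))) = code ({#}, {#1#}))"
    using separating_map[OF dim qQ(1-3) sq] by blast
  have fS: "f \<in> Hom S q (?W, ?w)" using f qQ nc by (simp add: Q SH del: net_simps)
  \<comment> \<open>There are no transitions in \<open>netD\<close>, hence none in its product with \<open>netP\<close>.\<close>
  have idleE: "idle_above 2 E"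
  proof (rule idle_if_no_gens[OF dE(1)])
    fix k assume "2 \<le> k" "enat (Suc k) \<le> N"
    then show "gens \<kappa> k E = {}"
      by (intro map_to_net(10)[OF dE(2) computad_ncat[OF dE(1)]]) (auto simp: net_gens_def)
  qed
  have coeq: "\<exists>g'\<in>Hom S (?Z, nid ?Z) e'. Cmp S (?P, ?r) (?Z, nid ?Z) e' g' ?r = g"
    if e': "e' \<in> Obj S" and g: "g \<in> Hom S (?P, ?r) e'"
      and eq: "Cmp S (?D, d) (?P, ?r) e' g ?i = Cmp S (?D, d) (?P, ?r) e' g ?j" for e' g
  proof -
    obtain H \<epsilon> where H: "e' = (H, \<epsilon>)" by (cases e')
    have Hc: "computad \<kappa> N H" "\<epsilon> \<in> computad_maps \<kappa> N H ?Z" using e' SO by (auto simp: H simp del: net_simps)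
    have g': "g \<in> computad_maps \<kappa> N ?P H" "ncompose ?P \<epsilon> g = ?r"
      using g SH[OF nc(2) Hc(1)] by (auto simp: H simp del: net_simps)
    have "ncompose ?D g ?i = ncompose ?D g ?j" using eq by (simp add: H SC)
    from collapse_coequalizes[OF dim computad_ncat[OF Hc(1)] g'(1) this]
    obtain u where u: "u \<in> computad_maps \<kappa> N ?Z H" "ncompose ?P u ?r = g" by blast
    have "ncompose ?Z \<epsilon> u = nid ?Z"
    proof (rule nfunctors_ext)
      show "ncompose ?Z \<epsilon> u \<in> nfunctors N ?Z ?Z" "nid ?Z \<in> nfunctors N ?Z ?Z"
        using computad_maps_compose[OF u(1) Hc(2) nn(3)] zm computad_mapsD(1) by blast+
      fix k x assume x: "x \<in> cells ?Z k"
      then obtain m \<tau> where m: "x = code (m, \<tau>)" "(m, \<tau>) \<in> markings {0} {0} k" "enat k \<le> N"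
        by (auto split: if_splits)
      have mP: "(m, \<tau>) \<in> markings {0, 1} {0} k" using m(2) by (auto simp: markings_iff split: if_splits)
      then have xP: "x \<in> cells ?P k" using m by simp
      have "set_mset m \<subseteq> {0}" using m(2) by (auto simp: markings_iff split: if_splits)
      then have rx: "?r k x = x" using net_map_code[OF m(3) mP, of "\<lambda>_. 0" "\<lambda>t. t"] by (simp add: m(1) image_zero)
      have "\<epsilon> k (u k x) = ncompose ?P \<epsilon> (ncompose ?P u ?r) k x" using xP rx by (simp del: net_simps)
      also have "\<dots> = x" using g'(2) u(2) rx by simp
      finally show "ncompose ?Z \<epsilon> u k x = nid ?Z k x" using x by (simp del: net_simps)
    qed
    then have "u \<in> Hom S (?Z, nid ?Z) e'" using u SH[OF nc(3) Hc(1)] by (simp add: H del: net_simps)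
    then show ?thesis using u(2) by (intro bexI[of _ u]) (simp_all add: H SC)
  qed
  have fuv: "Cmp S dq q (?W, ?w) f u = Cmp S dq q (?W, ?w) f v"
    if u: "u \<in> Hom S dq q" and v: "v \<in> Hom S dq q"
      and "Cmp S dq q (?P, ?r) \<rho>' u = \<sigma>'" "Cmp S dq q (?P, ?r) \<rho>' v = \<sigma>'" for u v
  proof -
    have uv: "u \<in> computad_maps \<kappa> N E Q" "v \<in> computad_maps \<kappa> N E Q" "ncompose E \<rho>' u = ncompose E \<rho>' v"
      using that SH[OF dE(1) qQ(1)] by (simp_all add: Q E SC)
    have "ncompose E f u = ncompose E f v"
    proof (rule idle_functors_eq[OF computad_ncat[OF dE(1)] idleE])
      show "ncompose E f u \<in> nfunctors N E ?W" "ncompose E f v \<in> nfunctors N E ?W"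
        using computad_maps_compose[OF _ f(1) computad_ncat[OF dE(1)]] uv computad_mapsD(1) by blast+
      fix k x assume k: "k \<le> 2" and x: "x \<in> cells E k"
      have "u k x \<in> cells Q k" "v k x \<in> cells Q k"
        using x nfunctorsD(2)[OF computad_mapsD(1)] uv by blast+
      moreover have "\<rho>' k (u k x) = \<rho>' k (v k x)"
        using fun_cong[OF fun_cong[OF uv(3)], of k x] x by simp
      ultimately show "ncompose E f u k x = ncompose E f v k x" using low k x by simp
    qed
    then show ?thesis by (simp add: E Q SC)
  qed
  have "\<exists>k\<in>Hom S (?P, ?r) (?W, ?w). f = Cmp S q (?P, ?r) (?W, ?w) k \<rho>'"
  proof (rule S.exponential_factors_through_projection[OF obj(1,2,1,3,4) hom(1,2,3,3) _ ex q _ dq fS])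
    show "Cmp S q (?P, ?r) (?Z, nid ?Z) ?r \<rho> = Cmp S q (?P, ?r) (?Z, nid ?Z) ?r \<rho>'"
      using sq by (simp add: Q SC)
  qed (use coeq fuv in blast)+
  then obtain k where k: "k \<in> computad_maps \<kappa> N ?P ?W" "f = ncompose Q k \<rho>'"
    using SH[OF nc(2,4)] by (auto simp: Q SC simp del: net_simps)
  let ?t = "code ({#}, {#0#}) :: 'u"
  have tm: "({#}, {#0#}) \<in> markings {0, 1} {0} 3" by (simp add: markings_iff)
  have l3: "enat 3 \<le> N" using dim by (simp add: numeral_eq_enat)
  have t: "?t \<in> cells ?P 3" using tm l3 by simp
  have val: "f 3 (h 3 ?t) = k 3 (h' 3 ?t)"
    if "h \<in> computad_maps \<kappa> N ?P Q" "ncompose ?P \<rho>' h = h'" for h h'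
  proof -
    have "h 3 ?t \<in> cells Q 3" using nfunctorsD(2)[OF computad_mapsD(1)[OF that(1)] t] .
    then show ?thesis using that(2) t by (auto simp: k(2) simp del: net_simps)
  qed
  \<comment> \<open>For \<open>c\<close> the identity and \<open>swap\<close>, this is the diagonal and the graph of \<open>swap\<close>.\<close>
  have pair: "\<exists>h\<in>computad_maps \<kappa> N ?P Q. ncompose ?P \<rho> h = nid ?P \<and> ncompose ?P \<rho>' h = c"
    if c: "c \<in> Hom S (?P, ?r) (?P, ?r)" for c
  proof (rule S.product_pairing[OF q obj(1) hom(4) c])
    fix h assume h: "h \<in> Hom S (?P, ?r) q" "Cmp S (?P, ?r) q (?P, ?r) \<rho> h = nid ?P"
      "Cmp S (?P, ?r) q (?P, ?r) \<rho>' h = c"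
    then have "h \<in> computad_maps \<kappa> N ?P Q" using SH[OF nc(2) qQ(1)] unfolding Q by blast
    then show ?thesis using h(2,3) unfolding Q SC by blast
  qed
  obtain h where h: "h \<in> computad_maps \<kappa> N ?P Q" "ncompose ?P \<rho> h = nid ?P" "ncompose ?P \<rho>' h = nid ?P"
    using pair[OF hom(4)] by blast
  obtain h' where h': "h' \<in> computad_maps \<kappa> N ?P Q" "ncompose ?P \<rho> h' = nid ?P" "ncompose ?P \<rho>' h' = ?s"
    using pair[OF hom(5)] by blast
  have "k 3 ?t = ?t" using val[OF h(1,3)] sep h t by (simp del: net_simps)
  moreover have "k 3 ?t = code ({#}, {#1#})"
    using val[OF h'(1,3)] sep h' net_map_code[OF l3 tm, of "\<lambda>s. 1 - s" "\<lambda>t. t"] by simp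
  ultimately show False by simp
qed

end

theorem theorem3p2:
  fixes \<kappa> :: "'u rel"
  assumes "Card_order \<kappa>" and "natLeq <o \<kappa>"
  shows "\<not> locally_cartesian_closed (Comp \<kappa>) \<and>
    (\<forall>n::nat. n > 2 \<longrightarrow> \<not> locally_cartesian_closed (nComp \<kappa> n))"
proof (intro conjI allI impI)
  interpret small_universe \<kappa> by unfold_locales fact+
  show "\<not> locally_cartesian_closed (Comp \<kappa>)"
  proof (rule computad_category.not_locally_cartesian_closed)
    show "computad_category \<kappa> \<infinity> (Comp \<kappa>)"
    proof unfold_locales
      show "Hom (Comp \<kappa>) A B = computad_maps \<kappa> \<infinity> A B" if "computad \<kappa> \<infinity> A" "computad \<kappa> \<infinity> B" for A B
        by (rule Comp_Hom) (use that in \<open>simp_all only: computad_def\<close>)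
    qed (simp_all add: Comp_Obj, simp_all add: Comp_def)
  qed
  fix n :: nat assume n: "n > 2"
  show "\<not> locally_cartesian_closed (nComp \<kappa> n)"
  proof (rule computad_category.not_locally_cartesian_closed)
    show "computad_category \<kappa> (enat n) (nComp \<kappa> n)"
    proof unfold_locales
      show "Hom (nComp \<kappa> n) A B = computad_maps \<kappa> (enat n) A B"
        if "computad \<kappa> (enat n) A" "computad \<kappa> (enat n) B" for A B
        by (rule nComp_Hom) (use that in \<open>simp_all only: computad_def\<close>)
    qed (use n in \<open>simp_all add: nComp_Obj numeral_eq_enat\<close>)
  qed
qed

end
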